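(* There is a constant $C_*>0$ such that the following two assertions hold. (i) For each $\epsilon\in(0,1]$ there exist a bounded, symmetric, uniformly elliptic matrix-valued function $A$ on $\mathbb{T}^2\times\mathbb{R}$ of the block form $A=\begin{pmatrix}A^{(1)}&0\\0&A^{(2)}\end{pmatrix}$ (with $A^{(1)}$ of size $2\times2$, $A^{(2)}$ of size $1\times 1$) satisfying, for some $L>0$, $$|\nabla A(\theta,\varphi,x)|\le \frac{L}{(1+|x|)^{1-\epsilon}}\quad\text{for a.e. }(\theta,\varphi,x)\in\mathbb{T}^2\times\mathbb{R},$$ a bounded, real-valued function $V$ with compact support, a real-valued, nontrivial solution $u$ of $$\operatorname{div}(A\nabla u)=Vu\quad\text{in }\mathbb{T}^2\times\mathbb{R},$$ and constants $c,C>0$ such that for every $(\theta,\varphi,x)\in\mathbb{T}^2\times\mathbb{R}$, $$|u(\theta,\varphi,x)|\le c\exp\{-\exp(C|x|^{\epsilon})\}.$$ (ii) For each $\epsilon\in(0,\tfrac12]$ there exist a bounded, symmetric, uniformly elliptic matrix-valued function $A$ on $\mathbb{T}^2\times\mathbb{R}$ of the same block form satisfying $$|\nabla A(\theta,\varphi,x)|\le \frac{C_*\epsilon^{-1}}{1+|x|}\quad\text{for a.e. }(\theta,\varphi,x)\in\mathbb{T}^2\times\mathbb{R},$$ a bounded, real-valued function $V$ with compact support, a real-valued, nontrivial solution $u$ of $\operatorname{div}(A\nabla u)=Vu$ in $\mathbb{T}^2\times\mathbb{R}$, and constants $c,C_\epsilon>0$ such that for every $(\theta,\varphi,x)\in\mathbb{T}^2\times\mathbb{R}$,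 $$|u(\theta,\varphi,x)|\le c\exp\{-C_\epsilon|x|^{1/\epsilon}\}.$$
   Context: $\mathbb{T}^2=\mathbb{R}^2/(2\pi\mathbb{Z})^2$ with coordinates $(\theta,\varphi)$, and $x\in\mathbb{R}$. $\nabla$ and $\operatorname{div}$ are taken in all three variables. Uniformly elliptic means $A\xi\cdot\xi\ge\Lambda^{-1}|\xi|^2$ for some $\Lambda\ge1$, all $\xi\in\mathbb{R}^3$ and all points. *)

theory Defs
  imports "HOL-Analysis.Analysis"
begin

text \<open>
  A point of the cylinder is a vector \<open>p :: real^3\<close> with \<open>p $ 1\<close>, \<open>p $ 2\<close> the two angles and
  \<open>p $ 3\<close> the real variable \<open>x\<close>. Functions on the cylinder (two-dimensional torus times the
  line) are functions on \<open>real^3\<close> that are \<open>2 * pi\<close>-periodic in the two angles. Integrals over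
  the cylinder are Lebesgue integrals over a fundamental domain.
\<close>

definition torus_periodic :: "(real^3 \<Rightarrow> 'b) \<Rightarrow> bool" where
  "torus_periodic f \<longleftrightarrow>
     (\<forall>p. f (p + (2 * pi) *\<^sub>R axis 1 1) = f p \<and> f (p + (2 * pi) *\<^sub>R axis 2 1) = f p)"

definition cylinder :: "(real^3) set" where
  "cylinder = {p. 0 \<le> p $ 1 \<and> p $ 1 < 2 * pi \<and> 0 \<le> p $ 2 \<and> p $ 2 < 2 * pi}"

definition partial_deriv :: "3 \<Rightarrow> (real^3 \<Rightarrow> 'b::real_normed_vector) \<Rightarrow> real^3 \<Rightarrow> 'b" where
  "partial_deriv i f p = frechet_derivative f (at p) (axis i 1)"

definition grad :: "(real^3 \<Rightarrow> real) \<Rightarrow> real^3 \<Rightarrow> real^3" where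
  "grad f p = (\<chi> i. partial_deriv i f p)"

text \<open>
  The Euclidean norm of all first derivatives of all entries: the norm of \<open>real^3^3\<close> is the
  Frobenius norm. The value is meaningful only where \<open>A\<close> is differentiable.
\<close>

definition matrix_grad_norm :: "(real^3 \<Rightarrow> real^3^3) \<Rightarrow> real^3 \<Rightarrow> real" where
  "matrix_grad_norm A p = sqrt (\<Sum>k\<in>UNIV. (norm (partial_deriv k A p))\<^sup>2)"

primrec C_k :: "nat \<Rightarrow> (real^3 \<Rightarrow> real) \<Rightarrow> bool" where
  "C_k 0 f \<longleftrightarrow> continuous_on UNIV f"
| "C_k (Suc k) f \<longleftrightarrow>
     (\<forall>p. f differentiable (at p)) \<and> (\<forall>i. C_k k (partial_deriv i f))"

text \<open>The torus is compact, so compact support only restricts the third variable.\<close>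

definition compact_support :: "(real^3 \<Rightarrow> real) \<Rightarrow> bool" where
  "compact_support f \<longleftrightarrow> (\<exists>R. \<forall>p. \<bar>p $ 3\<bar> > R \<longrightarrow> f p = 0)"

definition test_function :: "(real^3 \<Rightarrow> real) \<Rightarrow> bool" where
  "test_function \<phi> \<longleftrightarrow> (\<forall>k. C_k k \<phi>) \<and> torus_periodic \<phi> \<and> compact_support \<phi>"

definition L2_loc :: "(real^3 \<Rightarrow> 'b::euclidean_space) \<Rightarrow> bool" where
  "L2_loc f \<longleftrightarrow> f \<in> borel_measurable lebesgue \<and> torus_periodic f \<and>
     (\<forall>R. set_integrable lebesgue (cylinder \<inter> {p. \<bar>p $ 3\<bar> \<le> R}) (\<lambda>p. (norm (f p))\<^sup>2))"

definition weak_gradient :: "(real^3 \<Rightarrow> real) \<Rightarrow> (real^3 \<Rightarrow> real^3) \<Rightarrow> bool" where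
  "weak_gradient u g \<longleftrightarrow>
     (\<forall>\<phi> i. test_function \<phi> \<longrightarrow>
        (LINT p:cylinder|lebesgue. u p * partial_deriv i \<phi> p) =
        - (LINT p:cylinder|lebesgue. g p $ i * \<phi> p))"

text \<open>
  Weak solutions of \<open>div (A grad u) = V u\<close> on the cylinder: \<open>u\<close> and its weak gradient are locally
  square integrable, and the equation holds against test functions after integration by parts.
\<close>

definition weak_solution ::
  "(real^3 \<Rightarrow> real^3^3) \<Rightarrow> (real^3 \<Rightarrow> real) \<Rightarrow> (real^3 \<Rightarrow> real) \<Rightarrow> bool" where
  "weak_solution A V u \<longleftrightarrow> L2_loc u \<and>
     (\<exists>g. L2_loc g \<and> weak_gradient u g \<and>
       (\<forall>\<phi>. test_function \<phi> \<longrightarrow>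
          (LINT p:cylinder|lebesgue. (A p *v g p) \<bullet> grad \<phi> p) =
          - (LINT p:cylinder|lebesgue. V p * u p * \<phi> p)))"

text \<open>
  A pointwise a.e. bound on the derivative of \<open>A\<close> controls \<open>A\<close> only if \<open>A\<close> is locally Lipschitz
  (it would otherwise allow jumps), hence the first clause.
\<close>

definition grad_bounded_by :: "(real^3 \<Rightarrow> real^3^3) \<Rightarrow> (real^3 \<Rightarrow> real) \<Rightarrow> bool" where
  "grad_bounded_by A b \<longleftrightarrow>
     (\<forall>R. \<exists>K. K-lipschitz_on (cball 0 R) A) \<and>
     (AE p in lebesgue. A differentiable (at p) \<and> matrix_grad_norm A p \<le> b p)"

definition uniformly_elliptic :: "(real^3 \<Rightarrow> real^3^3) \<Rightarrow> bool" where
  "uniformly_elliptic A \<longleftrightarrow>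
     (\<exists>\<Lambda>\<ge>1. \<forall>p \<xi>. (A p *v \<xi>) \<bullet> \<xi> \<ge> inverse \<Lambda> * (norm \<xi>)\<^sup>2)"

definition block_form :: "real^3^3 \<Rightarrow> bool" where
  "block_form M \<longleftrightarrow> M $ 1 $ 3 = 0 \<and> M $ 2 $ 3 = 0 \<and> M $ 3 $ 1 = 0 \<and> M $ 3 $ 2 = 0"

definition coefficient_matrix :: "(real^3 \<Rightarrow> real^3^3) \<Rightarrow> bool" where
  "coefficient_matrix A \<longleftrightarrow> torus_periodic A \<and> bounded (range A) \<and>
     (\<forall>p. transpose (A p) = A p) \<and> uniformly_elliptic A \<and> (\<forall>p. block_form (A p))"

definition potential :: "(real^3 \<Rightarrow> real) \<Rightarrow> bool" where
  "potential V \<longleftrightarrow> V \<in> borel_measurable lebesgue \<and> torus_periodic V \<and>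
     bounded (range V) \<and> compact_support V"

text \<open>
  Solutions have continuous representatives; fixing the representative gives pointwise bounds and
  nontriviality their usual meaning.
\<close>

definition nontrivial_solution ::
  "(real^3 \<Rightarrow> real^3^3) \<Rightarrow> (real^3 \<Rightarrow> real) \<Rightarrow> (real^3 \<Rightarrow> real) \<Rightarrow> bool" where
  "nontrivial_solution A V u \<longleftrightarrow>
     weak_solution A V u \<and> continuous_on UNIV u \<and> (\<exists>p. u p \<noteq> 0)"

end

theory Submission
  imports Defs
begin

text \<open>
  The solution is a chain of modes \<open>f j (x) cos (k j \<tau>)\<close> with \<open>k j = 2 ^ j k 0\<close> and \<open>\<tau>\<close> alternately the
  first and the second angle. In the slab \<open>j\<close> the coefficient in the direction of the old mode \<open>j\<close> is
  raised and lowered again, so that this mode first dominates the new mode \<open>j + 1\<close> and is then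
  dominated by it. Each mode is cut on or off while it is dominated; the error in the equation
  is then a small multiple of the dominant mode and is absorbed exactly by a perturbation of the angular
  block of size \<open>O(1 / \<kappa>)\<close>, \<open>\<kappa>\<close> being frequency times slab length. Hence \<open>\<bar>\<nabla>A\<bar> \<le> C / l\<close> on a slab of
  length \<open>l\<close> while the frequency doubles there. Slabs ending at \<open>(i + 1) powr (1 / \<epsilon>)\<close>
  give the first assertion, geometrically growing ones the second. Near \<open>x = 0\<close> only the mode 0 is present;
  \<open>\<bar>x\<bar>\<close> is smoothed there and \<open>V\<close> absorbs the resulting error.
\<close>

section \<open>Integration by parts on the cylinder\<close>

text \<open>A single mode of frequency k decays only like exp (- k |x|), so faster decay forces ever
  higher frequencies, and \<open>V\<close>, being compactly supported, cannot absorb the errors of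
  the exchanges far out. Each error has to be the divergence of \<open>B\<close> applied to the
  gradient of \<open>u\<close>, with \<open>B\<close> symmetric, small and Lipschitz. Two angles
  make this solvable: neighbouring modes have angular gradients along different axes, so each
  angular component of the gradient is a single product. The danger is division by a sine at its
  zeros, or by the weaker mode. A flux with both components divisible by the sine of the dominant
  mode removes it, and the entries left over contain only the ratio weaker/dominant. The two choices
  of slabs answer one question: how often can the frequency double before |x|? If slab lengths are
  comparable to |x|^(1 - \<epsilon>), about |x|^\<epsilon> times, which gives a double exponential.
  If slab ends grow by a factor \<rho>, only about log |x| / log \<rho> times, which gives a power
  of |x| in the exponent; as \<rho> - 1 is of order \<epsilon>, position over length is of order 1 /
  \<epsilon>, the origin of that factor in the gradient bound.\<close>

lemma lborel_vec3:
  fixes i j k :: 3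
  assumes "i \<noteq> j" "j \<noteq> k" "i \<noteq> k"
  shows "(lborel :: (real^3) measure) =
    distr ((lborel \<Otimes>\<^sub>M lborel) \<Otimes>\<^sub>M (lborel :: real measure)) borel
      (\<lambda>z. fst (fst z) *\<^sub>R axis j 1 + snd (fst z) *\<^sub>R axis k 1 + snd z *\<^sub>R axis i 1)"
    (is "_ = distr ?M _ ?T")
proof (rule lborel_eqI)
  have meas: "?T \<in> borel_measurable ?M"
    by (simp add: lborel_prod, intro borel_measurable_continuous_onI continuous_intros)
  have U: "(UNIV :: 3 set) = {i, j, k}"
    using assms exhaust_3[of i] exhaust_3[of j] exhaust_3[of k] UNIV_3 by auto
  have B: "(Basis :: (real^3) set) = (\<lambda>m. axis m 1) ` UNIV"
    by (auto simp: Basis_vec_def)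
  have inj: "inj (\<lambda>m::3. axis m (1::real))"
    by (auto simp: inj_on_def axis_eq_axis)
  fix l u :: "real^3"
  assume le: "\<And>b. b \<in> Basis \<Longrightarrow> l \<bullet> b \<le> u \<bullet> b"
  have le': "l $ m \<le> u $ m" for m
    using le[of "axis m 1"] by (auto simp: inner_axis B)
  have vim: "?T -` box l u \<inter> space ?M =
      ({l $ j<..<u $ j} \<times> {l $ k<..<u $ k}) \<times> {l $ i<..<u $ i}"
  proof -
    have all: "(\<forall>m. P m) \<longleftrightarrow> P i \<and> P j \<and> P k" for P :: "3 \<Rightarrow> bool"
      using U by (metis (full_types) UNIV_I empty_iff insert_iff)
    have ax: "axis m (1::real) $ n = (if n = m then 1 else 0)" for m n :: 3
      by (simp add: axis_def)
    show ?thesis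
      using assms by (auto simp: space_pair_measure mem_box_cart all ax)
  qed
  have "emeasure (distr ?M borel ?T) (box l u) = emeasure ?M (({l $ j<..<u $ j} \<times> {l $ k<..<u $ k}) \<times> {l $ i<..<u $ i})"
    by (subst emeasure_distr[OF meas]) (simp_all add: vim)
  also have "\<dots> = ennreal (u $ j - l $ j) * ennreal (u $ k - l $ k) * ennreal (u $ i - l $ i)"
    by (simp add: lborel.emeasure_pair_measure_Times sigma_finite_measure.emeasure_pair_measure_Times[OF sigma_finite_lborel] le')
  also have "\<dots> = ennreal (\<Prod>b\<in>Basis. (u - l) \<bullet> b)"
    unfolding B prod.reindex[OF inj] using assms le'
    by (simp add: U inner_axis mult_ac flip: ennreal_mult)
  finally show "emeasure (distr ?M borel ?T) (box l u) = ennreal (\<Prod>b\<in>Basis. (u - l) \<bullet> b)" .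
qed simp

lemma cylinder_measurable [measurable]: "cylinder \<in> sets borel"
  unfolding cylinder_def by measurable

lemma cylinder_slab_subset_cbox:
  "cylinder \<inter> {p. \<bar>p $ 3\<bar> \<le> R} \<subseteq> cbox (vector [0, 0, -R]) (vector [2 * pi, 2 * pi, R])"
  unfolding cylinder_def by (auto simp: mem_box_cart forall_3)

lemma integrable_cylinder:
  fixes f :: "real^3 \<Rightarrow> real"
  assumes "continuous_on UNIV f" "compact_support f"
  shows "integrable lborel (\<lambda>p. indicator cylinder p *\<^sub>R f p)"
    and "set_integrable lebesgue cylinder f"
proof -
  obtain R where R: "\<And>p. \<bar>p $ 3\<bar> > R \<Longrightarrow> f p = 0"
    using assms(2) by (auto simp: compact_support_def)
  define K where "K = cbox (vector [0, 0, -R]) (vector [2 * pi, 2 * pi, R] :: real^3)"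
  have "integrable lborel (\<lambda>p. indicator K p *\<^sub>R f p)"
    unfolding K_def by (intro borel_integrable_compact compact_cbox continuous_on_subset[OF assms(1)]) auto
  then have "integrable lborel (\<lambda>p. indicator cylinder p *\<^sub>R (indicator K p *\<^sub>R f p))"
    by (rule integrable_mult_indicator[rotated]) (simp add: cylinder_measurable)
  moreover have "indicator cylinder p *\<^sub>R (indicator K p *\<^sub>R f p) = indicator cylinder p *\<^sub>R f p" for p
    using R[of p] cylinder_slab_subset_cbox[of R]
    by (cases "\<bar>p $ 3\<bar> > R") (auto simp: indicator_def K_def)
  ultimately show *: "integrable lborel (\<lambda>p. indicator cylinder p *\<^sub>R f p)" by (simp only:)
  then show "set_integrable lebesgue cylinder f"
    unfolding set_integrable_def by (subst integrable_completion) auto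
qed

text \<open>Fubini, with the direction of differentiation innermost.\<close>

lemma integral_cylinder_derivative:
  fixes w D :: "real^3 \<Rightarrow> real"
  assumes D: "continuous_on UNIV D"
    and deriv: "\<And>p. ((\<lambda>s. w (p + s *\<^sub>R axis i 1)) has_real_derivative D p) (at 0)"
    and per: "torus_periodic w" and supp: "compact_support w" "compact_support D"
  shows "(LINT p:cylinder|lebesgue. D p) = 0"
proof -
  obtain j k :: 3 where jk: "i \<noteq> j" "j \<noteq> k" "i \<noteq> k"
  proof -
    have "i = 1 \<or> i = 2 \<or> i = 3" "(1::3) \<noteq> 2" "(2::3) \<noteq> 3" "(1::3) \<noteq> 3"
      using exhaust_3 by auto
    then show thesis using that[of 1 2] that[of 2 3] that[of 3 1] by metis
  qed
  let ?T = "\<lambda>z. fst (fst z) *\<^sub>R axis j 1 + snd (fst z) *\<^sub>R axis k 1 + snd z *\<^sub>R axis i 1 :: real^3"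
  let ?f = "\<lambda>p. indicator cylinder p *\<^sub>R D p"
  have U: "(UNIV :: 3 set) = {i, j, k}"
    using jk exhaust_3[of i] exhaust_3[of j] exhaust_3[of k] UNIV_3 by auto
  have all: "(\<forall>m. P m) \<longleftrightarrow> P i \<and> P j \<and> P k" for P :: "3 \<Rightarrow> bool"
    using U by (metis (full_types) UNIV_I empty_iff insert_iff)
  have int: "integrable lborel ?f"
    by (rule integrable_cylinder[OF D supp(2)])
  have meas: "?T \<in> borel_measurable ((lborel \<Otimes>\<^sub>M lborel) \<Otimes>\<^sub>M lborel)"
    by (simp add: lborel_prod, intro borel_measurable_continuous_onI continuous_intros)
  have mf: "?f \<in> borel_measurable borel"
    using int by (auto dest: borel_measurable_integrable)
  obtain R0 where R0: "\<And>p. \<bar>p $ 3\<bar> > R0 \<Longrightarrow> w p = 0"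
    using supp(1) by (auto simp: compact_support_def)
  obtain R1 where R1: "\<And>p. \<bar>p $ 3\<bar> > R1 \<Longrightarrow> D p = 0"
    using supp(2) by (auto simp: compact_support_def)
  define R where "R = max 1 (max (R0 + 1) (R1 + 1))"
  have R: "R > R0" "R > R1" "R > 0" by (auto simp: R_def)
  \<comment> \<open>Direction 3 uses an interval reaching beyond both supports, where
    \<open>w\<close> vanishes; an angle uses a full period. Either way the two end values of
    \<open>w\<close> agree.\<close>
  define a b where "a = (if i = 3 then - R else 0)" and "b = (if i = 3 then R else 2 * pi)"
  have ab: "a \<le> b" using R by (auto simp: a_def b_def)
  have inner: "(\<integral>s. ?f (?T (q, s)) \<partial>lborel) = 0" for q
  proof -
    let ?p = "\<lambda>s. ?T (q, s)"
    have dW: "((\<lambda>s. w (?p s)) has_real_derivative D (?p s)) (at s)" for s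
    proof -
      have "((\<lambda>h. w (?p (s + h))) has_real_derivative D (?p s)) (at 0)"
        using deriv[of "?p s"] by (simp add: algebra_simps)
      then show ?thesis
        using DERIV_shift[of "\<lambda>s. w (?p s)" "D (?p s)" 0 s] by (simp only: add.commute[of _ s] add_0_right)
    qed
    have cW: "continuous_on {a..b} (\<lambda>s. D (?p s))"
      by (intro continuous_on_compose2[OF D] continuous_intros) auto
    have ends: "w (?p b) = w (?p a)"
    proof (cases "i = 3")
      case True
      then show ?thesis using R R0[of "?p a"] R0[of "?p b"] jk
        by (simp add: a_def b_def axis_def)
    next
      case False
      then have "i = 1 \<or> i = 2" using exhaust_3[of i] by auto
      then have "w (?p 0 + (2 * pi) *\<^sub>R axis i 1) = w (?p 0)"
        using per by (auto simp: torus_periodic_def)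
      then show ?thesis using False by (simp add: a_def b_def)
    qed
    have FTC: "(\<integral>s. indicator {a..b} s *\<^sub>R D (?p s) \<partial>lborel) = 0"
      using integral_FTC_atLeastAtMost[OF ab _ cW, of "\<lambda>s. w (?p s)"] dW ends
      by (simp add: has_real_derivative_iff_has_vector_derivative has_vector_derivative_at_within)
    define c where "c \<longleftrightarrow> (j \<noteq> 3 \<longrightarrow> 0 \<le> fst q \<and> fst q < 2 * pi) \<and> (k \<noteq> 3 \<longrightarrow> 0 \<le> snd q \<and> snd q < 2 * pi)"
    have comp: "?p s $ i = s" "?p s $ j = fst q" "?p s $ k = snd q" for s
      using jk by (auto simp: axis_def)
    have cyl: "?p s \<in> cylinder \<longleftrightarrow> c \<and> (i \<noteq> 3 \<longrightarrow> 0 \<le> s \<and> s < 2 * pi)" for s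
    proof -
      have iff: "p \<in> cylinder \<longleftrightarrow> (\<forall>m. m \<noteq> 3 \<longrightarrow> 0 \<le> p $ m \<and> p $ m < 2 * pi)" for p
        by (simp add: cylinder_def forall_3)
      show ?thesis unfolding iff[of "?p s"] all c_def comp by blast
    qed
    \<comment> \<open>The cylinder is half-open in an angular direction while the fundamental
      theorem needs a closed interval; the end point \<open>b\<close> is a null set.\<close>
    have "AE s in lborel. s \<noteq> b" by (rule AE_lborel_singleton)
    then have ae: "AE s in lborel. ?f (?p s) = of_bool c *\<^sub>R (indicator {a..b} s *\<^sub>R D (?p s))"
    proof eventually_elim
      case (elim s)
      have gen: "indicator cylinder P *\<^sub>R D P = of_bool c *\<^sub>R (indicator {a..b} s *\<^sub>R D P)"
        if "P \<in> cylinder \<longleftrightarrow> c \<and> (i \<noteq> 3 \<longrightarrow> 0 \<le> s \<and> s < 2 * pi)" "i = 3 \<Longrightarrow> \<bar>s\<bar> > R1 \<Longrightarrow> D P = 0" for P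
        using that elim R by (cases "i = 3"; cases "R1 < \<bar>s\<bar>") (auto simp: a_def b_def indicator_def)
      show ?case
        by (rule gen[OF cyl]) (use R1[of "?p s"] comp(1)[of s] in simp)
    qed
    have mp: "?p \<in> borel_measurable borel"
      by (intro borel_measurable_continuous_onI continuous_intros)
    have mDp: "(\<lambda>s. D (?p s)) \<in> borel_measurable lborel"
      using measurable_compose[OF mp] borel_measurable_continuous_onI[OF D] by simp
    have "(\<integral>s. ?f (?p s) \<partial>lborel) = (\<integral>s. of_bool c *\<^sub>R (indicator {a..b} s *\<^sub>R D (?p s)) \<partial>lborel)"
      using measurable_compose[OF mp] mf mDp by (intro integral_cong_AE ae) simp_all
    also have "\<dots> = 0" using FTC by simp
    finally show ?thesis .
  qed
  have "(LINT p:cylinder|lebesgue. D p) = (\<integral>p. ?f p \<partial>lborel)"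
    unfolding set_lebesgue_integral_def using mf by (subst integral_completion) auto
  also have "\<dots> = (\<integral>z. ?f (?T z) \<partial>((lborel \<Otimes>\<^sub>M lborel) \<Otimes>\<^sub>M lborel))"
    unfolding lborel_vec3[OF jk] by (rule integral_distr[OF meas mf])
  also have "\<dots> = (\<integral>q. (\<integral>s. ?f (?T (q, s)) \<partial>lborel) \<partial>(lborel \<Otimes>\<^sub>M lborel))"
  proof (rule pair_sigma_finite.integral_fst'[symmetric])
    show "pair_sigma_finite ((lborel :: real measure) \<Otimes>\<^sub>M (lborel :: real measure)) (lborel :: real measure)"
      unfolding lborel_prod by (simp add: pair_sigma_finite_def sigma_finite_lborel)
    show "integrable ((lborel \<Otimes>\<^sub>M lborel) \<Otimes>\<^sub>M lborel) (\<lambda>z. ?f (?T z))"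
      using int integrable_distr_eq[OF meas mf] unfolding lborel_vec3[OF jk] by simp
  qed
  also have "\<dots> = 0" by (simp only: inner Bochner_Integration.integral_zero)
  finally show ?thesis .
qed

lemma test_functionD:
  assumes "test_function \<phi>"
  shows "continuous_on UNIV \<phi>" "continuous_on UNIV (partial_deriv i \<phi>)"
    "torus_periodic \<phi>" "compact_support \<phi>" "compact_support (partial_deriv i \<phi>)"
    "((\<lambda>s. \<phi> (p + s *\<^sub>R axis i 1)) has_real_derivative partial_deriv i \<phi> p) (at 0)"
proof -
  have C: "C_k 0 \<phi>" "C_k (Suc 0) \<phi>"
    and "torus_periodic \<phi>" "compact_support \<phi>"
    using assms by (auto simp: test_function_def)
  then show "continuous_on UNIV \<phi>" "continuous_on UNIV (partial_deriv i \<phi>)"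
    "torus_periodic \<phi>" "compact_support \<phi>" by auto
  have "\<phi> differentiable (at p)" for p using C by auto
  then have hd: "(\<phi> has_derivative frechet_derivative \<phi> (at p)) (at p)" for p
    by (simp add: frechet_derivative_works)
  have line: "((\<lambda>s::real. p + s *\<^sub>R axis i 1 :: real^3) has_derivative (\<lambda>s. s *\<^sub>R axis i 1)) (at 0)" for p
    by (auto intro!: derivative_eq_intros)
  have dir: "((\<lambda>s. \<phi> (p + s *\<^sub>R axis i 1)) has_real_derivative partial_deriv i \<phi> p) (at 0)" for p
  proof -
    have "((\<lambda>s. \<phi> (p + s *\<^sub>R axis i 1)) has_derivative (\<lambda>s. frechet_derivative \<phi> (at p) (s *\<^sub>R axis i 1))) (at 0)"
      using has_derivative_compose[OF line, of \<phi> "frechet_derivative \<phi> (at p)" p] hd[of p] by simp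
    moreover have "linear (frechet_derivative \<phi> (at p))"
      using hd[of p] has_derivative_linear by blast
    ultimately show ?thesis
      by (simp add: has_field_derivative_def partial_deriv_def linear_cmul mult_commute_abs)
  qed
  then show "((\<lambda>s. \<phi> (p + s *\<^sub>R axis i 1)) has_real_derivative partial_deriv i \<phi> p) (at 0)" .
  obtain R where R: "\<And>p. \<bar>p $ 3\<bar> > R \<Longrightarrow> \<phi> p = 0"
    using \<open>compact_support \<phi>\<close> by (auto simp: compact_support_def)
  have "partial_deriv i \<phi> p = 0" if "\<bar>p $ 3\<bar> > R" for p
  proof -
    have op: "open {q :: real^3. \<bar>q $ 3\<bar> > R}"
      by (intro open_Collect_less continuous_intros)
    have "(\<phi> has_derivative (\<lambda>_. 0)) (at p)"
      by (rule has_derivative_transform_within_open[OF _ op, of "\<lambda>_. 0"]) (use that R in auto)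
    then show ?thesis
      using frechet_derivative_at[of \<phi> "\<lambda>_. 0" p] by (metis partial_deriv_def)
  qed
  then show "compact_support (partial_deriv i \<phi>)"
    unfolding compact_support_def by blast
qed

lemma compact_support_mult:
  "compact_support f \<Longrightarrow> compact_support (\<lambda>p. h p * f p)"
  by (auto simp: compact_support_def)

lemma compact_support_add:
  assumes "compact_support f" "compact_support h"
  shows "compact_support (\<lambda>p. f p + h p)"
proof -
  obtain R S where "\<And>p. \<bar>p $ 3\<bar> > R \<Longrightarrow> f p = 0" "\<And>p. \<bar>p $ 3\<bar> > S \<Longrightarrow> h p = 0"
    using assms by (auto simp: compact_support_def)
  then show ?thesis
    unfolding compact_support_def by (intro exI[of _ "max R S"]) auto
qed

lemma integration_by_parts_cylinder:
  fixes w D \<phi> :: "real^3 \<Rightarrow> real"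
  assumes cw: "continuous_on UNIV w" and cD: "continuous_on UNIV D"
    and deriv: "\<And>p. ((\<lambda>s. w (p + s *\<^sub>R axis i 1)) has_real_derivative D p) (at 0)"
    and per: "torus_periodic w" and \<phi>: "test_function \<phi>"
  shows "(LINT p:cylinder|lebesgue. w p * partial_deriv i \<phi> p) = - (LINT p:cylinder|lebesgue. D p * \<phi> p)"
proof -
  note t = test_functionD[OF \<phi>]
  have "(LINT p:cylinder|lebesgue. w p * partial_deriv i \<phi> p + D p * \<phi> p) = 0"
  proof (rule integral_cylinder_derivative[of _ "\<lambda>p. w p * \<phi> p" i])
    show "continuous_on UNIV (\<lambda>p. w p * partial_deriv i \<phi> p + D p * \<phi> p)"
      by (intro continuous_intros cw cD t)
    show "((\<lambda>s. w (p + s *\<^sub>R axis i 1) * \<phi> (p + s *\<^sub>R axis i 1)) has_real_derivative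
        w p * partial_deriv i \<phi> p + D p * \<phi> p) (at 0)" for p
      using DERIV_mult[OF deriv[of p] t(6)[of p i]] by (simp add: algebra_simps)
    show "torus_periodic (\<lambda>p. w p * \<phi> p)"
      using per t(3) by (simp add: torus_periodic_def)
  qed (intro compact_support_add compact_support_mult t)+
  moreover have "set_integrable lebesgue cylinder (\<lambda>p. w p * partial_deriv i \<phi> p)"
    "set_integrable lebesgue cylinder (\<lambda>p. D p * \<phi> p)"
    by (intro integrable_cylinder continuous_intros compact_support_mult cw cD t)+
  ultimately show ?thesis
    by (simp add: set_integral_add(2))
qed

lemma set_integral_sum:
  fixes f :: "'i \<Rightarrow> 'a \<Rightarrow> 'b::{banach, second_countable_topology}"
  assumes "\<And>i. i \<in> I \<Longrightarrow> set_integrable M A (f i)"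
  shows "(LINT x:A|M. (\<Sum>i\<in>I. f i x)) = (\<Sum>i\<in>I. LINT x:A|M. f i x)"
  using assms unfolding set_lebesgue_integral_def set_integrable_def scaleR_sum_right
  by (intro Bochner_Integration.integral_sum)

lemma L2_locI:
  fixes f :: "real^3 \<Rightarrow> 'b::euclidean_space"
  assumes "continuous_on UNIV f" "torus_periodic f"
  shows "L2_loc f"
proof -
  have "f \<in> borel_measurable lborel"
    unfolding measurable_lborel2 by (rule borel_measurable_continuous_onI[OF assms(1)])
  then have "f \<in> borel_measurable lebesgue"
    by (rule measurable_completion)
  moreover have "set_integrable lebesgue (cylinder \<inter> {p. \<bar>p $ 3\<bar> \<le> R}) (\<lambda>p. (norm (f p))\<^sup>2)" for R
  proof -
    define K where "K = cbox (vector [0, 0, -R]) (vector [2 * pi, 2 * pi, R] :: real^3)"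
    have "set_integrable lborel K (\<lambda>p. (norm (f p))\<^sup>2)"
      unfolding set_integrable_def K_def
      by (rule borel_integrable_compact[OF compact_cbox])
        (intro continuous_intros continuous_on_subset[OF assms(1)] subset_UNIV)
    moreover have "cylinder \<inter> {p. \<bar>p $ 3\<bar> \<le> R} \<in> sets lborel"
      unfolding sets_lborel
      by (intro sets.Int cylinder_measurable borel_closed closed_Collect_le continuous_intros)
    moreover have "cylinder \<inter> {p. \<bar>p $ 3\<bar> \<le> R} \<subseteq> K"
      unfolding K_def by (rule cylinder_slab_subset_cbox)
    ultimately have "set_integrable lborel (cylinder \<inter> {p. \<bar>p $ 3\<bar> \<le> R}) (\<lambda>p. (norm (f p))\<^sup>2)"
      by (rule set_integrable_subset)
    then show ?thesis
      unfolding set_integrable_def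
      by (subst integrable_completion) (simp_all only: borel_measurable_integrable)
  qed
  ultimately show ?thesis
    using assms(2) unfolding L2_loc_def by blast
qed

text \<open>Only directional derivatives enter, so \<open>g\<close> and the flux need not be differentiable jointly.\<close>

lemma weak_solutionI:
  fixes u :: "real^3 \<Rightarrow> real" and g :: "real^3 \<Rightarrow> real^3" and D :: "3 \<Rightarrow> real^3 \<Rightarrow> real"
  assumes cu: "continuous_on UNIV u" "torus_periodic u"
    and cg: "continuous_on UNIV g" "torus_periodic g"
    and dg: "\<And>i p. ((\<lambda>s. u (p + s *\<^sub>R axis i 1)) has_real_derivative g p $ i) (at 0)"
    and cflux: "continuous_on UNIV (\<lambda>p. A p *v g p)" "torus_periodic A"
    and cD: "\<And>i. continuous_on UNIV (D i)"
    and dflux: "\<And>i p. ((\<lambda>s. (A (p + s *\<^sub>R axis i 1) *v g (p + s *\<^sub>R axis i 1)) $ i) has_real_derivative D i p) (at 0)"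
    and eq: "\<And>p. (\<Sum>i\<in>UNIV. D i p) = V p * u p"
  shows "weak_solution A V u"
  unfolding weak_solution_def
proof (intro conjI exI[of _ g] allI impI)
  show "L2_loc u" "L2_loc g"
    by (intro L2_locI cu cg)+
  show "weak_gradient u g"
    unfolding weak_gradient_def
    by (intro allI impI integration_by_parts_cylinder cu dg continuous_intros cg) auto
  fix \<phi> assume \<phi>: "test_function \<phi>"
  note t = test_functionD[OF \<phi>]
  define F where "F p = A p *v g p" for p
  have cF: "continuous_on UNIV (\<lambda>p. F p $ i)" for i
    unfolding F_def by (intro continuous_intros cflux)
  have perF: "torus_periodic (\<lambda>p. F p $ i)" for i
    using cg(2) cflux(2) by (simp add: torus_periodic_def F_def)
  have "(LINT p:cylinder|lebesgue. F p \<bullet> grad \<phi> p) = (LINT p:cylinder|lebesgue. (\<Sum>i\<in>UNIV. F p $ i * partial_deriv i \<phi> p))"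
    by (simp add: inner_vec_def grad_def)
  also have "\<dots> = (\<Sum>i\<in>UNIV. (LINT p:cylinder|lebesgue. F p $ i * partial_deriv i \<phi> p))"
    by (rule set_integral_sum) (auto intro!: integrable_cylinder continuous_intros compact_support_mult cF t)
  also have "\<dots> = (\<Sum>i\<in>UNIV. - (LINT p:cylinder|lebesgue. D i p * \<phi> p))"
    by (intro sum.cong refl integration_by_parts_cylinder cF cD perF \<phi> dflux[folded F_def])
  also have "\<dots> = - (LINT p:cylinder|lebesgue. (\<Sum>i\<in>UNIV. D i p * \<phi> p))"
    by (subst set_integral_sum)
      (auto intro!: integrable_cylinder continuous_intros compact_support_mult cD t simp: sum_negf)
  also have "\<dots> = - (LINT p:cylinder|lebesgue. V p * u p * \<phi> p)"
    by (simp add: eq flip: sum_distrib_right)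
  finally show "(LINT p:cylinder|lebesgue. (A p *v g p) \<bullet> grad \<phi> p) = - (LINT p:cylinder|lebesgue. V p * u p * \<phi> p)"
    by (simp add: F_def)
qed

section \<open>Cut-offs and profiles\<close>

definition clip :: "real \<Rightarrow> real" where "clip t = max 0 (min 1 t)"

lemma clip_simps [simp]:
  "t \<le> 0 \<Longrightarrow> clip t = 0" "1 \<le> t \<Longrightarrow> clip t = 1" "0 \<le> t \<Longrightarrow> t \<le> 1 \<Longrightarrow> clip t = t"
  and clip_range: "0 \<le> clip t" "clip t \<le> 1"
  by (auto simp: clip_def)

lemma continuous_clip [continuous_intros]: "continuous_on S f \<Longrightarrow> continuous_on S (\<lambda>x. clip (f x))"
  unfolding clip_def by (intro continuous_intros)

lemma bounded_comp_clip:
  assumes "continuous_on UNIV (q :: real \<Rightarrow> real)"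
  shows "\<exists>B. \<forall>t. \<bar>q (clip t)\<bar> \<le> B"
proof -
  have "compact (q ` {0..1})"
    by (intro compact_continuous_image continuous_on_subset[OF assms]) auto
  then have "bounded (q ` {0..1})" by (rule compact_imp_bounded)
  then obtain B where "\<forall>s\<in>{0..1}. \<bar>q s\<bar> \<le> B"
    by (auto simp: bounded_iff)
  then show ?thesis
    by (intro exI[of _ B]) (simp add: clip_range)
qed

text \<open>Since \<open>clip\<close> is 1-Lipschitz, a vanishing derivative at the ends survives the composition.\<close>

lemma DERIV_comp_clip:
  assumes "\<And>s. (q has_real_derivative q' s) (at s)" "t \<le> 0 \<Longrightarrow> q' 0 = 0" "1 \<le> t \<Longrightarrow> q' 1 = 0"
  shows "((\<lambda>t. q (clip t)) has_real_derivative q' (clip t)) (at t)"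
proof (cases "0 < t \<and> t < 1")
  case True
  have "((\<lambda>t. q (clip t)) has_real_derivative q' t) (at t)"
    by (rule DERIV_cong_ev[THEN iffD1, OF refl _ refl assms(1)])
      (use True in \<open>auto intro: eventually_mono[OF eventually_conj[OF eventually_gt_at_top eventually_gt_at_top]]
         simp: eventually_nhds intro!: exI[of _ "{0<..<1}"]\<close>)
  then show ?thesis using True by simp
next
  case False
  then have z: "q' (clip t) = 0" using assms(2,3) by (cases "t \<le> 0") auto
  have lip: "\<bar>clip s - clip t\<bar> \<le> \<bar>s - t\<bar>" for s by (auto simp: clip_def)
  have "(q has_derivative (\<lambda>_. 0)) (at (clip t))"
    using assms(1)[of "clip t"] z by (simp add: has_field_derivative_def mult_commute_abs lambda_zero)
  then have small: "\<exists>d>0. \<forall>y. \<bar>y - clip t\<bar> < d \<longrightarrow> \<bar>q y - q (clip t)\<bar> \<le> e * \<bar>y - clip t\<bar>" if "e > 0" for e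
    using that unfolding has_derivative_at_alt by simp
  have "((\<lambda>t. q (clip t)) has_derivative (\<lambda>_. 0)) (at t)"
    unfolding has_derivative_at_alt
  proof (intro conjI allI impI)
    fix e :: real assume e: "0 < e"
    then obtain d where d: "d > 0" "\<And>y. \<bar>y - clip t\<bar> < d \<Longrightarrow> \<bar>q y - q (clip t)\<bar> \<le> e * \<bar>y - clip t\<bar>"
      using small by blast
    show "\<exists>d>0. \<forall>y. norm (y - t) < d \<longrightarrow> norm (q (clip y) - q (clip t) - 0) \<le> e * norm (y - t)"
    proof (intro exI[of _ d] conjI allI impI d)
      fix y assume "norm (y - t) < d"
      then have "\<bar>q (clip y) - q (clip t)\<bar> \<le> e * \<bar>clip y - clip t\<bar>"
        using d(2)[of "clip y"] lip[of y] by auto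
      also have "\<dots> \<le> e * \<bar>y - t\<bar>" using lip e by (intro mult_left_mono) auto
      finally show "norm (q (clip y) - q (clip t) - 0) \<le> e * norm (y - t)" by simp
    qed
  qed simp
  then show ?thesis using z by (simp add: has_field_derivative_def lambda_zero)
qed

text \<open>The septic smoothstep: its derivative is 140 c^3 (1 - c)^3, with 140 normalizing the
  integral to 1. Derivatives up to the third vanish at the ends, because the switching errors
  contain \<open>ramp2\<close> and the gradient of the matrix differentiates them once more.\<close>

definition ramp :: "real \<Rightarrow> real" where
  "ramp t = (let c = clip t in 35 * c ^ 4 - 84 * c ^ 5 + 70 * c ^ 6 - 20 * c ^ 7)"
definition ramp1 :: "real \<Rightarrow> real" where
  "ramp1 t = (let c = clip t in 140 * c ^ 3 * (1 - c) ^ 3)"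
definition ramp2 :: "real \<Rightarrow> real" where
  "ramp2 t = (let c = clip t in 420 * c\<^sup>2 * (1 - c)\<^sup>2 * (1 - 2 * c))"
definition ramp3 :: "real \<Rightarrow> real" where
  "ramp3 t = (let c = clip t in 840 * c * (1 - c) * (1 - 5 * c + 5 * c\<^sup>2))"

lemma DERIV_ramp: "(ramp has_real_derivative ramp1 t) (at t)"
  unfolding ramp_def ramp1_def Let_def
  by (rule DERIV_comp_clip) (auto intro!: derivative_eq_intros simp: power_numeral_reduce algebra_simps)

lemma DERIV_ramp1: "(ramp1 has_real_derivative ramp2 t) (at t)"
  unfolding ramp1_def ramp2_def Let_def
  by (rule DERIV_comp_clip) (auto intro!: derivative_eq_intros simp: power_numeral_reduce algebra_simps)

lemma DERIV_ramp2: "(ramp2 has_real_derivative ramp3 t) (at t)"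
  unfolding ramp2_def ramp3_def Let_def
  by (rule DERIV_comp_clip) (auto intro!: derivative_eq_intros simp: power_numeral_reduce algebra_simps)

lemma ramp_simps [simp]:
  "t \<le> 0 \<Longrightarrow> ramp t = 0" "1 \<le> t \<Longrightarrow> ramp t = 1"
  "t \<le> 0 \<Longrightarrow> ramp1 t = 0" "1 \<le> t \<Longrightarrow> ramp1 t = 0"
  "t \<le> 0 \<Longrightarrow> ramp2 t = 0" "1 \<le> t \<Longrightarrow> ramp2 t = 0"
  "t \<le> 0 \<Longrightarrow> ramp3 t = 0" "1 \<le> t \<Longrightarrow> ramp3 t = 0"
  by (auto simp: ramp_def ramp1_def ramp2_def ramp3_def)

lemma ramp_range: "0 \<le> ramp t" "ramp t \<le> 1"
proof -
  have mono: "ramp s \<le> ramp t" if "s \<le> t" for s t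
    by (rule DERIV_nonneg_imp_nondecreasing[OF that])
      (auto intro!: exI[of _ "ramp1 _"] DERIV_ramp simp: ramp1_def Let_def clip_range)
  show "0 \<le> ramp t" using mono[of "min 0 t" t] by simp
  show "ramp t \<le> 1" using mono[of t "max 1 t"] by simp
qed

lemma ramps_bounded: "\<exists>B. \<forall>t. \<bar>ramp1 t\<bar> \<le> B \<and> \<bar>ramp2 t\<bar> \<le> B \<and> \<bar>ramp3 t\<bar> \<le> B"
proof -
  have "\<exists>B. \<forall>t. \<bar>ramp1 t\<bar> \<le> B" "\<exists>B. \<forall>t. \<bar>ramp2 t\<bar> \<le> B" "\<exists>B. \<forall>t. \<bar>ramp3 t\<bar> \<le> B"
    unfolding ramp1_def ramp2_def ramp3_def Let_def
    by (rule bounded_comp_clip, intro continuous_intros)+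
  then obtain B1 B2 B3 where "\<And>t. \<bar>ramp1 t\<bar> \<le> B1" "\<And>t. \<bar>ramp2 t\<bar> \<le> B2" "\<And>t. \<bar>ramp3 t\<bar> \<le> B3"
    by blast
  then show ?thesis
    by (intro exI[of _ "max B1 (max B2 B3)"]) (simp add: max.coboundedI1 max.coboundedI2 le_max_iff_disj)
qed

text \<open>
  On a slab, with \<open>s \<in> [0, 1]\<close> and \<open>\<kappa>\<close> the frequency times the length of the slab, the old mode decays
  like \<open>exp (- \<kappa> \<integral> rate)\<close> and the new one like \<open>exp (- 2 \<kappa> s)\<close>, so their ratio is \<open>exp (\<kappa> gain)\<close>:
  the old mode dominates for \<open>s \<le> 1/2\<close>, the new one for \<open>s \<ge> 1/2\<close>. The factor \<open>8 / 3\<close> makes \<open>gain\<close>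
  vanish at both ends, and the fourth power makes \<open>rate\<close> flat there.
\<close>

definition rate :: "real \<Rightarrow> real" where "rate s = 1 + 8 / 3 * sin (pi * s) ^ 4"
definition rate1 :: "real \<Rightarrow> real" where "rate1 s = 32 / 3 * pi * sin (pi * s) ^ 3 * cos (pi * s)"
definition rate2 :: "real \<Rightarrow> real" where
  "rate2 s = 32 / 3 * pi\<^sup>2 * (3 * sin (pi * s) ^ 2 * cos (pi * s) ^ 2 - sin (pi * s) ^ 4)"
definition gain :: "real \<Rightarrow> real" where "gain s = sin (2 * pi * s) * (4 - cos (2 * pi * s)) / (6 * pi)"

lemma DERIV_rate: "(rate has_real_derivative rate1 s) (at s)"
  unfolding rate_def[abs_def] rate1_def
  by (auto intro!: derivative_eq_intros simp: power_numeral_reduce)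

lemma DERIV_rate1: "(rate1 has_real_derivative rate2 s) (at s)"
  unfolding rate1_def[abs_def] rate2_def
  by (auto intro!: derivative_eq_intros simp: power_numeral_reduce field_simps)

text \<open>Everything is a polynomial in c = cos (2 pi s): sin^4 (pi s) = (1 - c)^2 / 4, and c (4 -
  c) + (1 - c^2) = 1 + 4 c - 2 c^2 is three times 2 - \<open>rate s\<close>.\<close>

lemma DERIV_gain: "(gain has_real_derivative 2 - rate s) (at s)"
proof -
  have "cos (2 * pi * s) = 1 - 2 * (sin (pi * s))\<^sup>2"
    using cos_double_sin[of "pi * s"] by (simp add: mult.assoc)
  moreover have "(sin (2 * pi * s))\<^sup>2 = 1 - (cos (2 * pi * s))\<^sup>2"
    by (simp add: sin_squared_eq)
  moreover have "c * (4 - c) + z = 3 * (2 - (1 + 8 / 3 * x ^ 4))"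
    if "c = 1 - 2 * x\<^sup>2" "z = 1 - c\<^sup>2" for c z x :: real
    unfolding that by (simp add: power2_eq_square power4_eq_xxxx algebra_simps)
  ultimately have key: "cos (2 * pi * s) * (4 - cos (2 * pi * s)) + (sin (2 * pi * s))\<^sup>2 = 3 * (2 - rate s)"
    unfolding rate_def by blast
  have "(gain has_real_derivative
      (2 * pi * cos (2 * pi * s) * (4 - cos (2 * pi * s)) + 2 * pi * (sin (2 * pi * s))\<^sup>2) / (6 * pi)) (at s)"
    unfolding gain_def[abs_def]
    by (auto intro!: derivative_eq_intros simp: power2_eq_square field_simps)
  also have "(2 * pi * cos (2 * pi * s) * (4 - cos (2 * pi * s)) + 2 * pi * (sin (2 * pi * s))\<^sup>2) / (6 * pi)
      = (2 * pi) * (3 * (2 - rate s)) / (6 * pi)"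
    unfolding key[symmetric] by (simp add: algebra_simps)
  also have "(2 * pi) * (3 * (2 - rate s)) / (6 * pi) = 2 - rate s"
    by simp
  finally show ?thesis .
qed

lemma gain_nonneg: "0 \<le> s \<Longrightarrow> s \<le> 1 / 2 \<Longrightarrow> 0 \<le> gain s"
  unfolding gain_def
  by (intro divide_nonneg_nonneg mult_nonneg_nonneg sin_ge_zero)
    (auto intro: order_trans[OF cos_le_one])

lemma gain_nonpos:
  assumes "1 / 2 \<le> s" "s \<le> 1"
  shows "gain s \<le> 0"
proof -
  have "sin (2 * pi * s) \<le> 0"
  proof (cases "s = 1")
    case False
    then show ?thesis using assms
      by (intro sin_le_zero) auto
  qed simp
  then show ?thesis
    unfolding gain_def
    by (intro divide_nonpos_nonneg mult_nonpos_nonneg) (auto intro: order_trans[OF cos_le_one])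
qed

declare DERIV_ramp[THEN DERIV_chain2, derivative_intros]
  DERIV_ramp1[THEN DERIV_chain2, derivative_intros]
  DERIV_ramp2[THEN DERIV_chain2, derivative_intros]
  DERIV_rate[THEN DERIV_chain2, derivative_intros]
  DERIV_rate1[THEN DERIV_chain2, derivative_intros]
  DERIV_gain[THEN DERIV_chain2, derivative_intros]

lemma rate_ge_1: "1 \<le> rate s" by (simp add: rate_def)

lemma rates_bounded: "\<exists>B. \<forall>s. rate s \<le> B \<and> \<bar>rate1 s\<bar> \<le> B \<and> \<bar>rate2 s\<bar> \<le> B"
proof -
  have 1: "\<bar>a * b\<bar> \<le> 1" if "\<bar>a\<bar> \<le> 1" "\<bar>b\<bar> \<le> 1" for a b :: real
    using mult_mono[OF that] by (simp add: abs_mult)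
  have p: "\<bar>sin x ^ n\<bar> \<le> 1" "\<bar>cos x ^ n\<bar> \<le> 1" for x :: real and n
    by (simp_all add: power_abs power_le_one)
  have "rate s \<le> 4" for s using p(1)[of "pi * s" 4] by (simp add: rate_def)
  moreover have "\<bar>rate1 s\<bar> \<le> 32 / 3 * pi" for s
    using 1[OF p(1)[of "pi * s" 3] abs_cos_le_one[of "pi * s"]]
    by (simp add: rate1_def abs_mult mult.assoc mult.commute)
  moreover have "\<bar>rate2 s\<bar> \<le> 32 / 3 * pi\<^sup>2 * 4" for s
  proof -
    have "\<bar>3 * (sin (pi * s) ^ 2 * cos (pi * s) ^ 2) - sin (pi * s) ^ 4\<bar> \<le> 4"
      using 1[OF p(1)[of "pi * s" 2] p(2)[of "pi * s" 2]] p(1)[of "pi * s" 4] by linarith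
    then show ?thesis by (simp add: rate2_def abs_mult mult.assoc)
  qed
  ultimately show ?thesis
    by (intro exI[of _ "max 4 (max (32 / 3 * pi) (32 / 3 * pi\<^sup>2 * 4))"]) (simp add: le_max_iff_disj)
qed

text \<open>
  Common shape of the four coupling profiles: with \<open>r\<close> a cut-off, \<open>e = exp (\<plusminus> \<kappa> gain)\<close> the ratio of the
  two modes and \<open>\<delta> = \<plusminus>1\<close> the direction in which the cut-off runs.
\<close>

definition bump :: "real \<Rightarrow> real \<Rightarrow> real \<Rightarrow> real \<Rightarrow> real \<Rightarrow> real" where
  "bump \<kappa> r1 r2 s e = (4 * r2 / \<kappa>\<^sup>2 + 4 * r1 * s / \<kappa>) * e"
definition bump' :: "real \<Rightarrow> real \<Rightarrow> real \<Rightarrow> real \<Rightarrow> real \<Rightarrow> real \<Rightarrow> real \<Rightarrow> real \<Rightarrow> real \<Rightarrow> real" where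
  "bump' \<kappa> \<delta> r1 r2 r3 s s1 d e = (8 * \<delta> * r3 / \<kappa>\<^sup>2 + (8 * \<delta> * r2 * s + 4 * r1 * s1) / \<kappa>) * e
     + (4 * r2 / \<kappa>\<^sup>2 + 4 * r1 * s / \<kappa>) * (\<kappa> * d * e)"

lemma DERIV_bump:
  assumes "(R1 has_real_derivative 2 * \<delta> * R2 t) (at t)" "(R2 has_real_derivative 2 * \<delta> * R3 t) (at t)"
    "(S has_real_derivative S1 t) (at t)" "(E has_real_derivative d t) (at t)"
  shows "((\<lambda>t. bump \<kappa> (R1 t) (R2 t) (S t) (exp (\<kappa> * E t))) has_real_derivative
    bump' \<kappa> \<delta> (R1 t) (R2 t) (R3 t) (S t) (S1 t) (d t) (exp (\<kappa> * E t))) (at t)"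
  unfolding bump_def bump'_def divide_inverse
  by (auto intro!: derivative_eq_intros assms simp: algebra_simps)

text \<open>Differentiating the exponential \<open>e\<close> costs a factor \<kappa>, which the 1 /
  \<kappa> in \<open>bump\<close> repays. The sums give at most 28 B^3 and 28 B^3 + 24 B^3, rounded
  up to 60 B^3.\<close>

lemma bump_bounds:
  fixes \<kappa> B :: real
  assumes k: "1 \<le> \<kappa>" and B: "1 \<le> B" and \<delta>: "\<bar>\<delta>\<bar> = 1" and e: "0 < e" "e \<le> 1"
    and r: "\<bar>r0\<bar> \<le> 1" "\<bar>r1\<bar> \<le> B" "\<bar>r2\<bar> \<le> B" "\<bar>r3\<bar> \<le> B"
    and s: "\<bar>s\<bar> \<le> B" "\<bar>s1\<bar> \<le> B" "\<bar>d\<bar> \<le> B"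
  shows "\<bar>bump \<kappa> r1 r2 s e\<bar> \<le> 60 * B ^ 3 / \<kappa>"
    and "\<bar>bump' \<kappa> \<delta> r1 r2 r3 s s1 d e\<bar> \<le> 60 * B ^ 3"
    and "\<bar>bump \<kappa> r1 r2 s e * (r0 * e)\<bar> \<le> 60 * B ^ 3 / \<kappa>"
    and "\<bar>bump' \<kappa> \<delta> r1 r2 r3 s s1 d e * (r0 * e) + bump \<kappa> r1 r2 s e * (2 * \<delta> * r1 * e + r0 * (\<kappa> * d * e))\<bar> \<le> 60 * B ^ 3"
proof -
  have B2: "B \<le> B\<^sup>2" "B\<^sup>2 \<le> B ^ 3" "0 \<le> B\<^sup>2" "0 \<le> B ^ 3"
    using B by (auto intro: power_increasing[of 2 3 B] self_le_power)
  have m: "\<bar>x * y\<bar> \<le> a * b" if "\<bar>x\<bar> \<le> a" "\<bar>y\<bar> \<le> b" for x y a b :: real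
    using that by (simp add: abs_mult mult_mono')
  have dk: "\<bar>x / \<kappa>\<bar> \<le> a / \<kappa>" if "\<bar>x\<bar> \<le> a" for x a
    using that k by (simp add: divide_right_mono)
  have dk2: "\<bar>x / \<kappa>\<^sup>2\<bar> \<le> a / \<kappa>" if "\<bar>x\<bar> \<le> a" for x a
  proof -
    have "\<kappa> \<le> \<kappa>\<^sup>2" using k by (simp add: self_le_power)
    then have "\<bar>x\<bar> / \<kappa>\<^sup>2 \<le> a / \<kappa>" using that k by (intro frac_le) auto
    then show ?thesis by simp
  qed
  have me: "\<bar>x * e\<bar> \<le> a" if "\<bar>x\<bar> \<le> a" for x a
    using m[OF that, of e 1] e by simp
  have re: "\<bar>r0 * e\<bar> \<le> 1" using me[OF r(1)] .
  have core: "\<bar>4 * r2 / \<kappa>\<^sup>2 + 4 * r1 * s / \<kappa>\<bar> \<le> 8 * B\<^sup>2 / \<kappa>"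
  proof -
    have "\<bar>4 * r2 / \<kappa>\<^sup>2\<bar> \<le> 4 * B\<^sup>2 / \<kappa>" using r(3) B2 by (intro dk2) auto
    moreover have "\<bar>4 * r1 * s / \<kappa>\<bar> \<le> 4 * B\<^sup>2 / \<kappa>"
      using m[OF r(2) s(1)] by (intro dk) (simp add: power2_eq_square abs_mult mult.assoc)
    moreover have "8 * B\<^sup>2 / \<kappa> = 4 * B\<^sup>2 / \<kappa> + 4 * B\<^sup>2 / \<kappa>" by simp
    ultimately show ?thesis by linarith
  qed
  have bump: "\<bar>bump \<kappa> r1 r2 s e\<bar> \<le> 8 * B\<^sup>2 / \<kappa>"
    unfolding bump_def by (rule me[OF core])
  have mono: "8 * B\<^sup>2 / \<kappa> \<le> 60 * B ^ 3 / \<kappa>" using B2 k by (intro divide_right_mono) auto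
  show "\<bar>bump \<kappa> r1 r2 s e\<bar> \<le> 60 * B ^ 3 / \<kappa>" using bump mono by linarith
  show "\<bar>bump \<kappa> r1 r2 s e * (r0 * e)\<bar> \<le> 60 * B ^ 3 / \<kappa>" using m[OF bump re] mono by linarith
  have de: "\<bar>\<kappa> * d * e\<bar> \<le> \<kappa> * B"
    using m[of \<kappa> \<kappa> "d * e" B] me[OF s(3)] k by (simp add: mult.assoc)
  have k1: "8 * B\<^sup>2 / \<kappa> * (\<kappa> * B) = 8 * B ^ 3" using k by (simp add: power2_eq_square power3_eq_cube)
  have "\<bar>8 * \<delta> * r3 / \<kappa>\<^sup>2\<bar> \<le> 8 * B ^ 3"
  proof -
    have "\<bar>8 * \<delta> * r3\<bar> \<le> 8 * B" using \<delta> r by (simp add: abs_mult)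
    from dk2[OF this] have "\<bar>8 * \<delta> * r3 / \<kappa>\<^sup>2\<bar> \<le> 8 * B / \<kappa>" .
    also have "\<dots> \<le> 8 * B / 1" using k B by (intro divide_left_mono) auto
    finally show ?thesis using B2 by linarith
  qed
  moreover have "\<bar>(8 * \<delta> * r2 * s + 4 * r1 * s1) / \<kappa>\<bar> \<le> 12 * B ^ 3"
  proof -
    have "\<bar>8 * \<delta> * r2 * s\<bar> \<le> 8 * B\<^sup>2" "\<bar>4 * r1 * s1\<bar> \<le> 4 * B\<^sup>2"
      using m[OF r(3) s(1)] m[OF r(2) s(2)] \<delta> by (simp_all add: abs_mult power2_eq_square mult.assoc)
    then have "\<bar>8 * \<delta> * r2 * s + 4 * r1 * s1\<bar> \<le> 12 * B\<^sup>2" by linarith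
    from dk[OF this] have "\<bar>(8 * \<delta> * r2 * s + 4 * r1 * s1) / \<kappa>\<bar> \<le> 12 * B\<^sup>2 / \<kappa>" .
    also have "\<dots> \<le> 12 * B\<^sup>2 / 1" using k B by (intro divide_left_mono) auto
    finally show ?thesis using B2 by linarith
  qed
  ultimately have "\<bar>8 * \<delta> * r3 / \<kappa>\<^sup>2 + (8 * \<delta> * r2 * s + 4 * r1 * s1) / \<kappa>\<bar> \<le> 20 * B ^ 3" by linarith
  then have "\<bar>bump' \<kappa> \<delta> r1 r2 r3 s s1 d e\<bar> \<le> 20 * B ^ 3 + 8 * B ^ 3"
    unfolding bump'_def k1[symmetric]
    by (intro order_trans[OF abs_triangle_ineq add_mono] me m[OF core de])
  then have bump': "\<bar>bump' \<kappa> \<delta> r1 r2 r3 s s1 d e\<bar> \<le> 28 * B ^ 3" by simp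
  then show "\<bar>bump' \<kappa> \<delta> r1 r2 r3 s s1 d e\<bar> \<le> 60 * B ^ 3" using B2 by linarith
  have "\<bar>2 * \<delta> * r1 * e + r0 * (\<kappa> * d * e)\<bar> \<le> 3 * (\<kappa> * B)"
  proof -
    have "\<bar>2 * \<delta> * r1 * e\<bar> \<le> 2 * B" using \<delta> me[OF r(2)] by (simp add: abs_mult)
    moreover have "B \<le> \<kappa> * B" using k B by simp
    moreover have "\<bar>r0 * (\<kappa> * d * e)\<bar> \<le> \<kappa> * B" using m[OF r(1) de] by simp
    ultimately show ?thesis by linarith
  qed
  from m[OF bump' re] m[OF bump this]
  have "\<bar>bump' \<kappa> \<delta> r1 r2 r3 s s1 d e * (r0 * e) + bump \<kappa> r1 r2 s e * (2 * \<delta> * r1 * e + r0 * (\<kappa> * d * e))\<bar>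
      \<le> 28 * B ^ 3 * 1 + 8 * B\<^sup>2 / \<kappa> * (3 * (\<kappa> * B))"
    by (intro order_trans[OF abs_triangle_ineq add_mono])
  also have "\<dots> = 28 * B ^ 3 + 3 * (8 * B ^ 3)" unfolding k1[symmetric] by simp
  also have "\<dots> \<le> 60 * B ^ 3" using B2 by simp
  finally show "\<bar>bump' \<kappa> \<delta> r1 r2 r3 s s1 d e * (r0 * e) + bump \<kappa> r1 r2 s e * (2 * \<delta> * r1 * e + r0 * (\<kappa> * d * e))\<bar> \<le> 60 * B ^ 3" .
qed

text \<open>
  Entries of the coefficient matrix on a slab: \<open>pa\<close> produces the decay rate \<open>rate\<close>, while \<open>pb\<close> and \<open>qb\<close>
  absorb the error of switching off the old mode (on \<open>s \<ge> 1/2\<close>) and \<open>pg\<close> and \<open>qg\<close> that of switching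
  on the new one (on \<open>s \<le> 1/2\<close>). Each error is measured against the dominant mode, so no exponential
  factor exceeds 1 and the gain \<open>1 / \<kappa>\<close> in the amplitude pays for the angular derivatives.
\<close>

definition pa :: "real \<Rightarrow> real \<Rightarrow> real" where
  "pa \<kappa> t = (rate (clip t))\<^sup>2 - 1 - rate1 (clip t) / \<kappa>"
definition pa' :: "real \<Rightarrow> real \<Rightarrow> real" where
  "pa' \<kappa> t = 2 * rate (clip t) * rate1 (clip t) - rate2 (clip t) / \<kappa>"
definition pb :: "real \<Rightarrow> real \<Rightarrow> real" where
  "pb \<kappa> t = bump \<kappa> (ramp1 (2 - 2 * t)) (ramp2 (2 - 2 * t)) (rate t) (exp (\<kappa> * gain t))"
definition pb' :: "real \<Rightarrow> real \<Rightarrow> real" where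
  "pb' \<kappa> t = bump' \<kappa> (-1) (ramp1 (2 - 2 * t)) (ramp2 (2 - 2 * t)) (ramp3 (2 - 2 * t)) (rate t) (rate1 t)
     (2 - rate t) (exp (\<kappa> * gain t))"
definition qb :: "real \<Rightarrow> real \<Rightarrow> real" where
  "qb \<kappa> t = pb \<kappa> t * (ramp (2 - 2 * t) * exp (\<kappa> * gain t))"
definition qb' :: "real \<Rightarrow> real \<Rightarrow> real" where
  "qb' \<kappa> t = pb' \<kappa> t * (ramp (2 - 2 * t) * exp (\<kappa> * gain t)) + pb \<kappa> t *
     (2 * (-1) * ramp1 (2 - 2 * t) * exp (\<kappa> * gain t) + ramp (2 - 2 * t) * (\<kappa> * (2 - rate t) * exp (\<kappa> * gain t)))"
definition pg :: "real \<Rightarrow> real \<Rightarrow> real" where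
  "pg \<kappa> t = bump \<kappa> (ramp1 (2 * t)) (ramp2 (2 * t)) (-2) (exp (\<kappa> * - gain t))"
definition pg' :: "real \<Rightarrow> real \<Rightarrow> real" where
  "pg' \<kappa> t = bump' \<kappa> 1 (ramp1 (2 * t)) (ramp2 (2 * t)) (ramp3 (2 * t)) (-2) 0
     (rate t - 2) (exp (\<kappa> * - gain t))"
definition qg :: "real \<Rightarrow> real \<Rightarrow> real" where
  "qg \<kappa> t = pg \<kappa> t * (ramp (2 * t) * exp (\<kappa> * - gain t))"
definition qg' :: "real \<Rightarrow> real \<Rightarrow> real" where
  "qg' \<kappa> t = pg' \<kappa> t * (ramp (2 * t) * exp (\<kappa> * - gain t)) + pg \<kappa> t *
     (2 * 1 * ramp1 (2 * t) * exp (\<kappa> * - gain t) + ramp (2 * t) * (\<kappa> * (rate t - 2) * exp (\<kappa> * - gain t)))"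

lemma DERIV_pa: "(pa \<kappa> has_real_derivative pa' \<kappa> t) (at t)"
  unfolding pa_def[abs_def] pa'_def divide_inverse
  by (rule DERIV_comp_clip[of "\<lambda>c. (rate c)\<^sup>2 - 1 - rate1 c * inverse \<kappa>"])
    (auto intro!: derivative_eq_intros simp: rate1_def[of 0] rate1_def[of 1] rate2_def[of 0] rate2_def[of 1])

lemma DERIV_pb: "(pb \<kappa> has_real_derivative pb' \<kappa> t) (at t)"
  unfolding pb_def[abs_def] pb'_def
  by (rule DERIV_bump) (auto intro!: derivative_eq_intros)

lemma DERIV_pg: "(pg \<kappa> has_real_derivative pg' \<kappa> t) (at t)"
  unfolding pg_def[abs_def] pg'_def
  by (rule DERIV_bump[where S = "\<lambda>_. -2" and ?S1.0 = "\<lambda>_. 0"]) (auto intro!: derivative_eq_intros)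

lemma DERIV_qb: "(qb \<kappa> has_real_derivative qb' \<kappa> t) (at t)"
proof -
  have "((\<lambda>t. ramp (2 - 2 * t) * exp (\<kappa> * gain t)) has_real_derivative
      2 * (-1) * ramp1 (2 - 2 * t) * exp (\<kappa> * gain t) + ramp (2 - 2 * t) * (\<kappa> * (2 - rate t) * exp (\<kappa> * gain t))) (at t)"
    by (auto intro!: derivative_eq_intros simp: algebra_simps)
  from DERIV_mult'[OF DERIV_pb this] show ?thesis
    unfolding qb_def[abs_def] qb'_def by (simp only: add.commute)
qed

lemma DERIV_qg: "(qg \<kappa> has_real_derivative qg' \<kappa> t) (at t)"
proof -
  have "((\<lambda>t. ramp (2 * t) * exp (\<kappa> * - gain t)) has_real_derivative
      2 * 1 * ramp1 (2 * t) * exp (\<kappa> * - gain t) + ramp (2 * t) * (\<kappa> * (rate t - 2) * exp (\<kappa> * - gain t))) (at t)"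
    by (auto intro!: derivative_eq_intros simp: algebra_simps)
  from DERIV_mult'[OF DERIV_pg this] show ?thesis
    unfolding qg_def[abs_def] qg'_def by (simp only: add.commute)
qed

text \<open>The cut-offs and \<open>rate\<close> are flat at the ends of the slab. With values and
  derivatives zero there, the perturbations of successive slabs glue differentiably and at most one
  of them acts at any point.\<close>

lemma profiles_outside:
  assumes "t \<le> 0 \<or> 1 \<le> t"
  shows "pa \<kappa> t = 0" "pa' \<kappa> t = 0" "pb \<kappa> t = 0" "pb' \<kappa> t = 0" "pg \<kappa> t = 0" "pg' \<kappa> t = 0"
    "qb \<kappa> t = 0" "qb' \<kappa> t = 0" "qg \<kappa> t = 0" "qg' \<kappa> t = 0"
proof -
  have "clip t = 0 \<or> clip t = 1" using assms by auto
  then show "pa \<kappa> t = 0" "pa' \<kappa> t = 0"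
    by (auto simp: pa_def pa'_def rate_def rate1_def rate2_def)
  have r: "ramp1 (2 - 2 * t) = 0" "ramp2 (2 - 2 * t) = 0" "ramp3 (2 - 2 * t) = 0"
    "ramp1 (2 * t) = 0" "ramp2 (2 * t) = 0" "ramp3 (2 * t) = 0"
    using assms by auto
  then show "pb \<kappa> t = 0" "pb' \<kappa> t = 0" "pg \<kappa> t = 0" "pg' \<kappa> t = 0"
    by (simp_all add: pb_def pb'_def pg_def pg'_def bump_def bump'_def)
  then show "qb \<kappa> t = 0" "qb' \<kappa> t = 0" "qg \<kappa> t = 0" "qg' \<kappa> t = 0"
    by (simp_all add: qb_def qb'_def qg_def qg'_def r)
qed

lemma profile_bounds:
  "\<exists>C\<ge>1. \<forall>\<kappa>\<ge>1. \<forall>t. \<bar>pa \<kappa> t\<bar> \<le> C \<and> - C / \<kappa> \<le> pa \<kappa> t \<and> \<bar>pa' \<kappa> t\<bar> \<le> C \<and>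
    \<bar>pb \<kappa> t\<bar> \<le> C / \<kappa> \<and> \<bar>pb' \<kappa> t\<bar> \<le> C \<and> \<bar>qb \<kappa> t\<bar> \<le> C / \<kappa> \<and> \<bar>qb' \<kappa> t\<bar> \<le> C \<and>
    \<bar>pg \<kappa> t\<bar> \<le> C / \<kappa> \<and> \<bar>pg' \<kappa> t\<bar> \<le> C \<and> \<bar>qg \<kappa> t\<bar> \<le> C / \<kappa> \<and> \<bar>qg' \<kappa> t\<bar> \<le> C"
proof -
  obtain B1 where B1: "\<And>t. \<bar>ramp1 t\<bar> \<le> B1" "\<And>t. \<bar>ramp2 t\<bar> \<le> B1" "\<And>t. \<bar>ramp3 t\<bar> \<le> B1"
    using ramps_bounded by blast
  obtain B2 where B2: "\<And>t. rate t \<le> B2" "\<And>t. \<bar>rate1 t\<bar> \<le> B2" "\<And>t. \<bar>rate2 t\<bar> \<le> B2"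
    using rates_bounded by blast
  \<comment> \<open>The lower bound 2 lets \<open>B\<close> also control \<open>2 - rate t\<close>
    and the constant \<open>-2\<close> that takes the place of the rate in
    \<open>pg\<close>.\<close>
  define B where "B = max 2 (max B1 B2)"
  have B: "2 \<le> B" "B1 \<le> B" "B2 \<le> B" by (auto simp: B_def)
  have r: "\<bar>ramp1 t\<bar> \<le> B" "\<bar>ramp2 t\<bar> \<le> B" "\<bar>ramp3 t\<bar> \<le> B" "\<bar>ramp t\<bar> \<le> 1" for t
    using B1[of t] B ramp_range[of t] by auto
  have s: "1 \<le> rate t" "rate t \<le> B" "\<bar>rate1 t\<bar> \<le> B" "\<bar>rate2 t\<bar> \<le> B" for t
    using B2[of t] B rate_ge_1[of t] by auto
  have s': "\<bar>rate t\<bar> \<le> B" "\<bar>2 - rate t\<bar> \<le> B" "\<bar>rate t - 2\<bar> \<le> B" for t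
    using s[of t] B by auto
  define C where "C = 60 * B ^ 3"
  have C: "1 \<le> C" "3 * B\<^sup>2 \<le> C" "B \<le> C" "0 \<le> C"
  proof -
    have "B\<^sup>2 \<le> B ^ 3" "B \<le> B\<^sup>2" using B by (auto intro: power_increasing[of 2 3 B] self_le_power)
    then show "1 \<le> C" "3 * B\<^sup>2 \<le> C" "B \<le> C" "0 \<le> C" using B unfolding C_def by linarith+
  qed
  have "\<bar>pa \<kappa> t\<bar> \<le> C \<and> - C / \<kappa> \<le> pa \<kappa> t \<and> \<bar>pa' \<kappa> t\<bar> \<le> C \<and>
    \<bar>pb \<kappa> t\<bar> \<le> C / \<kappa> \<and> \<bar>pb' \<kappa> t\<bar> \<le> C \<and> \<bar>qb \<kappa> t\<bar> \<le> C / \<kappa> \<and> \<bar>qb' \<kappa> t\<bar> \<le> C \<and>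
    \<bar>pg \<kappa> t\<bar> \<le> C / \<kappa> \<and> \<bar>pg' \<kappa> t\<bar> \<le> C \<and> \<bar>qg \<kappa> t\<bar> \<le> C / \<kappa> \<and> \<bar>qg' \<kappa> t\<bar> \<le> C"
    if k: "1 \<le> \<kappa>" for \<kappa> t
  proof -
    let ?c = "clip t"
    have div: "\<bar>x / \<kappa>\<bar> \<le> \<bar>x\<bar>" for x
      using k frac_le[of "\<bar>x\<bar>" "\<bar>x\<bar>" 1 \<kappa>] by simp
    have sq: "1 \<le> (rate ?c)\<^sup>2" "(rate ?c)\<^sup>2 \<le> B\<^sup>2"
      using s[of ?c] power_mono[of 1 "rate ?c" 2] by (auto intro: power_mono)
    have BB: "B \<le> B\<^sup>2" using B by (simp add: self_le_power)
    have pa: "\<bar>pa \<kappa> t\<bar> \<le> C"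
      using sq div[of "rate1 ?c"] s(3)[of ?c] C(2) BB B unfolding pa_def by linarith
    have "rate1 ?c / \<kappa> \<le> C / \<kappa>" using s(3)[of ?c] C k by (intro divide_right_mono) auto
    then have pa_lower: "- C / \<kappa> \<le> pa \<kappa> t" using sq unfolding pa_def by linarith
    have "\<bar>rate ?c * rate1 ?c\<bar> \<le> B\<^sup>2"
      unfolding abs_mult power2_eq_square using s'(1)[of ?c] s(3)[of ?c] by (intro mult_mono) auto
    then have pa': "\<bar>pa' \<kappa> t\<bar> \<le> C"
      using div[of "rate2 ?c"] s(4)[of ?c] C(2) BB unfolding pa'_def by linarith
    show ?thesis
    proof (cases "0 < t \<and> t < 1")
      case False
      then have out: "t \<le> 0 \<or> 1 \<le> t" by auto
      have "0 \<le> C / \<kappa>" using C k by simp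
      then show ?thesis using pa pa_lower pa' C profiles_outside[OF out] by auto
    next
      case t: True
      have b: "\<bar>pb \<kappa> t\<bar> \<le> C / \<kappa> \<and> \<bar>pb' \<kappa> t\<bar> \<le> C \<and> \<bar>qb \<kappa> t\<bar> \<le> C / \<kappa> \<and> \<bar>qb' \<kappa> t\<bar> \<le> C"
      \<comment> \<open>For larger \<open>t\<close> the new mode dominates and the exponential ratio
        is at most 1; for smaller \<open>t\<close> the ratio may be huge, but the cut-off is
        constant there and \<open>pb\<close> vanishes.\<close>
      proof (cases "1 / 2 \<le> t")
        case True
        have "exp (\<kappa> * gain t) \<le> 1"
          using gain_nonpos[of t] True t k by (simp add: mult_nonneg_nonpos)
        note bb = bump_bounds[of \<kappa> B "-1" "exp (\<kappa> * gain t)", OF k _ _ _ this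
            r(4)[of "2 - 2 * t"] r(1-3)[of "2 - 2 * t"] s'(1) s(3) s'(2)]
        show ?thesis
          unfolding C_def pb_def pb'_def qb_def qb'_def
          by (intro conjI bb) (use B in simp_all)
      next
        case False
        then have "pb \<kappa> t = 0" "pb' \<kappa> t = 0"
          by (simp_all add: pb_def pb'_def bump_def bump'_def)
        then show ?thesis using C k by (simp add: qb_def qb'_def)
      qed
      have g: "\<bar>pg \<kappa> t\<bar> \<le> C / \<kappa> \<and> \<bar>pg' \<kappa> t\<bar> \<le> C \<and> \<bar>qg \<kappa> t\<bar> \<le> C / \<kappa> \<and> \<bar>qg' \<kappa> t\<bar> \<le> C"
      proof (cases "t \<le> 1 / 2")
        case True
        have "exp (\<kappa> * - gain t) \<le> 1"
          using gain_nonneg[of t] True t k by simp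
        note bb = bump_bounds[of \<kappa> B 1 "exp (\<kappa> * - gain t)" _ _ _ _ "-2" 0, OF k _ _ _ this
            r(4)[of "2 * t"] r(1-3)[of "2 * t"] _ _ s'(3)]
        show ?thesis
          unfolding C_def pg_def pg'_def qg_def qg'_def
          by (intro conjI bb) (use B in simp_all)
      next
        case False
        then have "pg \<kappa> t = 0" "pg' \<kappa> t = 0"
          by (simp_all add: pg_def pg'_def bump_def bump'_def)
        then show ?thesis using C k by (simp add: qg_def qg'_def)
      qed
      show ?thesis using pa pa_lower pa' b g by blast
    qed
  qed
  then show ?thesis using C(1) by blast
qed

section \<open>The chain of modes\<close>

text \<open>
  The slab \<open>i\<close> is \<open>[X i, X (i + 1)]\<close>, with local coordinate \<open>T i\<close>. The mode \<open>j\<close>, of frequency \<open>k j\<close>, has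
  the radial profile \<open>f j\<close>, which is switched on in the slab \<open>j - 1\<close> and off in the slab \<open>j\<close>; \<open>lam\<close>
  normalizes the amplitudes so that consecutive modes balance where they are exchanged.
\<close>

locale modes =
  fixes X :: "nat \<Rightarrow> real" and K :: nat
  assumes X0: "1 \<le> X 0" and gap: "\<And>i. 1 \<le> X (Suc i) - X i" and K: "1 \<le> K"
begin

definition k :: "nat \<Rightarrow> real" where "k i = real (K * 2 ^ i)"
definition len :: "nat \<Rightarrow> real" where "len i = X (Suc i) - X i"
definition T :: "nat \<Rightarrow> real \<Rightarrow> real" where "T i y = (y - X i) / len i"
definition kap :: "nat \<Rightarrow> real" where "kap i = k i * len i"
text \<open>\<open>k i\<close> times a primitive of \<open>rate (clip (T i y))\<close>: as
  \<open>gain\<close> has derivative 2 - \<open>rate\<close>, the clipped term contributes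
  \<open>rate\<close> - 1. Outside the slab the slope is back to \<open>k i\<close>.\<close>

definition psi :: "nat \<Rightarrow> real \<Rightarrow> real" where
  "psi i y = k i * (y + len i * (clip (T i y) - gain (clip (T i y))))"

primrec lam :: "nat \<Rightarrow> real" where
  "lam 0 = 0"
| "lam (Suc i) = lam i + k i * X i"

definition off :: "nat \<Rightarrow> real \<Rightarrow> real" where "off i y = ramp (2 - 2 * T i y)"
definition off1 :: "nat \<Rightarrow> real \<Rightarrow> real" where "off1 i y = - 2 / len i * ramp1 (2 - 2 * T i y)"
definition off2 :: "nat \<Rightarrow> real \<Rightarrow> real" where "off2 i y = 4 / (len i)\<^sup>2 * ramp2 (2 - 2 * T i y)"

primrec on :: "nat \<Rightarrow> real \<Rightarrow> real" where
  "on 0 = (\<lambda>y. 1)"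
| "on (Suc i) = (\<lambda>y. ramp (2 * T i y))"
primrec on1 :: "nat \<Rightarrow> real \<Rightarrow> real" where
  "on1 0 = (\<lambda>y. 0)"
| "on1 (Suc i) = (\<lambda>y. 2 / len i * ramp1 (2 * T i y))"
primrec on2 :: "nat \<Rightarrow> real \<Rightarrow> real" where
  "on2 0 = (\<lambda>y. 0)"
| "on2 (Suc i) = (\<lambda>y. 4 / (len i)\<^sup>2 * ramp2 (2 * T i y))"

definition amp :: "nat \<Rightarrow> real \<Rightarrow> real" where "amp i y = exp (lam i - psi i y)"
definition psi1 :: "nat \<Rightarrow> real \<Rightarrow> real" where "psi1 i y = k i * rate (clip (T i y))"
definition psi2 :: "nat \<Rightarrow> real \<Rightarrow> real" where "psi2 i y = k i * rate1 (clip (T i y)) / len i"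

definition f :: "nat \<Rightarrow> real \<Rightarrow> real" where "f i y = amp i y * (on i y * off i y)"
definition f1 :: "nat \<Rightarrow> real \<Rightarrow> real" where
  "f1 i y = amp i y * (on1 i y * off i y + on i y * off1 i y - psi1 i y * (on i y * off i y))"
definition f2 :: "nat \<Rightarrow> real \<Rightarrow> real" where
  "f2 i y = amp i y * (on2 i y * off i y + 2 * (on1 i y * off1 i y) + on i y * off2 i y
     - 2 * psi1 i y * (on1 i y * off i y + on i y * off1 i y)
     + ((psi1 i y)\<^sup>2 - psi2 i y) * (on i y * off i y))"

lemma len_ge_1: "1 \<le> len i" and len_pos: "0 < len i" and len_nz: "len i \<noteq> 0"
  using gap[of i] by (auto simp: len_def)

lemma k_pos: "0 < k i" and k_ge_1: "1 \<le> k i" and k_Suc: "k (Suc i) = 2 * k i"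
proof -
  have "1 \<le> K * 2 ^ i" using K by simp
  then show "1 \<le> k i" unfolding k_def by (metis of_nat_1 of_nat_le_iff)
  then show "0 < k i" by simp
qed (simp add: k_def)

lemma kap_ge: "real K \<le> kap i" and kap_ge_1: "1 \<le> kap i" and kap_pos: "0 < kap i"
proof -
  have "real K \<le> k i" using mult_left_mono[of 1 "2 ^ i" "real K"] by (simp add: k_def)
  then have "real K * 1 \<le> k i * len i"
    by (intro mult_mono len_ge_1) (use k_pos[of i] in auto)
  then show "real K \<le> kap i" by (simp add: kap_def)
  then show "1 \<le> kap i" "0 < kap i" using K by linarith+
qed

lemma X_mono: "i \<le> j \<Longrightarrow> X i + (real j - real i) \<le> X j"
proof (induction j rule: dec_induct)
  case (step j)
  then show ?case using gap[of j] by simp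
qed simp

lemma X_mono_le:
  assumes "i \<le> j"
  shows "X i \<le> X j"
proof -
  have "real i \<le> real j" using assms by simp
  then show ?thesis using X_mono[OF assms] by linarith
qed

lemma X_ge_1: "1 \<le> X i"
  using X_mono_le[of 0 i] X0 by simp

lemma X_unbounded: "\<exists>n. y < X n"
proof -
  obtain n where "y < real n" using reals_Archimedean2 by blast
  then show ?thesis using X_mono[of 0 n] X0 by (intro exI[of _ n]) simp
qed

lemma T_simps:
  "T i y \<le> 0 \<longleftrightarrow> y \<le> X i" "1 \<le> T i y \<longleftrightarrow> X (Suc i) \<le> y" "0 \<le> T i y \<longleftrightarrow> X i \<le> y" "T i y \<le> 1 \<longleftrightarrow> y \<le> X (Suc i)"
  using len_pos[of i] by (auto simp: T_def field_simps len_def)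

lemma T_eq: "y = X i + len i * T i y"
  using len_nz[of i] by (simp add: T_def)

lemma DERIV_T: "(T i has_real_derivative 1 / len i) (at y)"
  unfolding T_def[abs_def] by (auto intro!: derivative_eq_intros simp: len_nz)

declare DERIV_T[THEN DERIV_chain2, derivative_intros]

lemma DERIV_psi: "(psi i has_real_derivative psi1 i y) (at y)"
proof -
  have "((\<lambda>t. (\<lambda>c. c - gain c) (clip t)) has_real_derivative (\<lambda>c. rate c - 1) (clip t)) (at t)" for t
    by (rule DERIV_comp_clip) (auto intro!: derivative_eq_intros simp: rate_def)
  from DERIV_cmult[OF DERIV_add[OF DERIV_ident DERIV_cmult[OF DERIV_chain2[OF this DERIV_T[of i y]]]]]
  show ?thesis
    unfolding psi_def[abs_def] psi1_def by (rule DERIV_cong) (simp add: len_nz)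
qed

lemma DERIV_psi1: "(psi1 i has_real_derivative psi2 i y) (at y)"
proof -
  have "((\<lambda>t. rate (clip t)) has_real_derivative rate1 (clip t)) (at t)" for t
    by (rule DERIV_comp_clip) (auto intro!: derivative_eq_intros simp: rate1_def)
  from DERIV_cmult[OF DERIV_chain2[OF this DERIV_T[of i y]]]
  show ?thesis
    unfolding psi1_def[abs_def] psi2_def by (rule DERIV_cong) simp
qed

lemma DERIV_amp: "(amp i has_real_derivative - (psi1 i y) * amp i y) (at y)"
  unfolding amp_def[abs_def] by (auto intro!: derivative_eq_intros DERIV_psi)

lemma DERIV_off: "(off i has_real_derivative off1 i y) (at y)"
  unfolding off_def[abs_def] off1_def by (auto intro!: derivative_eq_intros)

lemma DERIV_off1: "(off1 i has_real_derivative off2 i y) (at y)"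
  unfolding off1_def[abs_def] off2_def by (auto intro!: derivative_eq_intros simp: power2_eq_square len_nz)

lemma DERIV_on: "(on i has_real_derivative on1 i y) (at y)"
proof (cases i)
  case (Suc j)
  have "((\<lambda>y. ramp (2 * T j y)) has_real_derivative 2 / len j * ramp1 (2 * T j y)) (at y)"
    by (auto intro!: derivative_eq_intros)
  then show ?thesis by (simp add: Suc)
qed simp

lemma DERIV_on1: "(on1 i has_real_derivative on2 i y) (at y)"
proof (cases i)
  case (Suc j)
  have "((\<lambda>y. 2 / len j * ramp1 (2 * T j y)) has_real_derivative 4 / (len j)\<^sup>2 * ramp2 (2 * T j y)) (at y)"
    by (auto intro!: derivative_eq_intros simp: power2_eq_square len_nz)
  then show ?thesis by (simp add: Suc)
qed simp

lemma DERIV_f: "(f i has_real_derivative f1 i y) (at y)"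
  unfolding f_def[abs_def] f1_def
  by (auto intro!: derivative_eq_intros DERIV_amp DERIV_on DERIV_off simp: algebra_simps)

lemma DERIV_f1: "(f1 i has_real_derivative f2 i y) (at y)"
  unfolding f1_def[abs_def] f2_def
  by (auto intro!: derivative_eq_intros DERIV_amp DERIV_on DERIV_off DERIV_on1 DERIV_off1 DERIV_psi1
      simp: algebra_simps power2_eq_square)

lemma before:
  assumes "y \<le> X i"
  shows "clip (T i y) = 0" "off i y = 1" "off1 i y = 0" "off2 i y = 0"
    "on (Suc i) y = 0" "on1 (Suc i) y = 0" "on2 (Suc i) y = 0"
    "psi i y = k i * y" "psi1 i y = k i" "psi2 i y = 0"
  using assms T_simps(1)[of i y]
  by (auto simp: off_def off1_def off2_def psi_def psi1_def psi2_def gain_def rate_def rate1_def)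

lemma after:
  assumes "X (Suc i) \<le> y"
  shows "off i y = 0" "off1 i y = 0" "off2 i y = 0" "on (Suc i) y = 1" "on1 (Suc i) y = 0" "on2 (Suc i) y = 0"
  using assms T_simps(2)[of i y] by (auto simp: off_def off1_def off2_def)

lemma on_after:
  assumes "X i \<le> y"
  shows "on i y = 1" "on1 i y = 0" "on2 i y = 0"
  using assms after[of "i - 1" y] by (cases i; simp)+

text \<open>The recursion for \<open>lam\<close> makes the two amplitudes equal at
  \<open>X i\<close>. From there the decay rates differ by \<open>k i\<close> times 2 -
  \<open>rate\<close>, whose integral is \<open>kap i\<close> times \<open>gain\<close>.\<close>

lemma amp_ratio:
  assumes "X i \<le> y" "y \<le> X (Suc i)"
  shows "amp (Suc i) y = amp i y * exp (- (kap i * gain (T i y)))"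
proof -
  have c: "clip (T i y) = T i y" using assms T_simps[of i y] by simp
  have "lam (Suc i) - psi (Suc i) y = lam i - psi i y - kap i * gain (T i y)"
  proof -
    have "y = X i + len i * T i y" by (rule T_eq)
    then have "k i * y = k i * (X i + len i * T i y)" by simp
    then show ?thesis
      unfolding before(8)[OF assms(2)] k_Suc lam.simps psi_def[of i] c kap_def
      by (simp only: distrib_left right_diff_distrib)
  qed
  then show ?thesis by (simp add: amp_def flip: exp_add)
qed

lemma f_slab:
  assumes "X i \<le> y" "y \<le> X (Suc i)"
  shows "f i y = amp i y * ramp (2 - 2 * T i y)"
    and "f (Suc i) y = amp i y * (exp (- (kap i * gain (T i y))) * ramp (2 * T i y))"
  using on_after[OF assms(1)] before[OF assms(2)] amp_ratio[OF assms]
  by (simp_all add: f_def off_def)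

text \<open>Where \<open>pg\<close> is nonzero the old cut-off is still 1, and where
  \<open>pb\<close> is nonzero the new one already is, so the factor built into \<open>qg\<close>
  and \<open>qb\<close> is there the exact quotient of the two modes. These relations stand in for
  the division needed to solve for the matrix.\<close>

lemma slab_relations:
  "qg (kap i) (T i y) * f i y = pg (kap i) (T i y) * f (Suc i) y"
  "qb (kap i) (T i y) * f (Suc i) y = pb (kap i) (T i y) * f i y"
proof -
  have "qg (kap i) (T i y) * f i y = pg (kap i) (T i y) * f (Suc i) y \<and>
    qb (kap i) (T i y) * f (Suc i) y = pb (kap i) (T i y) * f i y"
  proof (cases "X i \<le> y \<and> y \<le> X (Suc i)")
    case True
    note f = f_slab[OF conjunct1[OF True] conjunct2[OF True]]
    show ?thesis
    proof (cases "T i y \<le> 1 / 2")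
      case True
      then have "pb (kap i) (T i y) = 0" by (simp add: pb_def bump_def)
      then show ?thesis using True by (simp add: qb_def qg_def f)
    next
      case False
      then have "pg (kap i) (T i y) = 0" by (simp add: pg_def bump_def)
      then show ?thesis using False by (simp add: qb_def qg_def f mult_exp_exp)
    qed
  next
    case False
    then have "T i y \<le> 0 \<or> 1 \<le> T i y" using T_simps[of i y] by linarith
    then show ?thesis by (simp add: profiles_outside)
  qed
  then show "qg (kap i) (T i y) * f i y = pg (kap i) (T i y) * f (Suc i) y"
    "qb (kap i) (T i y) * f (Suc i) y = pb (kap i) (T i y) * f i y" by auto
qed

text \<open>Up to \<open>X (Suc i)\<close> the new mode has constant rate \<open>k (Suc i)\<close>,
  so the product rule leaves just these two terms. On the half slab where they live
  \<open>f i\<close> is \<open>amp i\<close>, and \<open>amp_ratio\<close> converts them into a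
  multiple of the dominant mode.\<close>

lemma switch_on_error:
  assumes "y \<le> X (Suc i)"
  shows "amp (Suc i) y * (on2 (Suc i) y - 2 * k (Suc i) * on1 (Suc i) y) = (k i)\<^sup>2 * pg (kap i) (T i y) * f i y"
proof (cases "X i \<le> y")
  case False
  then show ?thesis using before[of y i] T_simps(1)[of i y] by (simp add: profiles_outside)
next
  case True
  note f = f_slab[OF True assms]
  show ?thesis
  proof (cases "T i y \<le> 1 / 2")
    case True
    then show ?thesis
      by (simp add: f amp_ratio[OF \<open>X i \<le> y\<close> assms] pg_def bump_def k_Suc)
        (use len_pos[of i] k_pos[of i] in \<open>simp add: kap_def field_simps power2_eq_square\<close>)
  next
    case False
    then show ?thesis by (simp add: pg_def bump_def)
  qed
qed

lemma switch_off_error: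
  assumes "X i \<le> y"
  shows "amp i y * (off2 i y - 2 * psi1 i y * off1 i y) = (k i)\<^sup>2 * pb (kap i) (T i y) * f (Suc i) y"
proof (cases "y \<le> X (Suc i)")
  case False
  then show ?thesis using after[of i y] T_simps(2)[of i y] by (simp add: profiles_outside)
next
  case True
  note f = f_slab[OF assms True]
  have c: "clip (T i y) = T i y" using assms True T_simps[of i y] by simp
  show ?thesis
  proof (cases "1 / 2 \<le> T i y")
    case True
    then show ?thesis
      by (simp add: f pb_def bump_def off1_def off2_def psi1_def c exp_minus)
        (use len_pos[of i] k_pos[of i] in \<open>simp add: kap_def field_simps power2_eq_square\<close>)
  next
    case False
    then show ?thesis by (simp add: pb_def bump_def off1_def off2_def)
  qed
qed

definition prev :: "nat \<Rightarrow> real \<Rightarrow> real" where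
  "prev j y = (case j of 0 \<Rightarrow> 0 | Suc i \<Rightarrow> (k i)\<^sup>2 * pg (kap i) (T i y) * f i y)"

text \<open>Without cut-offs, \<open>amp j\<close> has second derivative (\<open>psi1\<close>^2 -
  \<open>psi2\<close>) \<open>amp j\<close>, which is how \<open>pa\<close> was chosen. The two
  cut-offs of mode \<open>j\<close> vary on opposite sides of \<open>X j\<close>, so no cross terms
  arise and the remainder is one of the two switching errors.\<close>

lemma mode_equation:
  "f2 j y = (k j)\<^sup>2 * (1 + pa (kap j) (T j y)) * f j y + (k j)\<^sup>2 * pb (kap j) (T j y) * f (Suc j) y + prev j y"
proof -
  have pp: "(psi1 j y)\<^sup>2 - psi2 j y = (k j)\<^sup>2 * (1 + pa (kap j) (T j y))"
    using k_pos[of j] len_pos[of j]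
    by (simp add: psi1_def psi2_def pa_def kap_def field_simps power2_eq_square)
  show ?thesis
  proof (cases "y \<le> X j")
    case True
    then have pb: "pb (kap j) (T j y) = 0" using T_simps(1)[of j y] by (simp add: profiles_outside)
    have "amp j y * (on2 j y - 2 * k j * on1 j y) = prev j y"
      using switch_on_error True by (cases j) (simp_all add: prev_def)
    then show ?thesis
      unfolding f2_def f_def pp pb using before[OF True] by (simp add: algebra_simps)
  next
    case False
    then have y: "X j \<le> y" by simp
    have "prev j y = 0"
      using y T_simps(2) by (cases j) (simp_all add: prev_def profiles_outside)
    moreover have "amp j y * (off2 j y - 2 * psi1 j y * off1 j y) = (k j)\<^sup>2 * pb (kap j) (T j y) * f (Suc j) y"
      by (rule switch_off_error[OF y])
    ultimately show ?thesis
      unfolding f2_def pp using on_after[OF y] by (simp add: f_def[of j] algebra_simps)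
  qed
qed

text \<open>The map c - \<open>gain\<close> c starts at 0 and has derivative \<open>rate\<close> -
  1. Hence \<open>psi i y\<close> is at least \<open>k i * y\<close>: raising the coefficient only
  helps the decay.\<close>

lemma shift_nonneg: "0 \<le> clip t - gain (clip t)"
proof -
  have "(\<lambda>c. c - gain c) 0 \<le> (\<lambda>c. c - gain c) (clip t)"
    by (rule DERIV_nonneg_imp_nondecreasing[OF clip_range(1)])
      (auto intro!: exI[of _ "rate _ - 1"] derivative_eq_intros simp: rate_ge_1)
  then show ?thesis by (simp add: gain_def)
qed

lemma f_nonneg: "0 \<le> f i y"
  using ramp_range by (cases i) (simp_all add: f_def amp_def off_def)

lemma f_le: "f i y \<le> exp (lam i - k i * y)"
proof -
  have "on i y * off i y \<le> 1 * 1"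
    using ramp_range by (intro mult_mono) (cases i; simp add: off_def)+
  then have "f i y \<le> amp i y * 1"
    unfolding f_def by (intro mult_left_mono) (auto simp: amp_def)
  moreover have "k i * y \<le> psi i y"
    using shift_nonneg[of "T i y"] k_pos[of i] len_pos[of i] by (simp add: psi_def)
  ultimately show ?thesis by (simp add: amp_def order_trans)
qed

lemma f_zero_after: "X (Suc i) \<le> y \<Longrightarrow> f i y = 0" "X (Suc i) \<le> y \<Longrightarrow> f1 i y = 0" "X (Suc i) \<le> y \<Longrightarrow> f2 i y = 0"
  by (simp_all add: f_def f1_def f2_def after)

lemma f_zero_before:
  "y \<le> X i \<Longrightarrow> f (Suc i) y = 0" "y \<le> X i \<Longrightarrow> f1 (Suc i) y = 0" "y \<le> X i \<Longrightarrow> f2 (Suc i) y = 0"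
  by (simp_all only: f_def f1_def f2_def before) simp_all

text \<open>\<open>lam (Suc i)\<close> is the sum of the earlier \<open>k m * X m\<close>; as
  \<open>k\<close> doubles and \<open>X\<close> increases, it is at most twice its last term. From
  \<open>X (Suc i)\<close> on, the exponent of mode \<open>Suc i\<close> is therefore at most
  \<open>- k (Suc i) * len i\<close>, the source of all decay estimates.\<close>

lemma lam_le: "lam (Suc i) \<le> k (Suc i) * X i"
proof (induction i)
  case 0
  then show ?case using X0 k_pos[of 0] by (simp add: k_Suc)
next
  case (Suc i)
  have "lam (Suc (Suc i)) \<le> k (Suc i) * X i + k (Suc i) * X (Suc i)" using Suc by simp
  also have "\<dots> \<le> k (Suc i) * X (Suc i) + k (Suc i) * X (Suc i)"
    using X_mono_le[of i "Suc i"] k_pos[of "Suc i"] by simp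
  finally show ?case by (simp add: k_Suc[of "Suc i"])
qed

end

text \<open>\<open>zeta\<close> smooths \<open>\<bar>x\<bar>\<close> inside \<open>\<bar>x\<bar> \<le> 1\<close>; the quartic matches \<open>\<bar>x\<bar>\<close> to second order at \<open>\<plusminus>1\<close>.\<close>

definition zeta :: "real \<Rightarrow> real" where
  "zeta x = (if \<bar>x\<bar> \<le> 1 then (3 + 6 * x\<^sup>2 - x ^ 4) / 8 else \<bar>x\<bar>)"
definition zeta1 :: "real \<Rightarrow> real" where
  "zeta1 x = (let c = 2 * clip ((x + 1) / 2) - 1 in (3 * c - c ^ 3) / 2)"
definition zeta2 :: "real \<Rightarrow> real" where
  "zeta2 x = (let c = 2 * clip ((x + 1) / 2) - 1 in (3 - 3 * c\<^sup>2) / 2)"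

lemma abs_le_zeta: "\<bar>x\<bar> \<le> zeta x"
proof (cases "\<bar>x\<bar> \<le> 1")
  case True
  \<comment> \<open>This product is 8 times the quartic minus 8 |x|; its triple zero at |x| = 1 is
    the second-order contact.\<close>
  have "0 \<le> (1 - \<bar>x\<bar>) ^ 3 * (3 + \<bar>x\<bar>)" using True by simp
  also have "\<dots> = 3 + 6 * \<bar>x\<bar>\<^sup>2 - \<bar>x\<bar> ^ 4 - 8 * \<bar>x\<bar>"
    by (simp add: power_numeral_reduce algebra_simps)
  finally have "0 \<le> 3 + 6 * x\<^sup>2 - x ^ 4 - 8 * \<bar>x\<bar>" by (simp add: power_even_abs)
  then show ?thesis using True by (simp add: zeta_def)
qed (simp add: zeta_def)

lemma zeta_le_1: "\<bar>x\<bar> \<le> 1 \<Longrightarrow> zeta x \<le> 1"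
proof -
  assume x: "\<bar>x\<bar> \<le> 1"
  then have "x\<^sup>2 \<le> 1" by (simp add: abs_square_le_1)
  then have "0 \<le> (1 - x\<^sup>2) * (5 - x\<^sup>2)" by simp
  then show ?thesis using x by (simp add: zeta_def power_numeral_reduce algebra_simps)
qed

lemma zeta12_outside:
  assumes "1 \<le> \<bar>x\<bar>"
  shows "(zeta1 x)\<^sup>2 = 1" "zeta2 x = 0"
proof -
  have "1 \<le> x \<or> x \<le> -1" using assms by linarith
  then have "2 * clip ((x + 1) / 2) - 1 = 1 \<or> 2 * clip ((x + 1) / 2) - 1 = -1" by auto
  then show "(zeta1 x)\<^sup>2 = 1" "zeta2 x = 0" by (auto simp: zeta1_def zeta2_def Let_def)
qed

lemma DERIV_zeta1: "(zeta1 has_real_derivative zeta2 x) (at x)"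
proof -
  have "((\<lambda>t. (\<lambda>s. (3 * (2 * s - 1) - (2 * s - 1) ^ 3) / 2) (clip t)) has_real_derivative
      (\<lambda>s. 3 - 3 * (2 * s - 1)\<^sup>2) (clip t)) (at t)" for t
    by (rule DERIV_comp_clip) (auto intro!: derivative_eq_intros simp: field_simps)
  note d = this
  have "((\<lambda>x. (x + 1) / 2) has_real_derivative 1 / 2) (at x)"
    by (auto intro!: derivative_eq_intros)
  from DERIV_chain2[OF d this] show ?thesis
    unfolding zeta1_def[abs_def] zeta2_def Let_def by (rule DERIV_cong) simp
qed

lemma DERIV_zeta: "(zeta has_real_derivative zeta1 x) (at x)"
proof -
  \<comment> \<open>Right of -1, \<open>zeta\<close> is x plus a remainder that is flat at 1 but not
    at -1, so clipping works on one side only; evenness supplies the half-line up to -1.\<close>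
  have right: "(zeta has_real_derivative zeta1 x) (at x)" if x: "-1 < x" for x
  proof -
    let ?N = "\<lambda>s. let c = 2 * s - 1 in (3 + 6 * c\<^sup>2 - c ^ 4) / 8 - c"
    have "((\<lambda>t. ?N (clip t)) has_real_derivative
        (\<lambda>s. let c = 2 * s - 1 in 3 * c - c ^ 3 - 2) (clip t)) (at t)" if "0 < t" for t
      unfolding Let_def
      by (rule DERIV_comp_clip) (use that in \<open>auto intro!: derivative_eq_intros simp: field_simps power_numeral_reduce\<close>)
    note d = this
    have a: "((\<lambda>x. (x + 1) / 2) has_real_derivative 1 / 2) (at x)"
      by (auto intro!: derivative_eq_intros)
    have "((\<lambda>x. x + ?N (clip ((x + 1) / 2))) has_real_derivative
        1 + (\<lambda>s. let c = 2 * s - 1 in 3 * c - c ^ 3 - 2) (clip ((x + 1) / 2)) * (1 / 2)) (at x)"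
      using x by (intro DERIV_add DERIV_ident DERIV_chain2[OF d a]) simp
    also have "1 + (\<lambda>s. let c = 2 * s - 1 in 3 * c - c ^ 3 - 2) (clip ((x + 1) / 2)) * (1 / 2) = zeta1 x"
      by (simp add: zeta1_def Let_def algebra_simps diff_divide_distrib)
    finally have "((\<lambda>x. x + ?N (clip ((x + 1) / 2))) has_real_derivative zeta1 x) (at x)" .
    moreover have "x + ?N (clip ((x + 1) / 2)) = zeta x" if "-1 < x" for x
    proof (cases "x \<le> 1")
      case True
      then have *: "2 * clip ((x + 1) / 2) - 1 = x" using that by (simp add: field_simps)
      have "\<bar>x\<bar> \<le> 1" using True that by simp
      then show ?thesis unfolding * Let_def by (simp add: zeta_def)
    qed (simp add: zeta_def Let_def)
    ultimately show ?thesis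
      using x
      by (elim has_field_derivative_transform_within_open[of _ _ x "{-1<..}" zeta]) simp_all
  qed
  show ?thesis
  proof (cases "-1 < x")
    case False
    have even: "zeta (- x) = zeta x" for x by (simp add: zeta_def)
    have "((\<lambda>x. zeta (- x)) has_real_derivative - zeta1 (- x)) (at x)"
      using DERIV_chain2[OF right[of "- x"] DERIV_minus[OF DERIV_ident]] False by simp
    moreover have "zeta1 (- x) = 1" "zeta1 x = - 1" using False by (simp_all add: zeta1_def)
    ultimately show ?thesis by (simp add: even)
  qed (rule right)
qed

declare DERIV_zeta[THEN DERIV_chain2, derivative_intros]
  DERIV_zeta1[THEN DERIV_chain2, derivative_intros]

lemma continuous_zeta [continuous_intros]:
  "continuous_on S h \<Longrightarrow> continuous_on S (\<lambda>x. zeta (h x))"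
  "continuous_on S h \<Longrightarrow> continuous_on S (\<lambda>x. zeta1 (h x))"
  "continuous_on S h \<Longrightarrow> continuous_on S (\<lambda>x. zeta2 (h x))"
proof -
  have "continuous_on UNIV zeta" "continuous_on UNIV zeta1"
    by (intro DERIV_continuous_on[where D = zeta1] DERIV_continuous_on[where D = zeta2] DERIV_zeta DERIV_zeta1)+
  then show "continuous_on S h \<Longrightarrow> continuous_on S (\<lambda>x. zeta (h x))"
    "continuous_on S h \<Longrightarrow> continuous_on S (\<lambda>x. zeta1 (h x))"
    by (auto intro: continuous_on_compose2)
  show "continuous_on S h \<Longrightarrow> continuous_on S (\<lambda>x. zeta2 (h x))"
    unfolding zeta2_def Let_def by (intro continuous_intros) auto
qed

lemma abs_zeta1_le: "\<bar>zeta1 x\<bar> \<le> 1"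
proof -
  define c where "c = 2 * clip ((x + 1) / 2) - 1"
  have c: "-1 \<le> c" "c \<le> 1" using clip_range[of "(x + 1) / 2"] by (auto simp: c_def)
  have "0 \<le> (1 - c)\<^sup>2 * (c + 2)" "0 \<le> (1 + c)\<^sup>2 * (2 - c)" using c by auto
  then have "3 * c - c ^ 3 \<le> 2" "-2 \<le> 3 * c - c ^ 3"
    by (simp_all add: power_numeral_reduce algebra_simps)
  then show ?thesis by (simp add: zeta1_def c_def[symmetric])
qed

lemma abs_zeta2_le: "\<bar>zeta2 x\<bar> \<le> 3 / 2"
proof -
  define c where "c = 2 * clip ((x + 1) / 2) - 1"
  have "\<bar>c\<bar> \<le> 1" using clip_range[of "(x + 1) / 2"] by (auto simp: c_def)
  then have "c\<^sup>2 \<le> 1" "0 \<le> c\<^sup>2" by (simp_all add: abs_square_le_1)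
  then show ?thesis by (simp add: zeta2_def c_def[symmetric])
qed

section \<open>Locally finite sums over the modes\<close>

context modes
begin

definition Y :: "real^3 \<Rightarrow> real" where "Y p = zeta (p $ 3)"

text \<open>Since \<open>X\<close> is unbounded and \<open>Y\<close> continuous, each point has a
  neighbourhood on which the series is a finite sum with a fixed number of terms; continuity and
  derivatives then pass to \<open>lsum\<close> termwise.\<close>

definition locfin :: "(nat \<Rightarrow> real^3 \<Rightarrow> 'b::zero) \<Rightarrow> bool" where
  "locfin F \<longleftrightarrow> (\<forall>n p. Y p < X n \<longrightarrow> (\<forall>i>n. F i p = 0))"

definition lsum :: "(nat \<Rightarrow> real^3 \<Rightarrow> 'b::real_normed_vector) \<Rightarrow> real^3 \<Rightarrow> 'b" where
  "lsum F p = (\<Sum>i. F i p)"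

lemma lsum_eq:
  assumes "locfin F" "Y p < X n"
  shows "lsum F p = (\<Sum>i\<le>n. F i p)"
  unfolding lsum_def
  by (rule suminf_finite) (use assms in \<open>auto simp: locfin_def\<close>)

lemma continuous_Y [continuous_intros]: "continuous_on S Y"
  unfolding Y_def[abs_def] by (intro continuous_intros)

lemma open_Y: "open {q. Y q < c}"
  by (intro open_Collect_less continuous_intros)

lemma lsum_periodic:
  assumes "\<And>i. torus_periodic (F i)"
  shows "torus_periodic (lsum F)"
  using assms by (simp add: torus_periodic_def lsum_def)

lemma continuous_lsum:
  assumes "locfin F" "\<And>i. continuous_on UNIV (F i)"
  shows "continuous_on UNIV (lsum F)"
proof -
  have "isCont (lsum F) p" for p
  proof -
    obtain n where n: "Y p < X n" using X_unbounded by blast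
    have "continuous_on {q. Y q < X n} (lsum F) \<longleftrightarrow> continuous_on {q. Y q < X n} (\<lambda>p. \<Sum>i\<le>n. F i p)"
      by (rule continuous_on_cong) (auto simp: lsum_eq[OF assms(1)])
    also have "\<dots>"
      by (intro continuous_on_sum continuous_on_subset[OF assms(2)]) auto
    finally show ?thesis
      using continuous_on_eq_continuous_at[OF open_Y] n by blast
  qed
  then show ?thesis by (simp add: continuous_at_imp_continuous_on)
qed

lemma has_derivative_lsum:
  assumes "locfin F" "\<And>i. (F i has_derivative F' i) (at p)" "Y p < X n"
  shows "(lsum F has_derivative (\<lambda>v. \<Sum>i\<le>n. F' i v)) (at p)"
proof -
  have "((\<lambda>p. \<Sum>i\<le>n. F i p) has_derivative (\<lambda>v. \<Sum>i\<le>n. F' i v)) (at p)"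
    by (intro has_derivative_sum assms(2))
  then show ?thesis
    by (rule has_derivative_transform_within_open[OF _ open_Y[of "X n"]])
      (use assms in \<open>auto simp: lsum_eq\<close>)
qed

lemma DERIV_lsum:
  fixes F D :: "nat \<Rightarrow> real^3 \<Rightarrow> real"
  assumes "locfin F" "locfin D"
    and "\<And>i p. ((\<lambda>s. F i (p + s *\<^sub>R axis a 1)) has_real_derivative D i p) (at 0)"
  shows "((\<lambda>s. lsum F (p + s *\<^sub>R axis a 1)) has_real_derivative lsum D p) (at 0)"
proof -
  obtain n where n: "Y p < X n" using X_unbounded by blast
  have op: "open {s. Y (p + s *\<^sub>R axis a 1) < X n}"
    unfolding Y_def by (intro open_Collect_less continuous_intros)
  have "((\<lambda>s. \<Sum>i\<le>n. F i (p + s *\<^sub>R axis a 1)) has_real_derivative (\<Sum>i\<le>n. D i p)) (at 0)"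
    by (intro DERIV_sum assms(3))
  then have "((\<lambda>s. lsum F (p + s *\<^sub>R axis a 1)) has_real_derivative (\<Sum>i\<le>n. D i p)) (at 0)"
    by (rule has_field_derivative_transform_within_open[OF _ op])
      (use n assms in \<open>auto simp: lsum_eq\<close>)
  then show ?thesis by (simp add: lsum_eq[OF assms(2) n])
qed

end

section \<open>The solution\<close>

lemma cos_sin_periodic:
  "cos (real n * (x + 2 * pi)) = cos (real n * x)" "sin (real n * (x + 2 * pi)) = sin (real n * x)"
proof -
  have "real n * (x + 2 * pi) = real n * x + 2 * real n * pi" by (simp add: algebra_simps)
  then show "cos (real n * (x + 2 * pi)) = cos (real n * x)" "sin (real n * (x + 2 * pi)) = sin (real n * x)"
    by (simp_all only: cos_add sin_add cos_2npi sin_2npi)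
qed

context modes
begin

declare DERIV_f[THEN DERIV_chain2, derivative_intros] DERIV_f1[THEN DERIV_chain2, derivative_intros]

definition r :: "nat \<Rightarrow> 3" where "r j = (if even j then 1 else 2)"
definition C :: "nat \<Rightarrow> real^3 \<Rightarrow> real" where "C j p = cos (k j * p $ r j)"
definition S :: "nat \<Rightarrow> real^3 \<Rightarrow> real" where "S j p = sin (k j * p $ r j)"

definition U :: "nat \<Rightarrow> real^3 \<Rightarrow> real" where "U j p = f j (Y p) * C j p"
definition dU :: "3 \<Rightarrow> nat \<Rightarrow> real^3 \<Rightarrow> real" where
  "dU a j p = (if a = 3 then zeta1 (p $ 3) * f1 j (Y p) * C j p
     else if a = r j then - k j * f j (Y p) * S j p else 0)"
definition ddU :: "3 \<Rightarrow> nat \<Rightarrow> real^3 \<Rightarrow> real" where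
  "ddU a j p = (if a = 3 then (zeta2 (p $ 3) * f1 j (Y p) + (zeta1 (p $ 3))\<^sup>2 * f2 j (Y p)) * C j p
     else if a = r j then - (k j)\<^sup>2 * f j (Y p) * C j p else 0)"

definition Pa :: "nat \<Rightarrow> real^3 \<Rightarrow> real" where "Pa i p = pa (kap i) (T i (Y p))"
definition Pb :: "nat \<Rightarrow> real^3 \<Rightarrow> real" where "Pb i p = pb (kap i) (T i (Y p))"
definition Pg :: "nat \<Rightarrow> real^3 \<Rightarrow> real" where "Pg i p = pg (kap i) (T i (Y p))"
definition Qb :: "nat \<Rightarrow> real^3 \<Rightarrow> real" where "Qb i p = qb (kap i) (T i (Y p))"
definition Qg :: "nat \<Rightarrow> real^3 \<Rightarrow> real" where "Qg i p = qg (kap i) (T i (Y p))"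

definition M1 :: "nat \<Rightarrow> real^3 \<Rightarrow> real" where
  "M1 i p = Pa i p + Pg i p * C i p * C (Suc i) p - 2 * Qg i p * (S (Suc i) p)\<^sup>2"
definition M2 :: "nat \<Rightarrow> real^3 \<Rightarrow> real" where
  "M2 i p = (Pb i p + Pg i p) * S i p * S (Suc i) p"
definition M3 :: "nat \<Rightarrow> real^3 \<Rightarrow> real" where
  "M3 i p = Pb i p * C i p * C (Suc i) p / 4 - Qb i p * (S i p)\<^sup>2 / 2"

text \<open>
  \<open>M1\<close>, \<open>M2\<close>, \<open>M3\<close> come from solving \<open>B \<nabla>u = F\<close> for a symmetric \<open>B\<close>, where the flux \<open>F\<close> has the
  prescribed divergence and is divisible by the sine of the dominant mode, so that \<open>B\<close> is smooth.
\<close>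

definition E :: "3 \<Rightarrow> 3 \<Rightarrow> real^3^3" where "E a b = (\<chi> m n. if m = a \<and> n = b then 1 else 0)"

definition B :: "nat \<Rightarrow> real^3 \<Rightarrow> real^3^3" where
  "B i p = M1 i p *\<^sub>R E (r i) (r i) + M2 i p *\<^sub>R (E (r i) (r (Suc i)) + E (r (Suc i)) (r i))
     + M3 i p *\<^sub>R E (r (Suc i)) (r (Suc i))"

text \<open>\<open>Fl a i\<close> is the component \<open>a\<close> of the flux \<open>B i \<nabla>u\<close>, and \<open>dFl a i\<close> its derivative in the direction \<open>a\<close>.\<close>

definition Fl :: "3 \<Rightarrow> nat \<Rightarrow> real^3 \<Rightarrow> real" where
  "Fl a i p =
    (if a = r i then - k i * Pa i p * f i (Y p) * S i p
        - k i * Pg i p * f i (Y p) * C (Suc i) p * S i p * C i p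
        - 2 * k i * Pb i p * f (Suc i) (Y p) * S i p * (S (Suc i) p)\<^sup>2
     else if a = r (Suc i) then
        - k i / 2 * Pb i p * f (Suc i) (Y p) * C i p * S (Suc i) p * C (Suc i) p
        - k i * Pg i p * f i (Y p) * S (Suc i) p * (S i p)\<^sup>2
     else 0)"
definition dFl :: "3 \<Rightarrow> nat \<Rightarrow> real^3 \<Rightarrow> real" where
  "dFl a i p =
    (if a = r i then - (k i)\<^sup>2 * Pa i p * f i (Y p) * C i p
        - (k i)\<^sup>2 * Pg i p * f i (Y p) * C (Suc i) p * ((C i p)\<^sup>2 - (S i p)\<^sup>2)
        - 2 * (k i)\<^sup>2 * Pb i p * f (Suc i) (Y p) * C i p * (S (Suc i) p)\<^sup>2
     else if a = r (Suc i) then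
        - (k i)\<^sup>2 * Pb i p * f (Suc i) (Y p) * C i p * ((C (Suc i) p)\<^sup>2 - (S (Suc i) p)\<^sup>2)
        - 2 * (k i)\<^sup>2 * Pg i p * f i (Y p) * C (Suc i) p * (S i p)\<^sup>2
     else 0)"

definition u :: "real^3 \<Rightarrow> real" where "u = lsum U"
definition g :: "real^3 \<Rightarrow> real^3" where "g p = (\<chi> a. lsum (dU a) p)"
definition A :: "real^3 \<Rightarrow> real^3^3" where "A p = mat 1 + lsum B p"
definition V :: "real^3 \<Rightarrow> real" where
  "V p = (k 0)\<^sup>2 * ((zeta1 (p $ 3))\<^sup>2 - 1) - k 0 * zeta2 (p $ 3)"

lemma r_simps [simp]: "r i \<noteq> 3" "3 \<noteq> r i" "r i \<noteq> r (Suc i)" "r (Suc i) \<noteq> r i" "r (Suc (Suc i)) = r i"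
  by (auto simp: r_def)

lemma profiles_zero:
  assumes "Y p \<le> X i \<or> X (Suc i) \<le> Y p"
  shows "Pa i p = 0" "Pb i p = 0" "Pg i p = 0" "Qb i p = 0" "Qg i p = 0"
  using profiles_outside[of "T i (Y p)"] assms T_simps[of i "Y p"]
  by (auto simp: Pa_def Pb_def Pg_def Qb_def Qg_def)

lemma before_X:
  assumes "Y p < X n" "n < i"
  shows "Y p \<le> X (i - 1) \<and> Y p \<le> X i \<and> i = Suc (i - 1)"
proof -
  have i: "n \<le> i - 1" "n \<le> i" "i = Suc (i - 1)" using assms(2) by auto
  then show ?thesis using X_mono_le[OF i(1)] X_mono_le[OF i(2)] assms(1) by linarith
qed

lemma f_zero_gt:
  assumes "Y p < X n" "n < i"
  shows "f i (Y p) = 0" "f1 i (Y p) = 0" "f2 i (Y p) = 0"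
  using before_X[OF assms] f_zero_before[of "Y p" "i - 1"] by metis+

lemma locfin:
  "locfin U" "locfin (dU a)" "locfin (ddU a)" "locfin (Fl a)" "locfin (dFl a)" "locfin B"
  unfolding locfin_def
proof (safe)
  fix n p i assume np: "Y p < X n" "n < i"
  note z = f_zero_gt[OF np] profiles_zero[of p i]
  have "Y p \<le> X i" using before_X[OF np] by simp
  then show "U i p = 0" "dU a i p = 0" "ddU a i p = 0" "Fl a i p = 0" "dFl a i p = 0" "B i p = 0"
    using z by (simp_all add: U_def dU_def ddU_def Fl_def dFl_def B_def M1_def M2_def M3_def)
qed

lemma continuous_f [continuous_intros]:
  "continuous_on Z h \<Longrightarrow> continuous_on Z (\<lambda>x. f i (h x))"
  "continuous_on Z h \<Longrightarrow> continuous_on Z (\<lambda>x. f1 i (h x))"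
  "continuous_on Z h \<Longrightarrow> continuous_on Z (\<lambda>x. f2 i (h x))"
proof -
  have 1: "continuous_on UNIV (f i)" "continuous_on UNIV (f1 i)"
    by (intro DERIV_continuous_on[where D = "f1 i"] DERIV_continuous_on[where D = "f2 i"] DERIV_f DERIV_f1)+
  have T: "continuous_on UNIV (T j)" for j
    by (rule DERIV_continuous_on[where D = "\<lambda>_. 1 / len j"]) (rule DERIV_T)
  have ramp2: "continuous_on UNIV ramp2"
    by (rule DERIV_continuous_on) (rule DERIV_ramp2)
  have rate1: "continuous_on UNIV rate1"
    by (rule DERIV_continuous_on) (rule DERIV_rate1)
  have r2: "continuous_on UNIV (\<lambda>y. ramp2 (2 * T j y))" for j
    by (rule continuous_on_compose2[OF ramp2]) (intro continuous_intros T, rule subset_UNIV)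
  have off2: "continuous_on UNIV (off2 j)" for j
    unfolding off2_def[abs_def]
    by (intro continuous_on_mult_left continuous_on_compose2[OF ramp2] continuous_on_diff
        continuous_on_const T subset_UNIV)
  have on2: "continuous_on UNIV (on2 j)" for j
    by (cases j) (simp_all only: on2.simps continuous_on_mult_left[OF r2] continuous_on_const)
  have psi2: "continuous_on UNIV (psi2 i)"
    unfolding psi2_def[abs_def] divide_inverse
    by (intro continuous_on_mult_left continuous_on_mult_right continuous_on_compose2[OF rate1]
        continuous_clip T subset_UNIV)
  have o: "continuous_on UNIV (amp i)" "continuous_on UNIV (on i)" "continuous_on UNIV (on1 i)"
    "continuous_on UNIV (off i)" "continuous_on UNIV (off1 i)" "continuous_on UNIV (psi1 i)"
    using DERIV_continuous_on[of UNIV, OF DERIV_amp] DERIV_continuous_on[of UNIV, OF DERIV_on]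
      DERIV_continuous_on[of UNIV, OF DERIV_on1] DERIV_continuous_on[of UNIV, OF DERIV_off]
      DERIV_continuous_on[of UNIV, OF DERIV_off1] DERIV_continuous_on[of UNIV, OF DERIV_psi1]
    by auto
  have "continuous_on UNIV (f2 i)"
    unfolding f2_def[abs_def] by (intro continuous_intros o on2 off2 psi2)
  with 1 show "continuous_on Z h \<Longrightarrow> continuous_on Z (\<lambda>x. f i (h x))"
    "continuous_on Z h \<Longrightarrow> continuous_on Z (\<lambda>x. f1 i (h x))"
    "continuous_on Z h \<Longrightarrow> continuous_on Z (\<lambda>x. f2 i (h x))"
    by (auto intro: continuous_on_compose2)
qed

lemma continuous_profiles [continuous_intros]:
  "continuous_on Z (Pa i)" "continuous_on Z (Pb i)" "continuous_on Z (Pg i)"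
  "continuous_on Z (Qb i)" "continuous_on Z (Qg i)" "continuous_on Z (C i)" "continuous_on Z (S i)"
proof -
  have "continuous_on UNIV (\<lambda>y. T i y)"
    by (rule DERIV_continuous_on[where D = "\<lambda>_. 1 / len i"]) (rule DERIV_T)
  then have T: "continuous_on Z (\<lambda>p. T i (Y p))"
    by (rule continuous_on_compose2[OF _ continuous_Y]) auto
  have c: "continuous_on UNIV (pa c)" "continuous_on UNIV (pb c)" "continuous_on UNIV (pg c)"
    "continuous_on UNIV (qb c)" "continuous_on UNIV (qg c)" for c
    using DERIV_continuous_on[of UNIV, OF DERIV_pa] DERIV_continuous_on[of UNIV, OF DERIV_pb]
      DERIV_continuous_on[of UNIV, OF DERIV_pg] DERIV_continuous_on[of UNIV, OF DERIV_qb]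
      DERIV_continuous_on[of UNIV, OF DERIV_qg]
    by auto
  show "continuous_on Z (Pa i)" "continuous_on Z (Pb i)" "continuous_on Z (Pg i)"
    "continuous_on Z (Qb i)" "continuous_on Z (Qg i)"
    unfolding Pa_def[abs_def] Pb_def[abs_def] Pg_def[abs_def] Qb_def[abs_def] Qg_def[abs_def]
    by (intro continuous_on_compose2[OF c(1) T] continuous_on_compose2[OF c(2) T] continuous_on_compose2[OF c(3) T]
      continuous_on_compose2[OF c(4) T] continuous_on_compose2[OF c(5) T] subset_UNIV)+
  show "continuous_on Z (C i)" "continuous_on Z (S i)"
    unfolding C_def[abs_def] S_def[abs_def] by (intro continuous_intros)+
qed

lemma continuous_terms:
  "continuous_on UNIV (U i)" "continuous_on UNIV (dU a i)" "continuous_on UNIV (ddU a i)"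
  "continuous_on UNIV (Fl a i)" "continuous_on UNIV (dFl a i)"
proof -
  show "continuous_on UNIV (U i)"
    unfolding U_def[abs_def] by (intro continuous_intros)
  show "continuous_on UNIV (dU a i)"
    unfolding dU_def[abs_def] by (cases "a = 3"; cases "a = r i") (auto intro!: continuous_intros)
  show "continuous_on UNIV (ddU a i)"
    unfolding ddU_def[abs_def] by (cases "a = 3"; cases "a = r i") (auto intro!: continuous_intros)
  show "continuous_on UNIV (Fl a i)"
    unfolding Fl_def[abs_def] by (cases "a = r i"; cases "a = r (Suc i)") (auto intro!: continuous_intros)
  show "continuous_on UNIV (dFl a i)"
    unfolding dFl_def[abs_def] by (cases "a = r i"; cases "a = r (Suc i)") (auto intro!: continuous_intros)
qed

lemma periodic_basic:
  assumes "b = 1 \<or> b = 2"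
  shows "C i (p + (2 * pi) *\<^sub>R axis b 1) = C i p" "S i (p + (2 * pi) *\<^sub>R axis b 1) = S i p"
    "(p + (2 * pi) *\<^sub>R axis b 1) $ 3 = p $ 3" "Y (p + (2 * pi) *\<^sub>R axis b 1) = Y p"
proof -
  have "(p + (2 * pi) *\<^sub>R axis b 1) $ r i = (if b = r i then p $ r i + 2 * pi else p $ r i)"
    by (simp add: axis_def)
  then show "C i (p + (2 * pi) *\<^sub>R axis b 1) = C i p" "S i (p + (2 * pi) *\<^sub>R axis b 1) = S i p"
    by (simp_all add: C_def S_def k_def cos_sin_periodic del: of_nat_mult of_nat_power)
  show "(p + (2 * pi) *\<^sub>R axis b 1) $ 3 = p $ 3" using assms by (auto simp: axis_def)
  then show "Y (p + (2 * pi) *\<^sub>R axis b 1) = Y p" by (simp add: Y_def)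
qed

lemma periodic_terms:
  "torus_periodic (U i)" "torus_periodic (dU a i)" "torus_periodic (B i)" "torus_periodic V"
  by (simp_all only: torus_periodic_def U_def dU_def B_def M1_def M2_def M3_def V_def
      Pa_def Pb_def Pg_def Qb_def Qg_def periodic_basic simp_thms)

lemma shift_component: "(p + s *\<^sub>R axis a 1) $ b = p $ b + (if b = a then s else (0::real))"
  by (simp add: axis_def)

lemma DERIV_U: "((\<lambda>s. U j (p + s *\<^sub>R axis a 1)) has_real_derivative dU a j p) (at 0)"
  unfolding U_def dU_def C_def S_def Y_def shift_component
  by (cases "a = 3"; cases "a = r j") (auto intro!: derivative_eq_intros)

lemma DERIV_dU: "((\<lambda>s. dU a j (p + s *\<^sub>R axis a 1)) has_real_derivative ddU a j p) (at 0)"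
  unfolding ddU_def dU_def C_def S_def Y_def shift_component
  by (cases "a = 3"; cases "a = r j") (auto intro!: derivative_eq_intros simp: power2_eq_square algebra_simps)

text \<open>\<open>r i\<close> and \<open>r (Suc i)\<close> are different angles, so differentiating
  in one of them leaves the other mode's sines and cosines and all radial factors constant.\<close>

lemma DERIV_Fl: "((\<lambda>s. Fl a i (p + s *\<^sub>R axis a 1)) has_real_derivative dFl a i p) (at 0)"
proof (cases "a = r i \<or> a = r (Suc i)")
  case True
  then show ?thesis
    unfolding Fl_def dFl_def C_def S_def Y_def Pa_def Pb_def Pg_def shift_component
    by (auto intro!: derivative_eq_intros simp: k_Suc) (simp_all add: power2_eq_square field_simps)
qed (simp add: Fl_def dFl_def)

end

section \<open>The flux identity and the equation\<close>

context modes
begin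

lemma E_mult: "(E a b *v v) $ m = (if m = a then v $ b else 0)"
  by (simp add: E_def matrix_vector_mult_def if_distrib[of "\<lambda>x. x * _"] cong: if_cong)

lemma B_mult:
  "(B i p *v v) $ a = (if a = r i then M1 i p * v $ r i + M2 i p * v $ r (Suc i)
     else if a = r (Suc i) then M2 i p * v $ r i + M3 i p * v $ r (Suc i) else 0)"
  by (simp add: B_def matrix_vector_mult_add_rdistrib scaleR_matrix_vector_assoc[symmetric] E_mult)

text \<open>Here the alternation of the angles pays off: earlier modes are already off, later ones
  not yet on, and the two survivors vary in different angles.\<close>

lemma g_slab:
  assumes "X i \<le> Y p" "Y p < X (Suc i)"
  shows "g p $ r i = - k i * f i (Y p) * S i p"
    and "g p $ r (Suc i) = - k (Suc i) * f (Suc i) (Y p) * S (Suc i) p"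
proof -
  have z: "f j (Y p) = 0" if "j < i" for j
    using f_zero_after(1)[of j "Y p"] X_mono_le[of "Suc j" i] that assms by simp
  have single: "lsum (dU (r m)) p = dU (r m) m p" if m: "m = i \<or> m = Suc i" for m
  proof -
    have "dU (r m) j p = 0" if "j \<le> Suc i" "j \<noteq> m" for j
    proof (cases "j < i")
      case False
      then have "r m \<noteq> r j" using that m by (auto simp: le_Suc_eq not_less)
      then show ?thesis by (simp add: dU_def)
    qed (simp add: dU_def z)
    then have "(\<Sum>j\<le>Suc i. dU (r m) j p) = (\<Sum>j\<in>{m}. dU (r m) j p)"
      using m by (intro sum.mono_neutral_right) auto
    then show ?thesis using lsum_eq[OF locfin(2) assms(2)] by simp
  qed
  show "g p $ r i = - k i * f i (Y p) * S i p" "g p $ r (Suc i) = - k (Suc i) * f (Suc i) (Y p) * S (Suc i) p"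
    by (simp_all add: g_def single) (simp_all add: dU_def)
qed

text \<open>In the \<open>Pg\<close> part the flux along \<open>r (Suc i)\<close> dictates the
  off-diagonal entry. Symmetry copies that entry into the other row, where it produces an unwanted
  term with \<open>Pg i p * f (Suc i) (Y p)\<close>; the \<open>Qg\<close> term of \<open>M1\<close>
  cancels it by the slab relation. The \<open>Pb\<close> part is the mirror image, with
  \<open>Qb\<close> in \<open>M3\<close>.\<close>

lemma B_flux: "(B i p *v g p) $ a = Fl a i p"
proof (cases "X i < Y p \<and> Y p < X (Suc i)")
  case False
  then have "Y p \<le> X i \<or> X (Suc i) \<le> Y p" by auto
  note z = profiles_zero[OF this]
  show ?thesis by (simp add: B_mult Fl_def M1_def M2_def M3_def z)
next
  case True
  then have gs: "g p $ r i = - k i * f i (Y p) * S i p"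
    "g p $ r (Suc i) = - (2 * k i) * f (Suc i) (Y p) * S (Suc i) p"
    using g_slab[of i p] by (simp_all add: k_Suc)
  have rel: "Qg i p * f i (Y p) = Pg i p * f (Suc i) (Y p)" "Qb i p * f (Suc i) (Y p) = Pb i p * f i (Y p)"
    unfolding Qg_def Pg_def Qb_def Pb_def by (rule slab_relations)+
  have "M1 i p * g p $ r i + M2 i p * g p $ r (Suc i) = Fl (r i) i p
      + 2 * k i * S i p * (S (Suc i) p)\<^sup>2 * (Qg i p * f i (Y p) - Pg i p * f (Suc i) (Y p))"
    unfolding M1_def M2_def Fl_def gs by (simp add: algebra_simps power2_eq_square)
  moreover have "M2 i p * g p $ r i + M3 i p * g p $ r (Suc i) = Fl (r (Suc i)) i p
      + k i * S (Suc i) p * (S i p)\<^sup>2 * (Qb i p * f (Suc i) (Y p) - Pb i p * f i (Y p))"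
    unfolding M2_def M3_def Fl_def gs by (simp add: algebra_simps power2_eq_square)
  ultimately show ?thesis
    unfolding B_mult rel by (simp add: Fl_def)
qed

lemma flux_eq: "(A p *v g p) $ a = lsum (dU a) p + lsum (Fl a) p"
proof -
  obtain n where n: "Y p < X n" using X_unbounded by blast
  have "(lsum B p *v g p) $ a = (\<Sum>i\<le>n. (B i p *v g p) $ a)"
    unfolding lsum_eq[OF locfin(6) n] matrix_vector_mult_def
    by (simp add: sum_distrib_right) (rule sum.swap)
  also have "\<dots> = lsum (Fl a) p" by (simp add: B_flux lsum_eq[OF locfin(4) n])
  finally show ?thesis
    by (simp add: A_def matrix_vector_mult_add_rdistrib g_def)
qed

definition D :: "3 \<Rightarrow> real^3 \<Rightarrow> real" where "D a p = lsum (ddU a) p + lsum (dFl a) p"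

lemma sum_ddU:
  "(\<Sum>a\<in>UNIV. ddU a j p) = (zeta2 (p $ 3) * f1 j (Y p) + (zeta1 (p $ 3))\<^sup>2 * f2 j (Y p)
     - (k j)\<^sup>2 * f j (Y p)) * C j p"
  by (cases "even j") (simp_all add: sum_3 ddU_def r_def algebra_simps)

text \<open>One direction yields cos^2 - sin^2 of the dominant mode and the other 2 sin^2, which add
  up to 1. The coefficients in \<open>Fl\<close> are tuned to this through
  \<open>k (Suc i) = 2 * k i\<close>.\<close>

lemma sum_dFl:
  "(\<Sum>a\<in>UNIV. dFl a i p) = - (k i)\<^sup>2 * Pa i p * f i (Y p) * C i p
     - (k i)\<^sup>2 * Pg i p * f i (Y p) * C (Suc i) p - (k i)\<^sup>2 * Pb i p * f (Suc i) (Y p) * C i p"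
proof -
  have CS: "(C j p)\<^sup>2 = 1 - (S j p)\<^sup>2" for j by (simp add: C_def S_def cos_squared_eq)
  have "(\<Sum>a\<in>UNIV. dFl a i p) = dFl (r i) i p + dFl (r (Suc i)) i p"
    by (cases "even i") (simp_all add: sum_3 dFl_def r_def)
  then show ?thesis by (simp add: dFl_def CS algebra_simps)
qed

text \<open>For |x| < 1 one has \<open>Y p\<close> at most 1, hence at most \<open>X 0\<close>, so
  only mode 0 is present, and it is a pure exponential. Its derivatives are explicit multiples of
  itself, which is why the mismatch due to the smoothing has the form of a potential not depending
  on \<open>u\<close>.\<close>

lemma reflect_term:
  "zeta2 (p $ 3) * f1 j (Y p) + (zeta1 (p $ 3))\<^sup>2 * f2 j (Y p) = f2 j (Y p) + V p * f j (Y p)"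
proof (cases "1 \<le> \<bar>p $ 3\<bar>")
  case True
  then show ?thesis by (simp add: V_def zeta12_outside)
next
  case False
  then have y: "Y p \<le> X 0" using zeta_le_1[of "p $ 3"] X0 by (simp add: Y_def)
  show ?thesis
  proof (cases j)
    case 0
    have "f1 0 (Y p) = - k 0 * f 0 (Y p)" "f2 0 (Y p) = (k 0)\<^sup>2 * f 0 (Y p)"
      using before[OF y] by (simp_all add: f_def f1_def f2_def)
    then show ?thesis by (simp add: 0 V_def algebra_simps)
  next
    case (Suc i)
    then show ?thesis using f_zero_before[of "Y p" i] X_mono_le[of 0 i] y by simp
  qed
qed

lemma divergence: "(\<Sum>a\<in>UNIV. D a p) = V p * u p"
proof -
  obtain n where n: "Y p < X n" using X_unbounded by blast
  have "(\<Sum>a\<in>UNIV. D a p) = (\<Sum>a\<in>UNIV. (\<Sum>j\<le>n. ddU a j p) + (\<Sum>j\<le>n. dFl a j p))"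
    by (simp add: D_def lsum_eq[OF locfin(3) n] lsum_eq[OF locfin(5) n])
  also have "\<dots> = (\<Sum>j\<le>n. (\<Sum>a\<in>UNIV. ddU a j p) + (\<Sum>a\<in>UNIV. dFl a j p))"
    unfolding sum.distrib by (simp add: sum.swap[of _ UNIV])
  \<comment> \<open>The flux of slab \<open>j\<close> cancels the switching-off error of mode
    \<open>j\<close> and supplies the term against the switching-on error of mode
    \<open>Suc j\<close>. The sum therefore telescopes, and its last term vanishes because
    \<open>Y p\<close> has not reached slab \<open>n\<close>.\<close>
  also have "\<dots> = (\<Sum>j\<le>n. V p * U j p + prev j (Y p) * C j p - prev (Suc j) (Y p) * C (Suc j) p)"
  proof (rule sum.cong[OF refl])
    fix j
    have "(\<Sum>a\<in>UNIV. ddU a j p) = (f2 j (Y p) + V p * f j (Y p) - (k j)\<^sup>2 * f j (Y p)) * C j p"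
      by (simp only: sum_ddU reflect_term)
    then show "(\<Sum>a\<in>UNIV. ddU a j p) + (\<Sum>a\<in>UNIV. dFl a j p)
        = V p * U j p + prev j (Y p) * C j p - prev (Suc j) (Y p) * C (Suc j) p"
      unfolding sum_dFl mode_equation[of j] U_def
      by (simp add: prev_def[of "Suc j"] Pa_def Pb_def Pg_def algebra_simps)
  qed
  also have "\<dots> = V p * (\<Sum>j\<le>n. U j p) + (\<Sum>j\<le>n. prev j (Y p) * C j p - prev (Suc j) (Y p) * C (Suc j) p)"
    by (simp add: sum.distrib sum_subtractf sum_distrib_left)
  also have "(\<Sum>j\<le>n. prev j (Y p) * C j p - prev (Suc j) (Y p) * C (Suc j) p)
      = prev 0 (Y p) * C 0 p - prev (Suc n) (Y p) * C (Suc n) p"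
    by (rule sum_telescope)
  also have "\<dots> = 0"
    using profiles_zero(3)[of p n] n by (simp add: prev_def Pg_def)
  also have "(\<Sum>j\<le>n. U j p) = u p"
    by (simp add: u_def lsum_eq[OF locfin(1) n])
  finally show ?thesis by simp
qed

lemma continuous_u: "continuous_on UNIV u"
  unfolding u_def by (intro continuous_lsum locfin continuous_terms)

lemma continuous_vec3:
  "(\<And>a. continuous_on Z (\<lambda>p. h p $ a)) \<Longrightarrow> continuous_on Z (h :: real^3 \<Rightarrow> real^3)"
  using continuous_on_vec_lambda[of Z "\<lambda>a p. h p $ a"] by simp

lemma weak_solution_u: "weak_solution A V u"
proof (rule weak_solutionI[where g = g and D = D])
  show "continuous_on UNIV u" by (rule continuous_u)
  show "torus_periodic u" unfolding u_def by (intro lsum_periodic periodic_terms)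
  show "continuous_on UNIV g"
    by (rule continuous_vec3) (simp add: g_def continuous_lsum locfin continuous_terms)
  have "torus_periodic (lsum (dU a))" for a by (intro lsum_periodic periodic_terms)
  then show "torus_periodic g" by (simp add: torus_periodic_def g_def)
  have "torus_periodic (lsum B)" by (intro lsum_periodic periodic_terms)
  then show "torus_periodic A" by (simp add: torus_periodic_def A_def)
  show "continuous_on UNIV (\<lambda>p. A p *v g p)"
    by (rule continuous_vec3) (simp only: flux_eq, intro continuous_intros continuous_lsum locfin continuous_terms)
  show "continuous_on UNIV (D a)" for a
    unfolding D_def[abs_def] by (intro continuous_intros continuous_lsum locfin continuous_terms)
  show "((\<lambda>s. u (p + s *\<^sub>R axis a 1)) has_real_derivative g p $ a) (at 0)" for a p
    using DERIV_lsum[OF locfin(1) locfin(2) DERIV_U] by (simp add: u_def g_def)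
  show "((\<lambda>s. (A (p + s *\<^sub>R axis a 1) *v g (p + s *\<^sub>R axis a 1)) $ a) has_real_derivative D a p) (at 0)" for a p
    unfolding flux_eq D_def
    by (intro DERIV_add DERIV_lsum[OF locfin(2) locfin(3) DERIV_dU] DERIV_lsum[OF locfin(4) locfin(5) DERIV_Fl])
  show "(\<Sum>a\<in>UNIV. D a p) = V p * u p" for p by (rule divergence)
qed

lemma nontrivial: "nontrivial_solution A V u"
  unfolding nontrivial_solution_def
proof (intro conjI weak_solution_u continuous_u exI)
  have y: "Y 0 < X 0" using X0 by (simp add: Y_def zeta_def)
  have "u 0 = f 0 (Y 0)"
    using lsum_eq[OF locfin(1) y] by (simp add: u_def U_def C_def)
  also have "\<dots> = amp 0 (Y 0)" using before[of "Y 0" 0] y by (simp add: f_def)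
  finally show "u 0 \<noteq> 0" by (simp add: amp_def)
qed

lemma potential_V: "potential V"
  unfolding potential_def
proof (intro conjI periodic_terms)
  have "continuous_on UNIV V"
    unfolding V_def[abs_def] by (intro continuous_intros)
  then have "V \<in> borel_measurable lborel"
    unfolding measurable_lborel2 by (rule borel_measurable_continuous_onI)
  then show "V \<in> borel_measurable lebesgue" by (rule measurable_completion)
  have "\<bar>V p\<bar> \<le> (k 0)\<^sup>2 + k 0 * (3 / 2)" for p
  proof -
    have "(zeta1 (p $ 3))\<^sup>2 \<le> 1" using abs_zeta1_le[of "p $ 3"] by (simp add: abs_square_le_1)
    then have "\<bar>(k 0)\<^sup>2 * ((zeta1 (p $ 3))\<^sup>2 - 1)\<bar> \<le> (k 0)\<^sup>2 * 1"
      unfolding abs_mult by (intro mult_mono) auto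
    moreover have "\<bar>k 0 * zeta2 (p $ 3)\<bar> \<le> k 0 * (3 / 2)"
      using abs_zeta2_le[of "p $ 3"] k_pos[of 0] by (simp add: abs_mult)
    ultimately show ?thesis unfolding V_def by linarith
  qed
  then show "bounded (range V)" by (auto simp: bounded_iff)
  show "compact_support V"
    unfolding compact_support_def
    by (intro exI[of _ 1]) (simp add: V_def zeta12_outside)
qed

section \<open>Pointwise size of the solution\<close>

lemma u_bound:
  assumes "Y p \<le> X (Suc j)" "X j \<le> Y p \<or> j = 0"
  shows "\<bar>u p\<bar> \<le> 2 * exp (lam j - k j * Y p)"
proof -
  let ?y = "Y p"
  \<comment> \<open>One index beyond the surviving modes, because the finite form of
    \<open>lsum\<close> needs a strict inequality. The alternative \<open>j = 0\<close> in the
    hypothesis takes care of points below \<open>X 0\<close>.\<close>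
  have y: "?y < X (Suc (Suc j))" using assms(1) gap[of "Suc j"] by simp
  have "\<bar>u p\<bar> \<le> (\<Sum>i\<le>Suc (Suc j). f i ?y)"
    unfolding u_def lsum_eq[OF locfin(1) y]
    by (rule order_trans[OF sum_abs sum_mono])
      (use mult_left_mono[OF abs_cos_le_one f_nonneg] in \<open>simp add: U_def C_def abs_mult f_nonneg\<close>)
  also have "\<dots> = (\<Sum>i\<in>{j, Suc j}. f i ?y)"
  proof (rule sum.mono_neutral_right)
    show "\<forall>i\<in>{..Suc (Suc j)} - {j, Suc j}. f i ?y = 0"
    proof
      fix i assume i: "i \<in> {..Suc (Suc j)} - {j, Suc j}"
      show "f i ?y = 0"
      proof (cases "i < j")
        case True
        then show ?thesis using assms(2) X_mono_le[of "Suc i" j] by (intro f_zero_after) auto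
      next
        case False
        then have "i = Suc (Suc j)" using i by auto
        then show ?thesis using assms(1) by (simp add: f_zero_before)
      qed
    qed
  qed auto
  also have "\<dots> = f j ?y + f (Suc j) ?y" by simp
  also have "f (Suc j) ?y \<le> exp (lam j - k j * ?y)"
  proof (cases "X j \<le> ?y")
    case True
    then have "k j * X j \<le> k j * ?y" using k_pos[of j] by simp
    \<comment> \<open>By the recursion for \<open>lam\<close>, the new mode obeys the bound of the
      old one as soon as it is present.\<close>
    then have "lam (Suc j) - k (Suc j) * ?y \<le> lam j - k j * ?y" by (simp add: k_Suc mult.commute)
    then show ?thesis using f_le[of "Suc j" ?y] by (meson exp_le_cancel_iff order_trans)
  next
    case False
    then show ?thesis by (simp add: f_zero_before)
  qed
  also have "f j ?y \<le> exp (lam j - k j * ?y)" by (rule f_le)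
  finally show ?thesis by simp
qed

lemma Y_nonneg: "0 \<le> Y p"
  using abs_le_zeta[of "p $ 3"] by (simp add: Y_def)

lemma u_decay:
  assumes "X (Suc j) \<le> Y p" "Y p \<le> X (Suc (Suc j))"
  shows "\<bar>u p\<bar> \<le> 2 * exp (- (k (Suc j) * len j))"
proof -
  have "k (Suc j) * X (Suc j) \<le> k (Suc j) * Y p" using assms k_pos[of "Suc j"] by simp
  then have "lam (Suc j) - k (Suc j) * Y p \<le> - (k (Suc j) * len j)"
    using lam_le[of j] unfolding len_def right_diff_distrib by linarith
  then show ?thesis using u_bound[of p "Suc j"] assms by (meson disjI1 exp_le_cancel_iff mult_left_mono order_trans zero_le_numeral)
qed

lemma slab_cases:
  obtains "Y p \<le> X 1" | j where "X (Suc j) \<le> Y p" "Y p \<le> X (Suc (Suc j))"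
proof (cases "Y p \<le> X 1")
  case False
  define n where "n = (LEAST n. Y p \<le> X n)"
  obtain m where "Y p < X m" using X_unbounded by blast
  then have n: "Y p \<le> X n" unfolding n_def by (metis LeastI less_imp_le)
  have least: "X m < Y p" if "m < n" for m using not_less_Least[of m] that unfolding n_def by fastforce
  have "n \<noteq> 0" "n \<noteq> 1" using False n X_mono_le[of 0 1] by (auto intro: ccontr)
  then obtain j where "n = Suc (Suc j)" by (metis One_nat_def not0_implies_Suc)
  then show thesis using that(2)[of j] n least[of "Suc j"] by simp
qed (rule that(1))

lemma u_le_2: "\<bar>u p\<bar> \<le> 2"
proof (cases p rule: slab_cases)
  case 1
  have "\<bar>u p\<bar> \<le> 2 * exp (lam 0 - k 0 * Y p)" using 1 by (intro u_bound) auto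
  moreover have "exp (lam 0 - k 0 * Y p) \<le> 1" using k_pos[of 0] Y_nonneg[of p] by simp
  ultimately show ?thesis by linarith
next
  case (2 j)
  have "exp (- (k (Suc j) * len j)) \<le> 1" using k_pos[of "Suc j"] len_pos[of j] by simp
  then show ?thesis using u_decay[OF 2] by linarith
qed

end

section \<open>The coefficient matrix\<close>

text \<open>Bookkeeping at one point: \<open>m\<close> bounds the value and \<open>d\<close> the
  operator norm of the derivative, so that products combine by the Leibniz rule.\<close>

definition bnd :: "(real^3 \<Rightarrow> real) \<Rightarrow> real^3 \<Rightarrow> real \<Rightarrow> real \<Rightarrow> bool" where
  "bnd F p m d \<longleftrightarrow> \<bar>F p\<bar> \<le> m \<and> (\<exists>F'. (F has_derivative F') (at p) \<and> (\<forall>v. \<bar>F' v\<bar> \<le> d * norm v))"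

lemma bnd_nonneg:
  assumes "bnd F p m d"
  shows "0 \<le> m" "0 \<le> d"
proof -
  show "0 \<le> m" using assms by (auto simp: bnd_def)
  obtain F' :: "real^3 \<Rightarrow> real" where "\<And>v. \<bar>F' v\<bar> \<le> d * norm v"
    using assms by (auto simp: bnd_def)
  from this[of "axis 1 1"] show "0 \<le> d" by simp
qed

lemma bnd_mult:
  assumes "bnd F p m d" "bnd G p m' d'"
  shows "bnd (\<lambda>p. F p * G p) p (m * m') (m * d' + d * m')"
proof -
  note nn = bnd_nonneg[OF assms(1)] bnd_nonneg[OF assms(2)]
  obtain F' G' where F: "(F has_derivative F') (at p)" "\<And>v. \<bar>F' v\<bar> \<le> d * norm v" "\<bar>F p\<bar> \<le> m"
    and G: "(G has_derivative G') (at p)" "\<And>v. \<bar>G' v\<bar> \<le> d' * norm v" "\<bar>G p\<bar> \<le> m'"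
    using assms by (auto simp: bnd_def)
  have "\<bar>F p * G' v + F' v * G p\<bar> \<le> (m * d' + d * m') * norm v" for v
  proof -
    have "\<bar>F p * G' v\<bar> \<le> m * (d' * norm v)" "\<bar>F' v * G p\<bar> \<le> (d * norm v) * m'"
      unfolding abs_mult using F G nn by (auto intro!: mult_mono)
    then show ?thesis by (simp add: algebra_simps)
  qed
  moreover have "\<bar>F p * G p\<bar> \<le> m * m'"
    unfolding abs_mult using F G nn by (auto intro!: mult_mono)
  ultimately show ?thesis
    unfolding bnd_def using has_derivative_mult[OF F(1) G(1)] by blast
qed

lemma bnd_add:
  assumes "bnd F p m d" "bnd G p m' d'"
  shows "bnd (\<lambda>p. F p + G p) p (m + m') (d + d')"
proof -
  obtain F' G' where F: "(F has_derivative F') (at p)" "\<And>v. \<bar>F' v\<bar> \<le> d * norm v" "\<bar>F p\<bar> \<le> m"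
    and G: "(G has_derivative G') (at p)" "\<And>v. \<bar>G' v\<bar> \<le> d' * norm v" "\<bar>G p\<bar> \<le> m'"
    using assms by (auto simp: bnd_def)
  have "\<bar>F' v + G' v\<bar> \<le> (d + d') * norm v" for v
    using F(2)[of v] G(2)[of v] by (simp add: algebra_simps)
  moreover have "\<bar>F p + G p\<bar> \<le> m + m'" using F(3) G(3) by simp
  ultimately show ?thesis
    unfolding bnd_def using has_derivative_add[OF F(1) G(1)] by blast
qed

lemma bnd_cmult:
  assumes "bnd F p m d"
  shows "bnd (\<lambda>p. c * F p) p (\<bar>c\<bar> * m) (\<bar>c\<bar> * d)"
proof -
  have "bnd (\<lambda>_. c) p \<bar>c\<bar> 0"
    unfolding bnd_def by (auto intro!: exI[of _ "\<lambda>_. 0"])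
  from bnd_mult[OF this assms] show ?thesis by simp
qed

lemma bnd_mono: "bnd F p m d \<Longrightarrow> m \<le> m' \<Longrightarrow> d \<le> d' \<Longrightarrow> bnd F p m' d'"
  unfolding bnd_def by (meson mult_right_mono norm_ge_zero order_trans)

locale modes_bounded = modes +
  fixes C0 :: real
  assumes C0: "1 \<le> C0" and K_large: "20 * C0 \<le> real K"
    and profile: "\<And>\<kappa> t. 1 \<le> \<kappa> \<Longrightarrow> \<bar>pa \<kappa> t\<bar> \<le> C0 \<and> - C0 / \<kappa> \<le> pa \<kappa> t \<and> \<bar>pa' \<kappa> t\<bar> \<le> C0 \<and>
    \<bar>pb \<kappa> t\<bar> \<le> C0 / \<kappa> \<and> \<bar>pb' \<kappa> t\<bar> \<le> C0 \<and> \<bar>qb \<kappa> t\<bar> \<le> C0 / \<kappa> \<and> \<bar>qb' \<kappa> t\<bar> \<le> C0 \<and>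
    \<bar>pg \<kappa> t\<bar> \<le> C0 / \<kappa> \<and> \<bar>pg' \<kappa> t\<bar> \<le> C0 \<and> \<bar>qg \<kappa> t\<bar> \<le> C0 / \<kappa> \<and> \<bar>qg' \<kappa> t\<bar> \<le> C0"
begin

text \<open>The admissible size of the derivative of the matrix. Every profile but \<open>Pa\<close>
  has amplitude \<open>Q i p / k i\<close>, so a trigonometric factor, whose derivative costs a
  frequency, again contributes only a multiple of \<open>Q\<close>.\<close>

definition Q :: "nat \<Rightarrow> real^3 \<Rightarrow> real" where
  "Q i p = (if X i < Y p \<and> Y p < X (Suc i) then C0 / len i else 0)"

lemma Q_nonneg: "0 \<le> Q i p"
  using C0 len_pos[of i] by (simp add: Q_def)

lemma bnd_profile:
  assumes d: "\<And>t. (h has_real_derivative h' t) (at t)"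
    and b: "\<And>t. \<bar>h t\<bar> \<le> m" "\<And>t. \<bar>h' t\<bar> \<le> C0"
    and z: "\<And>t. t \<le> 0 \<or> 1 \<le> t \<Longrightarrow> h t = 0 \<and> h' t = 0"
  shows "bnd (\<lambda>p. h (T i (Y p))) p (if X i < Y p \<and> Y p < X (Suc i) then m else 0) (Q i p)"
proof -
  let ?in = "X i < Y p \<and> Y p < X (Suc i)"
  have out: "h (T i (Y p)) = 0 \<and> h' (T i (Y p)) = 0" if "\<not> ?in"
    using z[of "T i (Y p)"] T_simps(1,2)[of i "Y p"] that by auto
  have hd: "((\<lambda>p. h (T i (Y p))) has_derivative (\<lambda>v. v $ 3 * (h' (T i (Y p)) * (1 / len i) * zeta1 (p $ 3)))) (at p)"
  proof -
    have 1: "((\<lambda>x. h (T i (zeta x))) has_real_derivative h' (T i (Y p)) * (1 / len i) * zeta1 (p $ 3)) (at (p $ 3))"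
      unfolding Y_def
      by (rule DERIV_chain2[OF DERIV_chain2[OF d DERIV_T] DERIV_zeta])
    have "((\<lambda>p. p $ 3) has_derivative (\<lambda>v. v $ 3)) (at p)"
      by (rule bounded_linear_imp_has_derivative[OF bounded_linear_vec_nth])
    from DERIV_compose_FDERIV[OF 1 this] show ?thesis by (simp add: Y_def)
  qed
  have "\<bar>v $ 3 * (h' (T i (Y p)) * (1 / len i) * zeta1 (p $ 3))\<bar> \<le> Q i p * norm v" for v :: "real^3"
  proof (cases ?in)
    case True
    have "\<bar>v $ 3 * (h' (T i (Y p)) * (1 / len i) * zeta1 (p $ 3))\<bar>
        = \<bar>v $ 3\<bar> * (\<bar>h' (T i (Y p))\<bar> * (1 / len i) * \<bar>zeta1 (p $ 3)\<bar>)"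
      using len_pos[of i] by (simp add: abs_mult)
    also have "\<dots> \<le> norm v * (C0 * (1 / len i) * 1)"
      using b(2) len_pos[of i] C0 component_le_norm_cart[of v 3] abs_zeta1_le[of "p $ 3"]
      by (intro mult_mono) auto
    finally show ?thesis using True by (simp add: Q_def mult.commute)
  qed (simp add: out Q_nonneg)
  moreover have "\<bar>h (T i (Y p))\<bar> \<le> (if ?in then m else 0)"
    using b(1) out by auto
  ultimately show ?thesis
    unfolding bnd_def using hd by blast
qed

lemma bnd_trig:
  "bnd (C i) p 1 (k i)" "bnd (S i) p 1 (k i)"
proof -
  have nth: "((\<lambda>p. p $ r i) has_derivative (\<lambda>v. v $ r i)) (at p)"
    by (rule bounded_linear_imp_has_derivative[OF bounded_linear_vec_nth])
  have d: "((\<lambda>x. cos (k i * x)) has_real_derivative - sin (k i * p $ r i) * k i) (at (p $ r i))"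
    "((\<lambda>x. sin (k i * x)) has_real_derivative cos (k i * p $ r i) * k i) (at (p $ r i))"
    by (auto intro!: derivative_eq_intros)
  have D: "((\<lambda>p. cos (k i * p $ r i)) has_derivative (\<lambda>v. v $ r i * (- sin (k i * p $ r i) * k i))) (at p)"
    "((\<lambda>p. sin (k i * p $ r i)) has_derivative (\<lambda>v. v $ r i * (cos (k i * p $ r i) * k i))) (at p)"
    by (rule DERIV_compose_FDERIV[of "\<lambda>x. cos (k i * x)", OF d(1) nth],
        rule DERIV_compose_FDERIV[of "\<lambda>x. sin (k i * x)", OF d(2) nth])
  have le: "\<bar>v $ r i * (x * k i)\<bar> \<le> k i * norm v" if "\<bar>x\<bar> \<le> 1" for v :: "real^3" and x
  proof -
    have "\<bar>v $ r i\<bar> * (\<bar>x\<bar> * k i) \<le> norm v * (1 * k i)"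
      using that k_pos[of i] component_le_norm_cart[of v "r i"] by (intro mult_mono) auto
    then show ?thesis using k_pos[of i] by (simp add: abs_mult mult.commute)
  qed
  show "bnd (C i) p 1 (k i)"
    unfolding bnd_def C_def[abs_def] using D(1) le[of "- sin (k i * p $ r i)"] by auto
  show "bnd (S i) p 1 (k i)"
    unfolding bnd_def S_def[abs_def] using D(2) le[of "cos (k i * p $ r i)"] by auto
qed

lemma profile_div: "(if X i < Y p \<and> Y p < X (Suc i) then C0 / kap i else 0) = Q i p / k i"
  using k_pos[of i] len_pos[of i] by (simp add: Q_def kap_def field_simps)

lemma bnd_profiles:
  "bnd (Pa i) p C0 (Q i p)" "bnd (Pb i) p (Q i p / k i) (Q i p)" "bnd (Pg i) p (Q i p / k i) (Q i p)"
  "bnd (Qb i) p (Q i p / k i) (Q i p)" "bnd (Qg i) p (Q i p / k i) (Q i p)"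
proof -
  note pr = profile[OF kap_ge_1[of i]]
  have "bnd (Pa i) p (if X i < Y p \<and> Y p < X (Suc i) then C0 else 0) (Q i p)"
    unfolding Pa_def[abs_def]
    by (rule bnd_profile[OF DERIV_pa]) (use pr profiles_outside in auto)
  then show "bnd (Pa i) p C0 (Q i p)"
    by (rule bnd_mono) (use C0 in auto)
  show "bnd (Pb i) p (Q i p / k i) (Q i p)"
    unfolding Pb_def[abs_def] profile_div[symmetric]
    by (rule bnd_profile[OF DERIV_pb]) (use pr profiles_outside in auto)
  show "bnd (Pg i) p (Q i p / k i) (Q i p)"
    unfolding Pg_def[abs_def] profile_div[symmetric]
    by (rule bnd_profile[OF DERIV_pg]) (use pr profiles_outside in auto)
  show "bnd (Qb i) p (Q i p / k i) (Q i p)"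
    unfolding Qb_def[abs_def] profile_div[symmetric]
    by (rule bnd_profile[OF DERIV_qb]) (use pr profiles_outside in auto)
  show "bnd (Qg i) p (Q i p / k i) (Q i p)"
    unfolding Qg_def[abs_def] profile_div[symmetric]
    by (rule bnd_profile[OF DERIV_qg]) (use pr profiles_outside in auto)
qed

lemma Q_div_k: "Q i p / k i \<le> 1 / 20"
proof -
  have "C0 / kap i \<le> 1 / 20"
    using kap_ge[of i] K_large kap_pos[of i] by (simp add: field_simps)
  then show ?thesis unfolding profile_div[symmetric] by simp
qed

text \<open>The 4 is 1 from the profile, 1 from frequency \<open>k i\<close> and 2 from
  \<open>k (Suc i)\<close>.\<close>

lemma bnd_trig_product:
  assumes "bnd F p 1 (k i)" "bnd G p 1 (k (Suc i))" "bnd H p (Q i p / k i) (Q i p)"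
  shows "bnd (\<lambda>p. H p * F p * G p) p (1 / 20) (4 * Q i p)"
  by (rule bnd_mono[OF bnd_mult[OF bnd_mult[OF assms(3,1)] assms(2)]])
    (use Q_div_k[of i p] k_pos[of i] in \<open>simp_all add: k_Suc\<close>)

text \<open>\<open>Pa\<close> is not small, but as \<open>rate\<close> is at least 1 its negative
  part is of order 1 / \<kappa>, and only that endangers ellipticity. The lower bound is -(1 + 1 +
  2) / 20, from the three terms of \<open>M1\<close>.\<close>

lemma bnd_M:
  "bnd (M1 i) p (2 * C0) (15 * Q i p)" "bnd (M2 i) p (1 / 10) (8 * Q i p)" "bnd (M3 i) p (1 / 10) (4 * Q i p)"
  and M1_lower: "- 1 / 5 \<le> M1 i p"
proof -
  note t = bnd_trig[of i p] bnd_trig[of "Suc i" p] and pr = bnd_profiles[of i p]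
  have b: "bnd (\<lambda>p. Pg i p * C i p * C (Suc i) p) p (1 / 20) (4 * Q i p)"
    by (intro bnd_trig_product t pr)
  have SS: "bnd (\<lambda>p. Qg i p * S (Suc i) p * S (Suc i) p) p (1 / 20) (5 * Q i p)"
    by (rule bnd_mono[OF bnd_mult[OF bnd_mult[OF pr(5) t(4)] t(4)]])
      (use Q_div_k[of i p] k_pos[of i] in \<open>simp_all add: k_Suc\<close>)
  have ss: "bnd (\<lambda>p. Qb i p * S i p * S i p) p (1 / 20) (3 * Q i p)"
    by (rule bnd_mono[OF bnd_mult[OF bnd_mult[OF pr(4) t(2)] t(2)]])
      (use Q_div_k[of i p] k_pos[of i] in \<open>simp_all add: k_Suc\<close>)
  have M1: "M1 i = (\<lambda>p. Pa i p + Pg i p * C i p * C (Suc i) p + - 2 * (Qg i p * S (Suc i) p * S (Suc i) p))"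
    by (simp add: M1_def fun_eq_iff power2_eq_square)
  show "bnd (M1 i) p (2 * C0) (15 * Q i p)"
    unfolding M1
    by (rule bnd_mono[OF bnd_add[OF bnd_add[OF pr(1) b] bnd_cmult[OF SS]]])
      (use C0 Q_nonneg[of i p] in auto)
  have "- C0 / kap i \<le> Pa i p" using profile[OF kap_ge_1[of i]] by (simp add: Pa_def)
  moreover have "C0 / kap i \<le> 1 / 20"
    using kap_ge[of i] K_large kap_pos[of i] by (simp add: field_simps)
  ultimately show "- 1 / 5 \<le> M1 i p"
    using b SS unfolding M1 bnd_def by auto
  have M2: "M2 i = (\<lambda>p. Pb i p * S i p * S (Suc i) p + Pg i p * S i p * S (Suc i) p)"
    by (simp add: M2_def fun_eq_iff algebra_simps)
  show "bnd (M2 i) p (1 / 10) (8 * Q i p)"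
    unfolding M2
    by (rule bnd_mono[OF bnd_add[OF bnd_trig_product[OF t(2,4) pr(2)] bnd_trig_product[OF t(2,4) pr(3)]]]) auto
  have M3: "M3 i = (\<lambda>p. 1 / 4 * (Pb i p * C i p * C (Suc i) p) + - 1 / 2 * (Qb i p * S i p * S i p))"
    by (simp add: M3_def fun_eq_iff power2_eq_square)
  show "bnd (M3 i) p (1 / 10) (4 * Q i p)"
    unfolding M3
    by (rule bnd_mono[OF bnd_add[OF bnd_cmult[OF bnd_trig_product[OF t(1,3) pr(2)]] bnd_cmult[OF ss]]])
      (use Q_nonneg[of i p] in auto)
qed

lemma norm_E: "norm (E a b) = 1"
proof -
  have "E a b = axis a (axis b 1)" by (auto simp: E_def axis_def vec_eq_iff)
  then show ?thesis by simp
qed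

lemma norm_combination:
  "norm (x *\<^sub>R E a b + y *\<^sub>R (E c d + E e h) + z *\<^sub>R E m n) \<le> \<bar>x\<bar> + 2 * \<bar>y\<bar> + \<bar>z\<bar>"
proof -
  have "norm (x *\<^sub>R E a b) \<le> \<bar>x\<bar>" "norm (z *\<^sub>R E m n) \<le> \<bar>z\<bar>" by (simp_all add: norm_E)
  moreover have "norm (y *\<^sub>R (E c d + E e h)) \<le> \<bar>y\<bar> * 2"
    using norm_triangle_ineq[of "E c d" "E e h"] by (simp add: norm_E mult_left_mono)
  ultimately show ?thesis
    using norm_triangle_ineq[of "x *\<^sub>R E a b + y *\<^sub>R (E c d + E e h)" "z *\<^sub>R E m n"]
      norm_triangle_ineq[of "x *\<^sub>R E a b" "y *\<^sub>R (E c d + E e h)"] by linarith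
qed

lemma B_derivative: "\<exists>B'. (B i has_derivative B') (at p) \<and> (\<forall>v. norm (B' v) \<le> 35 * Q i p * norm v)"
proof -
  obtain D1 D2 D3 where
    1: "(M1 i has_derivative D1) (at p)" "\<And>v. \<bar>D1 v\<bar> \<le> 15 * Q i p * norm v" and
    2: "(M2 i has_derivative D2) (at p)" "\<And>v. \<bar>D2 v\<bar> \<le> 8 * Q i p * norm v" and
    3: "(M3 i has_derivative D3) (at p)" "\<And>v. \<bar>D3 v\<bar> \<le> 4 * Q i p * norm v"
    using bnd_M[of i p] by (auto simp: bnd_def)
  let ?B' = "\<lambda>v. D1 v *\<^sub>R E (r i) (r i) + D2 v *\<^sub>R (E (r i) (r (Suc i)) + E (r (Suc i)) (r i))
     + D3 v *\<^sub>R E (r (Suc i)) (r (Suc i))"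
  have "(B i has_derivative ?B') (at p)"
    unfolding B_def[abs_def]
    by (intro has_derivative_add has_derivative_scaleR_left 1 2 3)
  \<comment> \<open>35 = 15 + 2 * 8 + 4, the off-diagonal entry counting twice.\<close>
  moreover have "norm (?B' v) \<le> 35 * Q i p * norm v" for v
    by (rule order_trans[OF norm_combination]) (use 1(2)[of v] 2(2)[of v] 3(2)[of v] in linarith)
  ultimately show ?thesis by blast
qed

lemma active_slab: "\<exists>i. \<forall>j. j \<noteq> i \<longrightarrow> Y p \<le> X j \<or> X (Suc j) \<le> Y p"
proof -
  define i where "i = (LEAST n. Y p \<le> X (Suc n))"
  obtain m where "Y p < X m" using X_unbounded by blast
  then have "Y p \<le> X (Suc m)" using X_mono_le[of m "Suc m"] by simp
  then have i: "Y p \<le> X (Suc i)" unfolding i_def by (rule LeastI)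
  have "Y p \<le> X j \<or> X (Suc j) \<le> Y p" if "j \<noteq> i" for j
  proof (cases "j < i")
    case True
    then show ?thesis using not_less_Least[of j] unfolding i_def by fastforce
  next
    case False
    then show ?thesis using i X_mono_le[of "Suc i" j] that by auto
  qed
  then show ?thesis by blast
qed

lemma A_derivative:
  "\<exists>A' d. (A has_derivative A') (at p) \<and> (\<forall>v. norm (A' v) \<le> d * norm v) \<and>
    (d = 0 \<or> (\<exists>i. X i < Y p \<and> Y p < X (Suc i) \<and> d = 35 * C0 / len i))"
proof -
  obtain i where i: "\<And>j. j \<noteq> i \<Longrightarrow> Y p \<le> X j \<or> X (Suc j) \<le> Y p" using active_slab[of p] by blast
  obtain n where n: "Y p < X n" using X_unbounded by blast
  obtain B' where B': "\<And>j. (B j has_derivative B' j) (at p)" "\<And>j v. norm (B' j v) \<le> 35 * Q j p * norm v"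
    using B_derivative[of _ p] by metis
  have "(A has_derivative (\<lambda>v. 0 + (\<Sum>j\<le>n. B' j v))) (at p)"
    unfolding A_def[abs_def]
    by (intro has_derivative_add has_derivative_const has_derivative_lsum locfin B' n)
  moreover have "norm (0 + (\<Sum>j\<le>n. B' j v)) \<le> 35 * Q i p * norm v" for v
  proof -
    have "B' j v = 0" if "j \<noteq> i" for j
      using B'(2)[of j v] i[OF that] by (auto simp: Q_def)
    then have "(\<Sum>j\<le>n. B' j v) = (\<Sum>j\<in>{..n} \<inter> {i}. B' j v)"
      by (intro sum.mono_neutral_right) auto
    also have "norm \<dots> \<le> 35 * Q i p * norm v"
      using B'(2)[of i v] Q_nonneg[of i p] by (cases "i \<le> n") auto
    finally show ?thesis by simp
  qed
  moreover have "35 * Q i p = 0 \<or> (\<exists>i. X i < Y p \<and> Y p < X (Suc i) \<and> 35 * Q i p = 35 * C0 / len i)"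
    by (auto simp: Q_def)
  moreover have "35 * Q i p = 35 * C0 / len i" if "Q i p \<noteq> 0"
    using that by (simp add: Q_def split: if_splits)
  ultimately show ?thesis
    by (intro exI[of _ "\<lambda>v. 0 + (\<Sum>j\<le>n. B' j v)"] exI[of _ "35 * Q i p"]) (auto simp: Q_def)
qed

lemma grad_bounded:
  assumes b: "\<And>p. 0 \<le> b p" "\<And>p i. X i < Y p \<Longrightarrow> Y p < X (Suc i) \<Longrightarrow> 70 * C0 / len i \<le> b p"
  shows "grad_bounded_by A b"
proof -
  obtain A' d where A': "\<And>p. (A has_derivative A' p) (at p)" "\<And>p v. norm (A' p v) \<le> d p * norm v"
    "\<And>p. d p = 0 \<or> (\<exists>i. X i < Y p \<and> Y p < X (Suc i) \<and> d p = 35 * C0 / len i)"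
    using A_derivative by metis
  have d: "0 \<le> d p" "d p \<le> 35 * C0" "2 * d p \<le> b p" for p
  proof -
    have "0 \<le> d p \<and> d p \<le> 35 * C0 \<and> 2 * d p \<le> b p"
    proof (cases "d p = 0")
      case False
      then obtain i where i: "X i < Y p" "Y p < X (Suc i)" "d p = 35 * C0 / len i" using A'(3) by blast
      have "35 * C0 / len i \<le> 35 * C0 / 1" using len_ge_1[of i] C0 by (intro divide_left_mono) auto
      then show ?thesis using b(2)[OF i(1,2)] i(3) C0 len_pos[of i] by simp
    qed (use b C0 in simp)
    then show "0 \<le> d p" "d p \<le> 35 * C0" "2 * d p \<le> b p" by auto
  qed
  have lip: "(35 * C0)-lipschitz_on (cball 0 R) A" for R
  proof (rule lipschitz_onI)
    fix x y :: "real^3" assume xy: "x \<in> cball 0 R" "y \<in> cball 0 R"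
    have "norm (A x - A y) \<le> 35 * C0 * norm (x - y)"
    proof (rule differentiable_bound[where f = A and f' = A', OF convex_cball _ _ xy])
      show "(A has_derivative A' z) (at z within cball 0 R)" for z
        using A'(1) by (rule has_derivative_at_withinI)
      show "onorm (A' z) \<le> 35 * C0" for z
      proof (rule onorm_le)
        show "norm (A' z v) \<le> 35 * C0 * norm v" for v
          using A'(2)[of z v] mult_right_mono[OF d(2)[of z] norm_ge_zero[of v]] by linarith
      qed
    qed
    then show "dist (A x) (A y) \<le> 35 * C0 * dist x y" by (simp add: dist_norm)
  qed (use C0 in simp)
  have "matrix_grad_norm A p \<le> b p" for p
  proof -
    have "partial_deriv a A p = A' p (axis a 1)" for a
      using frechet_derivative_at[OF A'(1)[of p]] by (simp add: partial_deriv_def)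
    then have "norm (partial_deriv a A p) \<le> d p" for a
      using A'(2)[of p "axis a 1"] by simp
    then have "(\<Sum>a\<in>UNIV. (norm (partial_deriv a A p))\<^sup>2) \<le> (\<Sum>a\<in>(UNIV :: 3 set). (d p)\<^sup>2)"
      by (intro sum_mono power_mono) auto
    \<comment> \<open>Three directions contribute 3 d^2, at most (2 d)^2; hence 70 = 2 * 35 in the
      hypothesis.\<close>
    also have "\<dots> \<le> (2 * d p)\<^sup>2" by (simp add: power_mult_distrib)
    finally have "matrix_grad_norm A p \<le> 2 * d p"
      unfolding matrix_grad_norm_def using d(1)[of p] by (intro real_le_lsqrt) (auto intro: sum_nonneg)
    then show ?thesis using d(3)[of p] by linarith
  qed
  moreover have "A differentiable (at p)" for p
    using A'(1) by (auto simp: differentiable_def)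
  ultimately show ?thesis
    unfolding grad_bounded_by_def using lip by auto
qed

section \<open>Symmetry, block form and ellipticity\<close>

lemma B_transpose: "transpose (B i p) = B i p"
proof -
  have swap: "E a b $ m $ n = E b a $ n $ m" for a b m n
    by (simp add: E_def conj_commute)
  have "B i p $ n $ m = B i p $ m $ n" for m n
    unfolding B_def vector_add_component vector_scaleR_component
      swap[of "r i" "r i" n m] swap[of "r (Suc i)" "r (Suc i)" n m]
      swap[of "r i" "r (Suc i)" n m] swap[of "r (Suc i)" "r i" n m]
    by (simp only: add.commute)
  then show ?thesis by (simp add: transpose_def vec_eq_iff)
qed

lemma B_entries: "B i p $ 3 $ a = 0" "B i p $ a $ 3 = 0"
proof -
  have "E (r a) (r b) $ 3 $ c = 0" "E (r a) (r b) $ c $ 3 = 0" for a b c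
    by (simp_all add: E_def)
  then show "B i p $ 3 $ a = 0" "B i p $ a $ 3 = 0"
    unfolding B_def vector_add_component vector_scaleR_component by simp_all
qed

lemma lsum_B_single:
  obtains i where "lsum B p = B i p"
proof -
  obtain i where i: "\<And>j. j \<noteq> i \<Longrightarrow> Y p \<le> X j \<or> X (Suc j) \<le> Y p" using active_slab[of p] by blast
  have "B j p = 0" if "j \<noteq> i" for j
    using profiles_zero[OF i[OF that]] by (simp add: B_def M1_def M2_def M3_def)
  then have "lsum B p = (\<Sum>j\<in>{i}. B j p)"
    unfolding lsum_def by (intro suminf_finite) auto
  then show thesis using that[of i] by simp
qed

text \<open>By 2 |x y| \<le> x^2 + y^2 the bounds on the entries lose at most 3/10 x^2 + 1/5 y^2, so
  at least half of the identity survives in \<open>A\<close>.\<close>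

lemma B_ellipticity: "- (1 / 2) * (norm v)\<^sup>2 \<le> (B i p *v v) \<bullet> v"
proof -
  define x y where "x = v $ r i" and "y = v $ r (Suc i)"
  have M: "- 1 / 5 \<le> M1 i p" "\<bar>M2 i p\<bar> \<le> 1 / 10" "\<bar>M3 i p\<bar> \<le> 1 / 10"
    using M1_lower[of i p] bnd_M[of i p] by (auto simp: bnd_def)
  have "(B i p *v v) \<bullet> v = (M1 i p * x + M2 i p * y) * x + (M2 i p * x + M3 i p * y) * y"
    unfolding inner_vec_def sum_3 B_mult x_def y_def
    by (cases "even i") (simp_all add: r_def)
  also have "\<dots> = M1 i p * x\<^sup>2 + 2 * (M2 i p * (x * y)) + M3 i p * y\<^sup>2"
    by (simp add: power2_eq_square algebra_simps)
  also have "\<dots> \<ge> - (1 / 2) * (x\<^sup>2 + y\<^sup>2)"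
  proof -
    have "- 1 / 5 * x\<^sup>2 \<le> M1 i p * x\<^sup>2" "- (1 / 10) * y\<^sup>2 \<le> M3 i p * y\<^sup>2"
      using M by (intro mult_right_mono; simp)+
    moreover have "- (1 / 10 * \<bar>x * y\<bar>) \<le> M2 i p * (x * y)"
    proof -
      have "\<bar>M2 i p * (x * y)\<bar> \<le> 1 / 10 * \<bar>x * y\<bar>"
        unfolding abs_mult[of "M2 i p"] using M(2) by (intro mult_right_mono) auto
      then show ?thesis by (rule abs_le_D2[THEN minus_le_iff[THEN iffD1]])
    qed
    moreover have "2 * \<bar>x * y\<bar> \<le> x\<^sup>2 + y\<^sup>2"
      using sum_squares_bound[of "\<bar>x\<bar>" "\<bar>y\<bar>"] by (simp add: abs_mult)
    moreover have "0 \<le> x\<^sup>2" "0 \<le> y\<^sup>2" by simp_all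
    moreover have "- (1 / 2) * (s + t) \<le> a + 2 * b + c"
      if "- 1 / 5 * s \<le> a" "- (1 / 10) * t \<le> c" "- (1 / 10 * m) \<le> b" "2 * m \<le> s + t" "0 \<le> s" "0 \<le> t"
      for a b c m s t :: real
      using that by argo
    ultimately show ?thesis by blast
  qed
  finally have "- (1 / 2) * (x\<^sup>2 + y\<^sup>2) \<le> (B i p *v v) \<bullet> v" .
  moreover have "x\<^sup>2 + y\<^sup>2 \<le> (norm v)\<^sup>2"
    unfolding power2_norm_eq_inner inner_vec_def sum_3 x_def y_def
    by (cases "even i") (simp_all add: r_def power2_eq_square)
  ultimately show ?thesis by argo
qed

lemma coefficient_A: "coefficient_matrix A"
  unfolding coefficient_matrix_def
proof (intro conjI allI)
  have "torus_periodic (lsum B)" by (intro lsum_periodic periodic_terms)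
  then show "torus_periodic A" by (simp add: torus_periodic_def A_def)
  have "norm (A p) \<le> norm (mat 1 :: real^3^3) + (2 * C0 + 1)" for p
  proof -
    obtain i where i: "lsum B p = B i p" by (rule lsum_B_single)
    have "norm (B i p) \<le> 2 * C0 + 1"
      unfolding B_def
      by (rule order_trans[OF norm_combination]) (use bnd_M[of i p, unfolded bnd_def] in linarith)
    then show ?thesis unfolding A_def i by (intro norm_triangle_le) simp
  qed
  then show "bounded (range A)" by (auto simp: bounded_iff)
  show "transpose (A p) = A p" for p
  proof -
    obtain i where i: "lsum B p = B i p" by (rule lsum_B_single)
    have "transpose (A p) = transpose (mat 1) + transpose (B i p)"
      unfolding A_def i transpose_def vec_eq_iff vector_add_component vec_lambda_beta by blast
    then show ?thesis by (simp add: transpose_mat B_transpose A_def i)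
  qed
  show "block_form (A p)" for p
  proof -
    obtain i where i: "lsum B p = B i p" by (rule lsum_B_single)
    show ?thesis unfolding block_form_def A_def i by (simp add: B_entries mat_def)
  qed
  have "(A p *v v) \<bullet> v \<ge> inverse 2 * (norm v)\<^sup>2" for p v
  proof -
    obtain i where i: "lsum B p = B i p" by (rule lsum_B_single)
    have "(A p *v v) \<bullet> v = (norm v)\<^sup>2 + (B i p *v v) \<bullet> v"
      by (simp add: A_def i matrix_vector_mult_add_rdistrib inner_add_left power2_norm_eq_inner)
    then show ?thesis using B_ellipticity[of v i p] by simp
  qed
  then show "uniformly_elliptic A"
    unfolding uniformly_elliptic_def by (intro exI[of _ 2]) auto
qed

end

section \<open>Decay\<close>

lemma double_exponential_decay:
  fixes \<epsilon> C0 :: real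
  assumes \<epsilon>: "0 < \<epsilon>" "\<epsilon> \<le> 1"
    and mb: "\<And>X. 1 \<le> X 0 \<Longrightarrow> (\<And>i. 1 \<le> X (Suc i) - X i) \<Longrightarrow> modes_bounded X K C0"
  shows "\<exists>A V u. coefficient_matrix A \<and>
    (\<exists>L>0. grad_bounded_by A (\<lambda>p. L / (1 + \<bar>p $ 3\<bar>) powr (1 - \<epsilon>))) \<and>
    potential V \<and> nontrivial_solution A V u \<and>
    (\<exists>c>0. \<exists>C>0. \<forall>p. \<bar>u p\<bar> \<le> c * exp (- exp (C * \<bar>p $ 3\<bar> powr \<epsilon>)))"
proof -
  define s where "s = 1 / \<epsilon>"
  define X where "X i = (real i + 1) powr s" for i :: nat
  have s: "1 \<le> s" "s * \<epsilon> = 1" "s * (1 - \<epsilon>) = s - 1" using \<epsilon> by (auto simp: s_def field_simps)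
  \<comment> \<open>An elementary substitute for the mean value theorem: only the power
    \<open>s - 1\<close> is enlarged, while the single factor i + 2 splits as (i + 1) + 1.\<close>
  have step: "(real i + 1) powr (s - 1) \<le> X (Suc i) - X i" for i
  proof -
    have "(real i + 2) * (real i + 1) powr (s - 1) \<le> (real i + 2) * (real i + 2) powr (s - 1)"
      using s by (intro mult_left_mono powr_mono2) auto
    also have "\<dots> = X (Suc i)"
      using powr_mult_base[of "real i + 2" "s - 1"] by (simp add: X_def add.commute)
    also have "(real i + 2) * (real i + 1) powr (s - 1) = X i + (real i + 1) powr (s - 1)"
      using powr_mult_base[of "real i + 1" "s - 1"] by (simp add: X_def algebra_simps)
    finally show ?thesis by simp
  qed
  have one: "1 \<le> (real i + 1) powr (s - 1)" for i
    using s by (intro ge_one_powr_ge_zero) auto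
  interpret modes_bounded X K C0
    by (rule mb) (use step one in \<open>auto simp: X_def intro: order_trans\<close>)
  have pow: "\<bar>p $ 3\<bar> powr \<epsilon> \<le> real i + 1" if "Y p \<le> X i" for p i
  proof -
    have "\<bar>p $ 3\<bar> powr \<epsilon> \<le> X i powr \<epsilon>"
      using that abs_le_zeta[of "p $ 3"] \<epsilon> by (intro powr_mono2) (auto simp: Y_def)
    then show ?thesis by (simp add: X_def powr_powr s)
  qed
  \<comment> \<open>The factor \<open>2 * 2 powr s\<close> passes from 1 + |x| to the start of the
    slab, through 1 + |x| \<le> 2 \<open>X (Suc i)\<close> and i + 2 \<le> 2 (i + 1).\<close>
  define L where "L = 70 * C0 * (2 * 2 powr s) powr (1 - \<epsilon>)"
  have L: "0 < L" using C0 by (simp add: L_def)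
  have "grad_bounded_by A (\<lambda>p. L / (1 + \<bar>p $ 3\<bar>) powr (1 - \<epsilon>))"
  proof (rule grad_bounded)
    fix p i assume y: "X i < Y p" "Y p < X (Suc i)"
    have "1 + \<bar>p $ 3\<bar> \<le> 1 + X (Suc i)"
      using y abs_le_zeta[of "p $ 3"] by (simp add: Y_def)
    also have "\<dots> \<le> 2 * X (Suc i)" using X_ge_1[of "Suc i"] by simp
    also have "\<dots> \<le> 2 * (2 * (real i + 1)) powr s"
      using s by (simp add: X_def powr_mono2)
    also have "\<dots> = 2 * 2 powr s * (real i + 1) powr s" by (subst powr_mult) simp_all
    finally have "(1 + \<bar>p $ 3\<bar>) powr (1 - \<epsilon>) \<le> (2 * 2 powr s * (real i + 1) powr s) powr (1 - \<epsilon>)"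
      using \<epsilon> by (intro powr_mono2) auto
    also have "\<dots> = (2 * 2 powr s) powr (1 - \<epsilon>) * (real i + 1) powr (s - 1)"
      by (simp add: powr_mult powr_powr s)
    also have "\<dots> \<le> (2 * 2 powr s) powr (1 - \<epsilon>) * len i"
      using step[of i] by (intro mult_left_mono) (auto simp: len_def)
    finally have "70 * C0 * (1 + \<bar>p $ 3\<bar>) powr (1 - \<epsilon>) \<le> L * len i"
      using C0 unfolding L_def by (simp add: mult.assoc mult_left_mono)
    then show "70 * C0 / len i \<le> L / (1 + \<bar>p $ 3\<bar>) powr (1 - \<epsilon>)"
      using len_pos[of i] by (simp add: field_simps)
  qed (use L in simp)
  \<comment> \<open>Halving the rate ln 2 makes z^2, not z, comparable to 2^(j + 3); the index shift
    3 is then harmless since z - 1 \<le> z^2 / 4. The factor \<open>exp 2\<close> covers the points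
    up to \<open>X 1\<close>, where z \<le> 2.\<close>
  moreover have "\<bar>u p\<bar> \<le> 2 * exp 2 * exp (- exp (ln 2 / 2 * \<bar>p $ 3\<bar> powr \<epsilon>))" for p
  proof (cases p rule: slab_cases)
    case 1
    have "ln 2 / 2 * \<bar>p $ 3\<bar> powr \<epsilon> \<le> ln 2 / 2 * 2"
      using pow[OF 1] by (intro mult_left_mono) auto
    then have "exp (ln 2 / 2 * \<bar>p $ 3\<bar> powr \<epsilon>) \<le> exp (ln 2)"
      by (simp only: exp_le_cancel_iff)
    then have "(1 :: real) \<le> exp (2 - exp (ln 2 / 2 * \<bar>p $ 3\<bar> powr \<epsilon>))" by simp
    moreover have "exp (2 - z) = exp 2 * exp (- z)" for z :: real
      by (simp flip: exp_add)
    ultimately show ?thesis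
      using u_le_2[of p] by (metis mult.assoc mult_left_mono mult.right_neutral order_trans zero_le_numeral)
  next
    case (2 j)
    define z where "z = exp (ln 2 / 2 * \<bar>p $ 3\<bar> powr \<epsilon>)"
    have "ln 2 / 2 * \<bar>p $ 3\<bar> powr \<epsilon> \<le> ln 2 / 2 * (real j + 3)"
      using pow[OF 2(2)] by (intro mult_left_mono) auto
    then have "2 * (ln 2 / 2 * \<bar>p $ 3\<bar> powr \<epsilon>) \<le> ln 2 * real (j + 3)" by simp
    then have "exp (2 * (ln 2 / 2 * \<bar>p $ 3\<bar> powr \<epsilon>)) \<le> exp (ln 2 * real (j + 3))"
      by (simp only: exp_le_cancel_iff)
    also have "exp (ln 2 * real (j + 3)) = (2 :: real) ^ (j + 3)"
      by (simp only: exp_of_nat2_mult) simp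
    also have "exp (2 * (ln 2 / 2 * \<bar>p $ 3\<bar> powr \<epsilon>)) = z\<^sup>2" by (simp only: z_def exp_double)
    finally have "z\<^sup>2 \<le> 8 * 2 ^ j" by (simp add: power_add)
    moreover have "2 * 2 ^ j \<le> k (Suc j) * len j"
    proof -
      have "2 * 2 ^ j * 1 \<le> k (Suc j) * len j"
        using K len_ge_1[of j] by (intro mult_mono) (auto simp: k_def)
      then show ?thesis by simp
    qed
    moreover have "z - 1 \<le> z\<^sup>2 / 4"
      using zero_le_power2[of "z / 2 - 1"] by (simp add: power2_eq_square field_simps)
    ultimately have "- (k (Suc j) * len j) \<le> 2 - z" by linarith
    then have "exp (- (k (Suc j) * len j)) \<le> exp 2 * exp (- z)"
      by (simp flip: exp_add)
    then show ?thesis using u_decay[OF 2] by (simp add: z_def)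
  qed
  ultimately show ?thesis
    using coefficient_A potential_V nontrivial L
    by (intro exI[of _ A] exI[of _ V] exI[of _ u] conjI exI[of _ L] exI[of _ "2 * exp 2"] exI[of _ "ln 2 / 2"]) auto
qed

lemma super_exponential_decay:
  fixes \<epsilon> C0 :: real
  assumes \<epsilon>: "0 < \<epsilon>" "\<epsilon> \<le> 1 / 2"
    and mb: "\<And>X. 1 \<le> X 0 \<Longrightarrow> (\<And>i. 1 \<le> X (Suc i) - X i) \<Longrightarrow> modes_bounded X K C0"
  shows "\<exists>A V u. coefficient_matrix A \<and>
    grad_bounded_by A (\<lambda>p. (560 * C0 * inverse \<epsilon>) / (1 + \<bar>p $ 3\<bar>)) \<and>
    potential V \<and> nontrivial_solution A V u \<and>
    (\<exists>c>0. \<exists>C>0. \<forall>p. \<bar>u p\<bar> \<le> c * exp (- (C * \<bar>p $ 3\<bar> powr (1 / \<epsilon>))))"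
proof -
  \<comment> \<open>The exponent that solves
    \<open>\<rho> powr (1 / \<epsilon>) = 2 * \<rho>\<close>: each slab multiplies |x| by \<rho> and
    the decay exponent \<open>k (Suc j) * len j\<close> by 2 \<rho>.\<close>
  define a where "a = \<epsilon> / (1 - \<epsilon>)"
  define \<rho> where "\<rho> = 2 powr a"
  have a: "\<epsilon> \<le> a" "a \<le> 1" using \<epsilon> by (auto simp: a_def field_simps)
  have \<rho>: "1 + \<epsilon> / 2 \<le> \<rho>" "\<rho> \<le> 2"
  proof -
    have "ln (1 / 2) \<le> 1 / 2 - (1 :: real)" by (rule ln_le_minus_one) simp
    then have "1 / 2 \<le> ln (2 :: real)" by (simp add: ln_div)
    then have "\<epsilon> * (1 / 2) \<le> a * ln 2" using a \<epsilon> by (intro mult_mono) auto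
    moreover have "\<rho> = exp (a * ln 2)" by (simp add: \<rho>_def powr_def)
    ultimately show "1 + \<epsilon> / 2 \<le> \<rho>"
      using exp_ge_add_one_self[of "a * ln 2"] by argo
    show "\<rho> \<le> 2" using powr_mono[of a 1 2] a by (simp add: \<rho>_def)
  qed
  have \<rho>_pow: "\<rho> powr (1 / \<epsilon>) = 2 * \<rho>"
  proof -
    have "a * (1 / \<epsilon>) = 1 + a" using \<epsilon> by (simp add: a_def field_simps)
    then show ?thesis by (simp add: \<rho>_def powr_powr powr_add)
  qed
  \<comment> \<open>Chosen so that the gaps are exactly \<rho>^i. The assumption \<epsilon> \<le>
    1/2 enters through \<rho> \<le> 2, which gives x0 \<ge> 1; \<rho> \<ge> 1 + \<epsilon> / 2 gives
    x0 \<le> 2 / \<epsilon>.\<close>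
  define x0 where "x0 = 1 / (\<rho> - 1)"
  have x0: "1 \<le> x0" "x0 \<le> 2 / \<epsilon>" "x0 * (\<rho> - 1) = 1"
    using \<rho> \<epsilon> by (auto simp: x0_def field_simps)
  define X where "X i = x0 * \<rho> ^ i" for i :: nat
  have step: "X (Suc i) - X i = \<rho> ^ i" for i
  proof -
    have "X (Suc i) - X i = x0 * (\<rho> - 1) * \<rho> ^ i" by (simp add: X_def algebra_simps)
    also have "\<dots> = \<rho> ^ i" unfolding x0(3) by simp
    finally show ?thesis .
  qed
  have \<rho>1: "1 \<le> \<rho>" using \<rho> \<epsilon> by simp
  interpret modes_bounded X K C0
    by (rule mb) (use step x0 \<rho>1 in \<open>auto simp: X_def one_le_power\<close>)
  have len: "len i = \<rho> ^ i" for i by (simp add: len_def step)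
  have "grad_bounded_by A (\<lambda>p. (560 * C0 * inverse \<epsilon>) / (1 + \<bar>p $ 3\<bar>))"
  proof (rule grad_bounded)
    fix p i assume y: "X i < Y p" "Y p < X (Suc i)"
    have "1 + \<bar>p $ 3\<bar> \<le> 1 + X (Suc i)"
      using y abs_le_zeta[of "p $ 3"] by (simp add: Y_def)
    also have "\<dots> \<le> 2 * X (Suc i)" using X_ge_1[of "Suc i"] by simp
    also have "\<dots> = 2 * (x0 * \<rho>) * \<rho> ^ i" by (simp add: X_def)
    \<comment> \<open>The factor 8 / \<epsilon> found here, times 70, is the constant 560 /
      \<epsilon>.\<close>
    also have "\<dots> \<le> 2 * (2 / \<epsilon> * 2) * \<rho> ^ i"
      using x0 \<rho> \<rho>1 \<epsilon> by (intro mult_right_mono mult_left_mono mult_mono) auto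
    finally have "70 * C0 * (1 + \<bar>p $ 3\<bar>) \<le> 70 * C0 * (2 * (2 / \<epsilon> * 2) * \<rho> ^ i)"
      using C0 by (intro mult_left_mono) auto
    then have "70 * C0 * (1 + \<bar>p $ 3\<bar>) \<le> 560 * C0 * inverse \<epsilon> * len i"
      by (simp add: len divide_inverse mult_ac)
    then show "70 * C0 / len i \<le> (560 * C0 * inverse \<epsilon>) / (1 + \<bar>p $ 3\<bar>)"
      using len_pos[of i] by (simp add: pos_divide_le_eq pos_le_divide_eq add_pos_nonneg mult.commute)
  qed (use C0 \<epsilon> in simp)
  moreover
  \<comment> \<open>The normalization for which |x| \<le> x0 \<rho>^2 \<rho>^j becomes a bound by (2
    \<rho>)^j, a quantity that \<open>k (Suc j) * len j\<close> dominates.\<close>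
  define M where "M = (x0 * \<rho>\<^sup>2) powr (1 / \<epsilon>)"
  have M: "0 < M" using x0 \<rho>1 by (simp add: M_def)
  have pow: "1 / M * \<bar>p $ 3\<bar> powr (1 / \<epsilon>) \<le> (2 * \<rho>) ^ j" if "Y p \<le> X (Suc (Suc j))" for p j
  proof -
    have "\<bar>p $ 3\<bar> powr (1 / \<epsilon>) \<le> X (Suc (Suc j)) powr (1 / \<epsilon>)"
      using that abs_le_zeta[of "p $ 3"] \<epsilon> by (intro powr_mono2) (auto simp: Y_def)
    also have "X (Suc (Suc j)) = x0 * \<rho>\<^sup>2 * \<rho> ^ j" by (simp add: X_def power2_eq_square)
    also have "(x0 * \<rho>\<^sup>2 * \<rho> ^ j) powr (1 / \<epsilon>) = M * (\<rho> ^ j) powr (1 / \<epsilon>)"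
      using x0 \<rho>1 by (simp add: M_def powr_mult)
    also have "(\<rho> ^ j) powr (1 / \<epsilon>) = (2 * \<rho>) ^ j"
    proof -
      have "(\<rho> ^ j) powr (1 / \<epsilon>) = (\<rho> powr (1 / \<epsilon>)) ^ j"
        using \<rho>1 by (simp add: powr_powr mult.commute flip: powr_realpow)
      then show ?thesis by (simp add: \<rho>_pow)
    qed
    finally show ?thesis using M by (simp add: field_simps)
  qed
  have "\<bar>u p\<bar> \<le> 2 * exp 1 * exp (- (1 / M * \<bar>p $ 3\<bar> powr (1 / \<epsilon>)))" for p
  proof (cases p rule: slab_cases)
    case 1
    then have "1 / M * \<bar>p $ 3\<bar> powr (1 / \<epsilon>) \<le> 1"
      using pow[of p 0] X_mono_le[of 1 "Suc (Suc 0)"] by simp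
    then have "(1 :: real) \<le> exp (1 - 1 / M * \<bar>p $ 3\<bar> powr (1 / \<epsilon>))" by simp
    then have "2 * 1 \<le> 2 * exp (1 - 1 / M * \<bar>p $ 3\<bar> powr (1 / \<epsilon>))" by (intro mult_left_mono) auto
    then show ?thesis using u_le_2[of p] by (simp add: exp_diff exp_minus divide_inverse)
  next
    case (2 j)
    have "(2 * \<rho>) ^ j \<le> k (Suc j) * len j"
    proof -
      have "2 ^ j * \<rho> ^ j \<le> k (Suc j) * len j"
        unfolding len
        using K \<rho>1 by (intro mult_right_mono) (auto simp: k_def intro: order_trans[of _ "2 * 2 ^ j"])
      then show ?thesis by (simp add: power_mult_distrib)
    qed
    then have "exp (- (k (Suc j) * len j)) \<le> exp (- (1 / M * \<bar>p $ 3\<bar> powr (1 / \<epsilon>)))"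
      using pow[OF 2(2)] by (simp only: exp_le_cancel_iff)
    also have "\<dots> \<le> exp 1 * exp (- (1 / M * \<bar>p $ 3\<bar> powr (1 / \<epsilon>)))" by simp
    finally show ?thesis using u_decay[OF 2] by simp
  qed
  ultimately show ?thesis
    using coefficient_A potential_V nontrivial M
    by (intro exI[of _ A] exI[of _ V] exI[of _ u] conjI exI[of _ "2 * exp 1"] exI[of _ "1 / M"]) auto
qed

theorem theorem2:
  shows "\<exists>Cstar::real. Cstar > 0 \<and>
    (\<forall>\<epsilon>::real. 0 < \<epsilon> \<and> \<epsilon> \<le> 1 \<longrightarrow>
      (\<exists>A V u. coefficient_matrix A \<and>
        (\<exists>L>0. grad_bounded_by A (\<lambda>p. L / (1 + \<bar>p $ 3\<bar>) powr (1 - \<epsilon>))) \<and>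
        potential V \<and> nontrivial_solution A V u \<and>
        (\<exists>c>0. \<exists>C>0. \<forall>p. \<bar>u p\<bar> \<le> c * exp (- exp (C * \<bar>p $ 3\<bar> powr \<epsilon>))))) \<and>
    (\<forall>\<epsilon>::real. 0 < \<epsilon> \<and> \<epsilon> \<le> 1/2 \<longrightarrow>
      (\<exists>A V u. coefficient_matrix A \<and>
        grad_bounded_by A (\<lambda>p. (Cstar * inverse \<epsilon>) / (1 + \<bar>p $ 3\<bar>)) \<and>
        potential V \<and> nontrivial_solution A V u \<and>
        (\<exists>c>0. \<exists>C>0. \<forall>p. \<bar>u p\<bar> \<le> c * exp (- (C * \<bar>p $ 3\<bar> powr (1 / \<epsilon>))))))"
proof -
  obtain C0 where C0: "1 \<le> C0" and profile: "\<And>\<kappa> t. 1 \<le> \<kappa> \<Longrightarrow> \<bar>pa \<kappa> t\<bar> \<le> C0 \<and> - C0 / \<kappa> \<le> pa \<kappa> t \<and>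
    \<bar>pa' \<kappa> t\<bar> \<le> C0 \<and> \<bar>pb \<kappa> t\<bar> \<le> C0 / \<kappa> \<and> \<bar>pb' \<kappa> t\<bar> \<le> C0 \<and> \<bar>qb \<kappa> t\<bar> \<le> C0 / \<kappa> \<and> \<bar>qb' \<kappa> t\<bar> \<le> C0 \<and>
    \<bar>pg \<kappa> t\<bar> \<le> C0 / \<kappa> \<and> \<bar>pg' \<kappa> t\<bar> \<le> C0 \<and> \<bar>qg \<kappa> t\<bar> \<le> C0 / \<kappa> \<and> \<bar>qg' \<kappa> t\<bar> \<le> C0"
    using profile_bounds by blast
  \<comment> \<open>\<open>C0\<close> and \<open>K\<close> are fixed before \<epsilon> and the
    slabs, so the gradient constant in the second assertion is uniform in \<epsilon>.\<close>
  obtain K :: nat where K: "20 * C0 \<le> real K" using real_arch_simple by blast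
  then have "1 \<le> real K" using C0 by linarith
  then have K1: "1 \<le> K" by simp
  have mb: "modes_bounded X K C0" if "1 \<le> X 0" "\<And>i. 1 \<le> X (Suc i) - X i" for X
    by unfold_locales (use that K1 C0 K profile in blast)+
  show ?thesis
    using double_exponential_decay[OF _ _ mb] super_exponential_decay[OF _ _ mb] C0
    by (intro exI[of _ "560 * C0"]) simp
qed

end
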